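(* Let $\{X_n, n\ge 1\}$ be a sequence of independent random variables, identically distributed as $X$, in the sublinear expectation space $(\Omega,\mathcal{H},\mathbb{E})$. Let $p>0$, $r>1$, $q>\frac12$, $\beta>-q/r$, and suppose that $\mathbb{E}X=-\mathbb{E}(-X)=0$ in the case $\frac12<q\le 1$. Suppose that $\{a_{ni}, 1\le i\le n, n\ge 1\}$ is a triangular array of real numbers with $a_{ni}\approx (i/n)^{\beta}(1/n^{q})$. Then the following are equivalent: (i) $$\begin{cases} C_{\mathbb{V}}\left(|X|^{p}\right)<\infty, & \text{if } p>r/q,\\ C_{\mathbb{V}}\left(|X|^{r/q}\ln|X|\right)<\infty, & \text{if } p=r/q,\\ C_{\mathbb{V}}\left(|X|^{r/q}\right)<\infty, & \text{if } p<r/q;\end{cases}$$ (ii) for every $\epsilon>0$, $$\sum_{n=1}^{\infty}n^{r-2}\,C_{\mathbb{V}}\left(\left(\max_{1\le k\le n}\left|\sum_{i=1}^{k}a_{ni}X_{i}\right|^p-\epsilon\right)^{+}\right)<\infty.$$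
   Context: Setting. $(\Omega,\mathcal{F})$ is a measurable space and $\mathcal{H}$ is a set of real random variables on $(\Omega,\mathcal{F})$ such that $I_A\in\mathcal{H}$ for all $A\in\mathcal{F}$ and such that $X_1,\dots,X_n\in\mathcal{H}$ implies $\varphi(X_1,\dots,X_n)\in\mathcal{H}$ for every $\varphi\in C_{l,Lip}(\mathbb{R}^n)$, the space of functions satisfying $|\varphi(\mathbf{x})-\varphi(\mathbf{y})|\le C(1+|\mathbf{x}|^m+|\mathbf{y}|^m)|\mathbf{x}-\mathbf{y}|$ for all $\mathbf{x},\mathbf{y}\in\mathbb{R}^n$, with some $C>0$, $m\in\mathbb{N}$ depending on $\varphi$. A sublinear expectation is a functional $\mathbb{E}:\mathcal{H}\to[-\infty,\infty]$ such that for all $X,Y\in\mathcal{H}$: (a) $X\ge Y$ implies $\mathbb{E}[X]\ge\mathbb{E}[Y]$; (b) $\mathbb{E}[c]=c$ for $c\in\mathbb{R}$; (c) $\mathbb{E}[\lambda X]=\lambda\mathbb{E}[X]$ for $\lambda\ge0$; (d) $\mathbb{E}[X+Y]\le\mathbb{E}[X]+\mathbb{E}[Y]$ whenever the right side is not of the form $\infty-\infty$ or $-\infty+\infty$. Then $(\Omega,\mathcal{H},\mathbb{E})$ is a sublinear expectation space. Standing assumption: $\mathbb{E}$ is countably sub-additive, i.e. $\mathbb{E}(X)\le\sum_{n=1}^\infty\mathbb{E}(X_n)$ whenever $X\le\sum_{n=1}^\infty X_n$ with $X,X_n\in\mathcal{H}$, $X\ge0$, $X_n\ge0$. The capacity is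 $\mathbb{V}(A):=\mathbb{E}[I_A]$ for $A\in\mathcal{F}$, and the Choquet expectation of a random variable $X$ is $C_{\mathbb{V}}(X):=\int_0^\infty\mathbb{V}(X>x)\,dx+\int_{-\infty}^0(\mathbb{V}(X>x)-1)\,dx$. Independence. A random vector $\mathbf{Y}=(Y_1,\dots,Y_n)$, $Y_i\in\mathcal{H}$, is independent of $\mathbf{X}=(X_1,\dots,X_m)$, $X_i\in\mathcal{H}$, if for each Borel-measurable $\psi$ on $\mathbb{R}^m\times\mathbb{R}^n$ with $\psi(\mathbf{X},\mathbf{Y})\in\mathcal{H}$ and $\psi(\mathbf{x},\mathbf{Y})\in\mathcal{H}$ for each $\mathbf{x}\in\mathbb{R}^m$, one has $\mathbb{E}[\psi(\mathbf{X},\mathbf{Y})]=\mathbb{E}\big[\mathbb{E}[\psi(\mathbf{x},\mathbf{Y})]|_{\mathbf{x}=\mathbf{X}}\big]$ whenever $\bar\psi(\mathbf{x}):=\mathbb{E}[|\psi(\mathbf{x},\mathbf{Y})|]<\infty$ for each $\mathbf{x}$ and $\mathbb{E}[|\bar\psi(\mathbf{X})|]<\infty$. A sequence $(X_n)$ is a sequence of independent random variables if $X_{n+1}$ is independent of $(X_1,\dots,X_n)$ for each $n\ge1$. Identical distribution. $X$ and $Y$ are identically distributed if $\mathbb{E}[\psi(X)]=\mathbb{E}[\psi(Y)]$ for every Borel-measurable $\psi$ with $\psi(X),\psi(Y)\in\mathcal{H}$, whenever these sublinear expectations are finite. Notation. $x^+=\max\{x,0\}$. For the array, $a_{ni}\approx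 b_{ni}$ (with $b_{ni}>0$) means there is a constant $C\ge1$, independent of $i$ and $n$, with $C^{-1}b_{ni}\le a_{ni}\le C b_{ni}$ for all indices $i$ of the $n$-th row and all sufficiently large $n$. The expression $|X|^{s}\ln|X|$ ($s>0$) is read as $0$ where $X=0$. *)

theory Defs
  imports "HOL-Analysis.Analysis"
begin

(* Vectors of R^n are the elements of PiE {1..n} (\<lambda>_. UNIV), and Borel sets of R^n are those of
   PiM {1..n} (\<lambda>_. borel). *)

abbreviation borel_vec :: "nat \<Rightarrow> (nat \<Rightarrow> real) measure" where
  "borel_vec n \<equiv> PiM {1..n} (\<lambda>_. borel)"

abbreviation vec_norm :: "nat \<Rightarrow> (nat \<Rightarrow> real) \<Rightarrow> real" where
  "vec_norm n x \<equiv> L2_set x {1..n}"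

definition rvec :: "nat \<Rightarrow> (nat \<Rightarrow> 'a \<Rightarrow> real) \<Rightarrow> 'a \<Rightarrow> nat \<Rightarrow> real" where
  "rvec n X \<omega> = (\<lambda>i\<in>{1..n}. X i \<omega>)"

definition C_l_Lip :: "nat \<Rightarrow> ((nat \<Rightarrow> real) \<Rightarrow> real) set" where
  "C_l_Lip n = {\<phi>. \<exists>C m. C > 0 \<and>
     (\<forall>x \<in> PiE {1..n} (\<lambda>_. UNIV). \<forall>y \<in> PiE {1..n} (\<lambda>_. UNIV).
        \<bar>\<phi> x - \<phi> y\<bar>
          \<le> C * (1 + vec_norm n x ^ m + vec_norm n y ^ m) * vec_norm n (\<lambda>i. x i - y i))}"

(* Random variables are functions on the whole type 'a. The assumption H_cong makes membership in H
   depend only on the values on space M; by mono the same then holds for the functional \<E>. *)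

locale sublinear_expectation_space =
  fixes M :: "'a measure" and H :: "('a \<Rightarrow> real) set" and \<E> :: "('a \<Rightarrow> real) \<Rightarrow> ereal"
  assumes H_measurable: "H \<subseteq> borel_measurable M"
    and H_cong: "\<And>X Y. X \<in> H \<Longrightarrow> (\<And>\<omega>. \<omega> \<in> space M \<Longrightarrow> X \<omega> = Y \<omega>) \<Longrightarrow> Y \<in> H"
    and H_indicator: "\<And>A. A \<in> sets M \<Longrightarrow> indicator A \<in> H"
    and H_C_l_Lip: "\<And>n X \<phi>. n \<ge> 1 \<Longrightarrow> (\<And>i. i \<in> {1..n} \<Longrightarrow> X i \<in> H) \<Longrightarrow> \<phi> \<in> C_l_Lip n
          \<Longrightarrow> (\<lambda>\<omega>. \<phi> (rvec n X \<omega>)) \<in> H"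
    and mono: "\<And>X Y. X \<in> H \<Longrightarrow> Y \<in> H \<Longrightarrow> (\<And>\<omega>. \<omega> \<in> space M \<Longrightarrow> Y \<omega> \<le> X \<omega>) \<Longrightarrow> \<E> Y \<le> \<E> X"
    and const: "\<And>c. \<E> (\<lambda>_. c) = ereal c"
    and pos_homogeneous: "\<And>X l. X \<in> H \<Longrightarrow> l \<ge> 0 \<Longrightarrow> \<E> (\<lambda>\<omega>. l * X \<omega>) = ereal l * \<E> X"
    and subadditive: "\<And>X Y. X \<in> H \<Longrightarrow> Y \<in> H
          \<Longrightarrow> \<not> (\<E> X = \<infinity> \<and> \<E> Y = -\<infinity>) \<Longrightarrow> \<not> (\<E> X = -\<infinity> \<and> \<E> Y = \<infinity>)
          \<Longrightarrow> \<E> (\<lambda>\<omega>. X \<omega> + Y \<omega>) \<le> \<E> X + \<E> Y"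

definition countably_subadditive_exp ::
  "'a measure \<Rightarrow> ('a \<Rightarrow> real) set \<Rightarrow> (('a \<Rightarrow> real) \<Rightarrow> ereal) \<Rightarrow> bool" where
  "countably_subadditive_exp M H \<E> \<longleftrightarrow>
     (\<forall>X \<in> H. \<forall>Z :: nat \<Rightarrow> 'a \<Rightarrow> real.
        (\<forall>n. Z n \<in> H) \<longrightarrow>
        (\<forall>\<omega> \<in> space M. 0 \<le> X \<omega>) \<longrightarrow>
        (\<forall>n. \<forall>\<omega> \<in> space M. 0 \<le> Z n \<omega>) \<longrightarrow>
        (\<forall>\<omega> \<in> space M. ereal (X \<omega>) \<le> (\<Sum>n. ereal (Z n \<omega>))) \<longrightarrow>
        \<E> X \<le> (\<Sum>n. \<E> (Z n)))"

definition capacity :: "(('a \<Rightarrow> real) \<Rightarrow> ereal) \<Rightarrow> 'a set \<Rightarrow> ereal" where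
  "capacity \<E> A = \<E> (indicator A)"

(* Both integrals are Lebesgue integrals of [0,1]-valued functions and may be infinite. The second
   one is written as minus the integral of 1 - V(X > x). In the case \<infinity> - \<infinity> the value
   is \<infinity> (ereal convention); this does not arise when X is bounded below. *)

definition choquet :: "'a measure \<Rightarrow> (('a \<Rightarrow> real) \<Rightarrow> ereal) \<Rightarrow> ('a \<Rightarrow> real) \<Rightarrow> ereal" where
  "choquet M \<E> X =
     enn2ereal (\<integral>\<^sup>+x\<in>{0..}. e2ennreal (capacity \<E> {\<omega> \<in> space M. X \<omega> > x}) \<partial>lborel)
     - enn2ereal (\<integral>\<^sup>+x\<in>{..0}. e2ennreal (1 - capacity \<E> {\<omega> \<in> space M. X \<omega> > x}) \<partial>lborel)"

(* indep_of H \<E> m X n Y: (Y 1, ..., Y n) is independent of (X 1, ..., X m).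
   The iterated expectation and the moment condition are only meaningful if the functions of X
   obtained by integrating out Y lie in the domain H of \<E>; the two membership premises say so.
   Finiteness of all \<E>[|\<psi>(x,Y)|] makes the values converted by real_of_ereal finite. *)

definition indep_of :: "('a \<Rightarrow> real) set \<Rightarrow> (('a \<Rightarrow> real) \<Rightarrow> ereal) \<Rightarrow>
    nat \<Rightarrow> (nat \<Rightarrow> 'a \<Rightarrow> real) \<Rightarrow> nat \<Rightarrow> (nat \<Rightarrow> 'a \<Rightarrow> real) \<Rightarrow> bool" where
  "indep_of H \<E> m X n Y \<longleftrightarrow>
     (\<forall>\<psi> \<in> borel_measurable (borel_vec m \<Otimes>\<^sub>M borel_vec n).
        let \<psi>_mean = (\<lambda>x. \<E> (\<lambda>\<omega>. \<psi> (x, rvec n Y \<omega>)));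
            \<psi>_bar = (\<lambda>x. \<E> (\<lambda>\<omega>. \<bar>\<psi> (x, rvec n Y \<omega>)\<bar>))
        in (\<lambda>\<omega>. \<psi> (rvec m X \<omega>, rvec n Y \<omega>)) \<in> H \<longrightarrow>
           (\<forall>x \<in> PiE {1..m} (\<lambda>_. UNIV). (\<lambda>\<omega>. \<psi> (x, rvec n Y \<omega>)) \<in> H) \<longrightarrow>
           (\<forall>x \<in> PiE {1..m} (\<lambda>_. UNIV). \<psi>_bar x < \<infinity>) \<longrightarrow>
           (\<lambda>\<omega>. \<bar>real_of_ereal (\<psi>_bar (rvec m X \<omega>))\<bar>) \<in> H \<longrightarrow>
           \<E> (\<lambda>\<omega>. \<bar>real_of_ereal (\<psi>_bar (rvec m X \<omega>))\<bar>) < \<infinity> \<longrightarrow>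
           (\<lambda>\<omega>. real_of_ereal (\<psi>_mean (rvec m X \<omega>))) \<in> H \<longrightarrow>
           \<E> (\<lambda>\<omega>. \<psi> (rvec m X \<omega>, rvec n Y \<omega>))
             = \<E> (\<lambda>\<omega>. real_of_ereal (\<psi>_mean (rvec m X \<omega>))))"

(* The sequence is X 1, X 2, ...; the value X 0 is not used. *)

definition indep_seq ::
  "('a \<Rightarrow> real) set \<Rightarrow> (('a \<Rightarrow> real) \<Rightarrow> ereal) \<Rightarrow> (nat \<Rightarrow> 'a \<Rightarrow> real) \<Rightarrow> bool" where
  "indep_seq H \<E> X \<longleftrightarrow> (\<forall>n\<ge>1. indep_of H \<E> n X 1 (\<lambda>_. X (Suc n)))"

definition ident_distrib ::
  "('a \<Rightarrow> real) set \<Rightarrow> (('a \<Rightarrow> real) \<Rightarrow> ereal) \<Rightarrow> ('a \<Rightarrow> real) \<Rightarrow> ('a \<Rightarrow> real) \<Rightarrow> bool" where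
  "ident_distrib H \<E> X Y \<longleftrightarrow>
     (\<forall>\<psi> \<in> borel_measurable (borel :: real measure).
        (\<lambda>\<omega>. \<psi> (X \<omega>)) \<in> H \<longrightarrow> (\<lambda>\<omega>. \<psi> (Y \<omega>)) \<in> H \<longrightarrow>
        \<bar>\<E> (\<lambda>\<omega>. \<psi> (X \<omega>))\<bar> < \<infinity> \<longrightarrow> \<bar>\<E> (\<lambda>\<omega>. \<psi> (Y \<omega>))\<bar> < \<infinity> \<longrightarrow>
        \<E> (\<lambda>\<omega>. \<psi> (X \<omega>)) = \<E> (\<lambda>\<omega>. \<psi> (Y \<omega>)))"

definition array_approx :: "(nat \<Rightarrow> nat \<Rightarrow> real) \<Rightarrow> (nat \<Rightarrow> nat \<Rightarrow> real) \<Rightarrow> bool" where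
  "array_approx a b \<longleftrightarrow>
     (\<exists>C\<ge>1. \<forall>\<^sub>F n in sequentially. \<forall>i\<in>{1..n}. inverse C * b n i \<le> a n i \<and> a n i \<le> C * b n i)"

end

theory Submission
  imports Defs
begin

text \<open>
  Put $s = r/q$, $v(u) = V(|X| > u)$ and $b_{ni} = (i/n)^\beta n^{-q}$. Both conditions turn out
  to be the finiteness of one integral of the tail function $v$, namely $\int_1^\infty
  v(t)\,t^{p-1}\Lambda(t)\,dt$, where $\Lambda(t)$ is $t^{s-p}$, $1 + \ln t$ or $1$ according as
  $p < s$, $p = s$ or $p > s$. For (i) this is a change of variables in the Choquet integral
  (\<open>moment_condition_iff_tail_integral\<close>). The three regimes come from the array: up
  to constants, $\Lambda(t)$ is the size of $\sum_n n^{r-2} \sum_{i \le n} b_{ni}^p\,[b_{ni} \ge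
  1/t]$ (\<open>weighted_coeff_sum_upper\<close>). The indices $n/2 < i \le n$, for which $b_{ni}$
  is of order $n^{-q}$, already give a lower bound of this size
  (\<open>weighted_sum_lower\<close>).

  From (i) to (ii). Let $y > 0$ and truncate the summands $a_{ni}X_i$ at $\pm y/K$. Either some
  summand exceeds $y/K$, or the maximum of the truncated sums exceeds $y$. The events of the first
  kind contribute values of $v$ at multiples of $y/b_{ni}$; integrated over $y^p$ and summed over
  $i$ and $n$ they give the tail integral, by the bound for the array. The events of the second
  kind have capacity at most a constant times $B^{K/2}$, where $B$ is a multiple of
  $n^{-(q\theta-1)} y^{-\theta}$ that dominates $\sum_i (K|a_{ni}|/y)^\theta$ times the moment of
  order $\theta$ (\<open>max_weighted_sum_tail_le\<close>). Here $\theta = \min(s,2)$ if $q \le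
  1$, when the variables are centred, and $\theta = \min(s,1)$ if $q > 1$, when no centring is
  available. Since $q > 1/2$ and $r > 1$, always $q\theta > 1$, so for $K$ large these capacities
  form a convergent series.

  The exponential inequality is proved with the product of the variables $e^{\lambda Y_i}$,
  stopped as soon as a partial sum exceeds $y$ (\<open>exponential_maximal_inequality\<close>). A
  sublinear expectation has no conditional expectations and its independence is not symmetric, but
  one step at a time is enough: the next factor enters only through test functions $A(x) +
  B(x)g(y)$ with nonnegative bounded $A$, $B$, $g$, and for these the inner expectation $A(x) +
  B(x)\,E[g(Y)]$ gives again an element of $H$ (\<open>indep_affine\<close>).

  From (ii) to (i). The same kind of test function gives the exact formula $V(\bigcup_i \{X_i \in
  T_i\}) = 1 - \prod_i (1 - V(X_i \in T_i))$ (\<open>cap_union_indep\<close>). As a large summand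
  forces a large partial sum, the capacity that the maximum exceeds $u$ is at least $\frac14
  \min(1, n\,v(D n^q u))$. The terms with $n$ between $N$ and $2N$ have total weight of order
  $N^{r-1} \to \infty$, so a convergent series leaves no room for the minimum to be $1$ when $n$
  is large (\<open>tail_small_of_excess_series\<close>), and summation over $n$ gives the tail
  integral.
\<close>

section \<open>Power sums and elementary bounds\<close>

text \<open>
  For $\alpha \le 1$ the derivative $x^{\alpha-1}$ of $x^\alpha/\alpha$ does not increase, so its
  value at the right end point is below the mean slope. Both signs of $\alpha$ are used: positive
  for growing sums, negative for tails of convergent ones.
\<close>
lemma powr_le_increment:
  fixes x \<alpha> :: real
  assumes "x \<ge> 2" "\<alpha> \<le> 1" "\<alpha> \<noteq> 0"
  shows "x powr (\<alpha> - 1) \<le> (x powr \<alpha> - (x - 1) powr \<alpha>) / \<alpha>"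
proof -
  have "\<exists>z>x-1. z < x \<and> x powr \<alpha> / \<alpha> - (x-1) powr \<alpha> / \<alpha> = (x - (x - 1)) * z powr (\<alpha> - 1)"
    by (rule MVT2) (use assms in \<open>auto intro!: derivative_eq_intros simp: field_simps\<close>)
  then obtain z where z: "z > x - 1" "z < x"
    "x powr \<alpha> / \<alpha> - (x-1) powr \<alpha> / \<alpha> = z powr (\<alpha> - 1)" by auto
  have "x powr (\<alpha> - 1) \<le> z powr (\<alpha> - 1)"
    using z assms by (intro powr_mono2') auto
  with z show ?thesis by (simp add: diff_divide_distrib)
qed

lemma sum_powr_le:
  fixes \<alpha> :: real
  assumes "\<alpha> > 0"
  shows "\<exists>C>0. \<forall>n::nat. (\<Sum>i=1..n. real i powr (\<alpha> - 1)) \<le> C * real n powr \<alpha>"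
proof (cases "\<alpha> \<le> 1")
  case True
  have "(\<Sum>i=1..n. real i powr (\<alpha> - 1)) \<le> 1/\<alpha> * real n powr \<alpha>" for n :: nat
  proof (induction n)
    case (Suc n)
    show ?case
    proof (cases "n = 0")
      case False
      have "real (Suc n) powr (\<alpha> - 1) \<le> (real (Suc n) powr \<alpha> - real n powr \<alpha>) / \<alpha>"
        using powr_le_increment[of "real (Suc n)" \<alpha>] False True assms by simp
      with Suc show ?thesis by (simp add: diff_divide_distrib)
    qed (use True assms in \<open>auto simp: field_simps\<close>)
  qed simp
  with assms show ?thesis by (intro exI[of _ "1/\<alpha>"]) auto
next
  case False
  have "(\<Sum>i=1..n. real i powr (\<alpha> - 1)) \<le> 1 * real n powr \<alpha>" for n :: nat
  proof -
    have "(\<Sum>i=1..n. real i powr (\<alpha> - 1)) \<le> (\<Sum>i=1..n. real n powr (\<alpha> - 1))"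
      using False by (intro sum_mono powr_mono2) auto
    also have "\<dots> = real n powr \<alpha>"
      by (cases "n = 0") (auto simp: powr_diff)
    finally show ?thesis by simp
  qed
  then show ?thesis by (intro exI[of _ 1]) auto
qed

lemma sum_powr_le_cutoff:
  fixes \<alpha> :: real
  assumes "\<alpha> > 0"
  shows "\<exists>C>0. \<forall>m::nat. \<forall>N\<ge>0. (\<Sum>n\<in>{n\<in>{1..m}. real n \<le> N}. real n powr (\<alpha> - 1)) \<le> C * N powr \<alpha>"
proof -
  obtain C where C: "C > 0" "\<And>n::nat. (\<Sum>i=1..n. real i powr (\<alpha> - 1)) \<le> C * real n powr \<alpha>"
    using sum_powr_le[OF assms] by blast
  show ?thesis
  proof (intro exI[of _ C] conjI allI impI C(1))
    fix m :: nat and N :: real assume N: "N \<ge> 0"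
    have "(\<Sum>n\<in>{n\<in>{1..m}. real n \<le> N}. real n powr (\<alpha> - 1))
        \<le> (\<Sum>n\<in>{1..nat \<lfloor>N\<rfloor>}. real n powr (\<alpha> - 1))"
      by (intro sum_mono2) (auto simp: le_nat_floor)
    also have "\<dots> \<le> C * real (nat \<lfloor>N\<rfloor>) powr \<alpha>" by (rule C)
    also have "\<dots> \<le> C * N powr \<alpha>"
      using N C assms by (intro mult_left_mono powr_mono2) auto
    finally show "(\<Sum>n\<in>{n\<in>{1..m}. real n \<le> N}. real n powr (\<alpha> - 1)) \<le> C * N powr \<alpha>" .
  qed
qed

lemma sum_inverse_le_cutoff:
  fixes N :: real
  assumes "N \<ge> 1"
  shows "(\<Sum>n\<in>{n\<in>{1..m}. real n \<le> N}. 1 / real n) \<le> 1 + ln N"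
proof -
  have *: "(\<Sum>n=1..k. 1 / real n) \<le> 1 + ln (real k)" if "k \<ge> 1" for k :: nat
    using that
  proof (induction k rule: dec_induct)
    case (step k)
    have "ln (real k / real (Suc k)) \<le> real k / real (Suc k) - 1"
      using step by (intro ln_le_minus_one) auto
    moreover have "ln (real k / real (Suc k)) = ln (real k) - ln (real (Suc k))"
      using step by (simp add: ln_div)
    moreover have "real k / real (Suc k) - 1 = - (1 / real (Suc k))"
      by (simp add: field_simps)
    ultimately show ?case using step by simp
  qed simp
  have k: "nat \<lfloor>N\<rfloor> \<ge> 1" using assms by linarith
  have "(\<Sum>n\<in>{n\<in>{1..m}. real n \<le> N}. 1 / real n) \<le> (\<Sum>n\<in>{1..nat \<lfloor>N\<rfloor>}. 1 / real n)"
    by (intro sum_mono2) (auto simp: le_nat_floor)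
  also have "\<dots> \<le> 1 + ln (real (nat \<lfloor>N\<rfloor>))" by (rule *[OF k])
  also have "\<dots> \<le> 1 + ln N" using assms k by simp
  finally show ?thesis .
qed

lemma sum_powr_le_tail:
  fixes \<delta> N :: real
  assumes "\<delta> > 0" "N \<ge> 1"
  shows "(\<Sum>n\<in>{n\<in>{1..m}. real n > N}. real n powr (- \<delta> - 1)) \<le> 2 powr \<delta> / \<delta> * N powr (- \<delta>)"
proof -
  define k where "k = nat \<lfloor>N\<rfloor>"
  have k1: "k \<ge> 1" using assms unfolding k_def by linarith
  moreover have "N < real k + 1" unfolding k_def by linarith
  ultimately have k: "k \<ge> 1" "real k \<ge> N / 2" by linarith+
  have *: "(\<Sum>n=k+1..l. real n powr (-\<delta>-1)) \<le> (real k powr (-\<delta>) - real l powr (-\<delta>)) / \<delta>"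
    if "l \<ge> k" for l
    using that
  proof (induction l rule: dec_induct)
    case (step l)
    have "real (Suc l) powr (-\<delta> - 1) \<le> (real (Suc l) powr (-\<delta>) - real l powr (-\<delta>)) / (-\<delta>)"
      using powr_le_increment[of "real (Suc l)" "-\<delta>"] assms k step by simp
    with step show ?case by (simp add: diff_divide_distrib)
  qed simp
  have "(\<Sum>n\<in>{n\<in>{1..m}. real n > N}. real n powr (- \<delta> - 1))
      \<le> (\<Sum>n=k+1..max k m. real n powr (-\<delta>-1))"
    unfolding k_def by (intro sum_mono2) (use assms in \<open>auto simp: Suc_le_eq floor_less_iff nat_less_iff\<close>)
  also have "\<dots> \<le> (real k powr (-\<delta>) - real (max k m) powr (-\<delta>)) / \<delta>" by (rule *) simp
  also have "\<dots> \<le> real k powr (-\<delta>) / \<delta>" using assms by (simp add: field_simps)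
  also have "\<dots> \<le> (N/2) powr (-\<delta>) / \<delta>"
    using k assms by (intro divide_right_mono powr_mono2') auto
  also have "(N/2) powr (-\<delta>) = 2 powr \<delta> * N powr (-\<delta>)"
    using assms by (simp add: powr_divide powr_minus field_simps)
  finally show ?thesis by simp
qed

text \<open>
  This and the next lemma bound exponential moments of bounded variables by absolute moments of
  order $\theta$. Without centring the linear term must be absorbed, which restricts $\theta$ to
  at most $1$.
\<close>
lemma exp_minus_one_le:
  fixes u \<theta> :: real
  assumes "u \<ge> 0" "0 < \<theta>" "\<theta> \<le> 1"
  shows "exp u - 1 \<le> u powr \<theta> * exp u"
proof (cases "u \<le> 1")
  case True
  have "1 - u \<le> exp (-u)" using exp_ge_add_one_self[of "-u"] by simp
  then have "exp u - 1 \<le> u * exp u" by (simp add: exp_minus field_simps)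
  have "u \<le> u powr \<theta>"
  proof (cases "u = 0")
    case False
    then have "u powr 1 \<le> u powr \<theta>" using True assms by (intro powr_mono') auto
    then show ?thesis using assms by simp
  qed simp
  then have "u * exp u \<le> u powr \<theta> * exp u" by (intro mult_right_mono) auto
  with \<open>exp u - 1 \<le> u * exp u\<close> show ?thesis by linarith
next
  case False
  then have "1 \<le> u powr \<theta>" using assms by (intro ge_one_powr_ge_zero) auto
  then have "exp u \<le> u powr \<theta> * exp u" by simp
  then show ?thesis by linarith
qed

lemma exp_minus_one_minus_le:
  fixes u \<theta> :: real
  assumes "1 \<le> \<theta>" "\<theta> \<le> 2"
  shows "exp u - 1 - u \<le> \<bar>u\<bar> powr \<theta> * exp \<bar>u\<bar>"
proof (cases "\<bar>u\<bar> \<le> 1")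
  case True
  have le: "exp u - 1 \<le> u * exp u"
    using exp_ge_add_one_self[of "-u"] by (simp add: exp_minus field_simps)
  have sq: "\<bar>u\<bar>^2 \<le> \<bar>u\<bar> powr \<theta>"
  proof (cases "u = 0")
    case False
    then have "\<bar>u\<bar> powr 2 \<le> \<bar>u\<bar> powr \<theta>" using True assms by (intro powr_mono') auto
    then show ?thesis using False by simp
  qed simp
  have "exp u - 1 - u \<le> u * (exp u - 1)" using le by (simp add: algebra_simps)
  also have "\<dots> \<le> \<bar>u\<bar>^2 * exp \<bar>u\<bar>"
  proof (cases "u \<ge> 0")
    case True
    then have "u * (exp u - 1) \<le> u * (u * exp u)" using le by (intro mult_left_mono) auto
    then show ?thesis using True by (simp add: power2_eq_square mult.assoc)
  next
    case False
    then have "(-u) * (1 - exp u) \<le> (-u) * (-u)"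
      using exp_ge_add_one_self[of u] by (intro mult_left_mono) linarith+
    also have "\<dots> \<le> \<bar>u\<bar>^2 * exp \<bar>u\<bar>"
      using mult_left_mono[of 1 "exp \<bar>u\<bar>" "\<bar>u\<bar>^2"] by (simp add: power2_eq_square)
    finally show ?thesis by (simp add: algebra_simps)
  qed
  also have "\<dots> \<le> \<bar>u\<bar> powr \<theta> * exp \<bar>u\<bar>" using sq by (intro mult_right_mono) auto
  finally show ?thesis .
next
  case False
  have "\<bar>u\<bar> powr 1 \<le> \<bar>u\<bar> powr \<theta>" using False assms by (intro powr_mono) auto
  then have u: "\<bar>u\<bar> \<le> \<bar>u\<bar> powr \<theta>" by simp
  have "\<bar>u\<bar> * exp \<bar>u\<bar> \<le> \<bar>u\<bar> powr \<theta> * exp \<bar>u\<bar>" using u by (intro mult_right_mono) auto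
  moreover have "1 * exp \<bar>u\<bar> \<le> \<bar>u\<bar> * exp \<bar>u\<bar>" using False by (intro mult_right_mono) auto
  moreover have "\<bar>u\<bar> * 1 \<le> \<bar>u\<bar> * exp \<bar>u\<bar>" by (intro mult_left_mono) auto
  moreover have "exp u - 1 - u \<le> max \<bar>u\<bar> (exp \<bar>u\<bar>)"
  proof (cases "u \<ge> 0")
    case False
    then have "exp u \<le> 1" by simp
    then show ?thesis using False by linarith
  qed (auto simp: max_def)
  ultimately show ?thesis by linarith
qed

section \<open>Integrals over half-lines\<close>

text \<open>
  Exhausting the half-line by $[a, a+n]$ reduces the claim to compact intervals, where the
  substitution rule is available.
\<close>
lemma nn_integral_substitution_at_top:
  fixes f g g' :: "real \<Rightarrow> real"
  assumes f: "f \<in> borel_measurable borel"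
    and deriv: "\<And>u. u \<ge> a \<Longrightarrow> (g has_real_derivative g' u) (at u)"
    and cont: "continuous_on {a..} g'"
    and nonneg: "\<And>u. u \<ge> a \<Longrightarrow> g' u \<ge> 0"
    and lim: "filterlim g at_top at_top"
  shows "(\<integral>\<^sup>+x\<in>{g a..}. ennreal (f x) \<partial>lborel) = (\<integral>\<^sup>+u\<in>{a..}. ennreal (f (g u) * g' u) \<partial>lborel)"
proof -
  have gmono: "g x \<le> g y" if "a \<le> x" "x \<le> y" for x y
    using that by (intro DERIV_nonneg_imp_nondecreasing[of x y g])
      (auto intro!: exI[of _ "g' _"] deriv nonneg)
  have A: "(\<integral>\<^sup>+x\<in>{g a..}. ennreal (f x) \<partial>lborel)
      = (SUP n. \<integral>\<^sup>+x. ennreal (f x * indicator {g a..g (a + real n)} x) \<partial>lborel)"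
  proof -
    have "(SUP n. ennreal (f x * indicator {g a..g (a + real n)} x))
        = ennreal (f x) * indicator {g a..} x" for x
    proof -
      obtain n0 :: nat where n0: "\<And>n. n \<ge> n0 \<Longrightarrow> x \<le> g (a + real n)"
      proof -
        have "filterlim (\<lambda>n. a + real n) at_top sequentially"
          by (rule filterlim_tendsto_add_at_top[OF tendsto_const filterlim_real_sequentially])
        from filterlim_compose[OF lim this] have "eventually (\<lambda>n. x \<le> g (a + real n)) sequentially"
          by (simp add: filterlim_at_top)
        then show ?thesis using that by (auto simp: eventually_sequentially)
      qed
      show ?thesis
      proof (rule antisym)
        show "(SUP n. ennreal (f x * indicator {g a..g (a + real n)} x))
            \<le> ennreal (f x) * indicator {g a..} x"
          by (rule SUP_least) (auto simp: indicator_def)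
        show "ennreal (f x) * indicator {g a..} x
            \<le> (SUP n. ennreal (f x * indicator {g a..g (a + real n)} x))"
          by (rule SUP_upper2[of n0]) (use n0[of n0] in \<open>auto simp: indicator_def\<close>)
      qed
    qed
    then have "(\<integral>\<^sup>+x\<in>{g a..}. ennreal (f x) \<partial>lborel)
        = (\<integral>\<^sup>+x. (SUP n. ennreal (f x * indicator {g a..g (a + real n)} x)) \<partial>lborel)"
      by simp
    also have "\<dots> = (SUP n. \<integral>\<^sup>+x. ennreal (f x * indicator {g a..g (a + real n)} x) \<partial>lborel)"
    proof (rule nn_integral_monotone_convergence_SUP)
      show "incseq (\<lambda>n x. ennreal (f x * indicator {g a..g (a + real n)} x))"
      proof (rule incseq_SucI, rule le_funI)
        fix n x
        show "ennreal (f x * indicator {g a..g (a + real n)} x)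
            \<le> ennreal (f x * indicator {g a..g (a + real (Suc n))} x)"
          using gmono[of "a + real n" "a + real (Suc n)"] by (auto simp: indicator_def)
      qed
    qed (use f in measurable)
    finally show ?thesis .
  qed
  have cg: "continuous_on {a..} g"
    using deriv by (intro continuous_at_imp_continuous_on) (auto intro: DERIV_isCont)
  have m: "(\<lambda>u. f (g u) * g' u * indicator {a..} u) \<in> borel_measurable borel"
  proof -
    have "(\<lambda>u. if u \<in> {a..} then g u else 0) \<in> borel_measurable borel"
      by (rule borel_measurable_continuous_on_if) (auto intro: cg)
    then have "(\<lambda>u. f (if u \<in> {a..} then g u else 0)) \<in> borel_measurable borel"
      using measurable_compose[OF _ f] by blast
    moreover have "(\<lambda>u. if u \<in> {a..} then g' u else 0) \<in> borel_measurable borel"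
      by (rule borel_measurable_continuous_on_if) (auto intro: cont)
    ultimately have "(\<lambda>u. f (if u \<in> {a..} then g u else 0) * (if u \<in> {a..} then g' u else 0))
        \<in> borel_measurable borel" by simp
    moreover have "(\<lambda>u. f (if u \<in> {a..} then g u else 0) * (if u \<in> {a..} then g' u else 0))
        = (\<lambda>u. f (g u) * g' u * indicator {a..} u)" by (auto simp: indicator_def)
    ultimately show ?thesis by simp
  qed
  have B: "(\<integral>\<^sup>+u\<in>{a..}. ennreal (f (g u) * g' u) \<partial>lborel)
      = (SUP n. \<integral>\<^sup>+u. ennreal (f (g u) * g' u * indicator {a..a + real n} u) \<partial>lborel)"
  proof -
    have "(SUP n. ennreal (f (g u) * g' u * indicator {a..a + real n} u))
        = ennreal (f (g u) * g' u) * indicator {a..} u" for u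
    proof (rule antisym)
      show "(SUP n. ennreal (f (g u) * g' u * indicator {a..a + real n} u))
          \<le> ennreal (f (g u) * g' u) * indicator {a..} u"
        by (rule SUP_least) (auto simp: indicator_def)
      obtain n0 :: nat where "u - a \<le> real n0" using real_arch_simple by blast
      then show "ennreal (f (g u) * g' u) * indicator {a..} u
          \<le> (SUP n. ennreal (f (g u) * g' u * indicator {a..a + real n} u))"
        by (intro SUP_upper2[of n0]) (auto simp: indicator_def)
    qed
    then have "(\<integral>\<^sup>+u\<in>{a..}. ennreal (f (g u) * g' u) \<partial>lborel)
        = (\<integral>\<^sup>+u. (SUP n. ennreal (f (g u) * g' u * indicator {a..a + real n} u)) \<partial>lborel)"
      by simp
    also have "\<dots> = (SUP n. \<integral>\<^sup>+u. ennreal (f (g u) * g' u * indicator {a..a + real n} u) \<partial>lborel)"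
    proof (rule nn_integral_monotone_convergence_SUP)
      show "incseq (\<lambda>n u. ennreal (f (g u) * g' u * indicator {a..a + real n} u))"
        by (rule incseq_SucI, rule le_funI) (auto simp: indicator_def)
      fix n :: nat
      have "(\<lambda>u. (f (g u) * g' u * indicator {a..} u) * indicator {a..a + real n} u)
          \<in> borel_measurable borel"
        using m by measurable
      also have "(\<lambda>u. (f (g u) * g' u * indicator {a..} u) * indicator {a..a + real n} u)
          = (\<lambda>u. f (g u) * g' u * indicator {a..a + real n} u)"
        by (auto simp: indicator_def)
      finally show "(\<lambda>u. ennreal (f (g u) * g' u * indicator {a..a + real n} u))
          \<in> borel_measurable lborel" by simp
    qed
    finally show ?thesis .
  qed
  have "(\<integral>\<^sup>+x. ennreal (f x * indicator {g a..g (a + real n)} x) \<partial>lborel)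
      = (\<integral>\<^sup>+u. ennreal (f (g u) * g' u * indicator {a..a + real n} u) \<partial>lborel)" for n
    by (rule nn_integral_substitution)
      (use f in \<open>auto intro!: deriv nonneg continuous_on_subset[OF cont] simp: set_borel_measurable_def\<close>)
  with A B show ?thesis by simp
qed

lemma filterlim_powr_at_top:
  fixes c :: real
  assumes "c > 0"
  shows "filterlim (\<lambda>t. t powr c) at_top at_top"
  unfolding filterlim_at_top
proof
  fix Z :: real
  show "eventually (\<lambda>t. Z \<le> t powr c) at_top"
    using eventually_ge_at_top[of "max 0 Z powr (1/c)"]
  proof eventually_elim
    case (elim t)
    have "Z \<le> (max 0 Z powr (1/c)) powr c" using assms by (simp add: powr_powr)
    also have "\<dots> \<le> t powr c" using elim assms by (intro powr_mono2) auto
    finally show ?case .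
  qed
qed

lemma nn_integral_interval_le:
  fixes f :: "real \<Rightarrow> real"
  assumes "\<And>x. x \<in> {a..b} \<Longrightarrow> f x \<le> c" "a \<le> b" "c \<ge> 0"
  shows "(\<integral>\<^sup>+x\<in>{a..b}. ennreal (f x) \<partial>lborel) \<le> ennreal (c * (b - a))"
proof -
  have "(\<integral>\<^sup>+x\<in>{a..b}. ennreal (f x) \<partial>lborel) \<le> (\<integral>\<^sup>+x. ennreal c * indicator {a..b} x \<partial>lborel)"
    using assms(1) by (intro nn_integral_mono) (auto simp: indicator_def intro!: ennreal_leI)
  also have "\<dots> = ennreal (c * (b - a))"
    using assms by (simp add: nn_integral_cmult_indicator ennreal_mult)
  finally show ?thesis .
qed

lemma nn_integral_split_at:
  fixes f :: "real \<Rightarrow> real"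
  assumes [measurable]: "f \<in> borel_measurable borel" and "a \<le> b"
  shows "(\<integral>\<^sup>+x\<in>{a..}. ennreal (f x) \<partial>lborel)
    \<le> (\<integral>\<^sup>+x\<in>{a..b}. ennreal (f x) \<partial>lborel) + (\<integral>\<^sup>+x\<in>{b..}. ennreal (f x) \<partial>lborel)"
proof -
  have "(\<integral>\<^sup>+x\<in>{a..}. ennreal (f x) \<partial>lborel)
      \<le> (\<integral>\<^sup>+x. ennreal (f x) * indicator {a..b} x + ennreal (f x) * indicator {b..} x \<partial>lborel)"
    by (intro nn_integral_mono) (auto simp: indicator_def)
  also have "\<dots> = (\<integral>\<^sup>+x\<in>{a..b}. ennreal (f x) \<partial>lborel) + (\<integral>\<^sup>+x\<in>{b..}. ennreal (f x) \<partial>lborel)"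
    by (rule nn_integral_add) measurable
  finally show ?thesis .
qed

lemma nn_integral_finite_mono:
  fixes f g :: "real \<Rightarrow> real"
  assumes "(\<integral>\<^sup>+x\<in>A. ennreal (g x) \<partial>lborel) < \<infinity>" "\<And>x. x \<in> A \<Longrightarrow> f x \<le> C * g x" "C \<ge> 0"
    "\<And>x. x \<in> A \<Longrightarrow> g x \<ge> 0"
    and [measurable]: "A \<in> sets borel" "g \<in> borel_measurable borel"
  shows "(\<integral>\<^sup>+x\<in>A. ennreal (f x) \<partial>lborel) < \<infinity>"
proof -
  have "(\<integral>\<^sup>+x\<in>A. ennreal (f x) \<partial>lborel) \<le> (\<integral>\<^sup>+x. ennreal C * (ennreal (g x) * indicator A x) \<partial>lborel)"
    using assms(2-4)
    by (intro nn_integral_mono) (auto simp: indicator_def ennreal_mult[symmetric] intro!: ennreal_leI)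
  also have "\<dots> = ennreal C * (\<integral>\<^sup>+x\<in>A. ennreal (g x) \<partial>lborel)"
    by (rule nn_integral_cmult) measurable
  also have "\<dots> < \<infinity>" using assms(1) by (simp add: ennreal_mult_less_top)
  finally show ?thesis .
qed

lemma nn_integral_shifted_powr_finite:
  fixes \<sigma> \<epsilon> :: real
  assumes "\<sigma> > 1" "\<epsilon> > 0"
  shows "(\<integral>\<^sup>+x\<in>{0..}. ennreal ((x + \<epsilon>) powr (- \<sigma>)) \<partial>lborel) < \<infinity>"
proof -
  have "(\<integral>\<^sup>+x\<in>{0..}. ennreal ((x + \<epsilon>) powr (- \<sigma>)) \<partial>lborel)
      = ennreal (0 - (- ((0 + \<epsilon>) powr (1 - \<sigma>) / (\<sigma> - 1))))"
  proof (rule nn_integral_FTC_atLeast)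
    show "((\<lambda>x. - ((x + \<epsilon>) powr (1 - \<sigma>) / (\<sigma> - 1))) has_real_derivative (x + \<epsilon>) powr (- \<sigma>)) (at x)"
      if "0 \<le> x" for x
    proof -
      have "((\<lambda>x. - ((x + \<epsilon>) powr (1 - \<sigma>) / (\<sigma> - 1))) has_real_derivative
          - ((1 - \<sigma>) * (x + \<epsilon>) powr (1 - \<sigma> - 1) / (\<sigma> - 1))) (at x)"
        using that assms by (auto intro!: derivative_eq_intros)
      also have "- ((1 - \<sigma>) * (x + \<epsilon>) powr (1 - \<sigma> - 1) / (\<sigma> - 1)) = (x + \<epsilon>) powr (- \<sigma>)"
      proof -
        have "- ((1 - \<sigma>) * z / (\<sigma> - 1)) = z" for z
        proof -
          have "- ((1 - \<sigma>) * z) = z * (\<sigma> - 1)" by (simp add: algebra_simps)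
          then have "- ((1 - \<sigma>) * z / (\<sigma> - 1)) = z * (\<sigma> - 1) / (\<sigma> - 1)" by (metis minus_divide_left)
          then show ?thesis using assms by simp
        qed
        then show ?thesis by simp
      qed
      finally show ?thesis .
    qed
    have "filterlim (\<lambda>x. (x + \<epsilon>) powr (\<sigma> - 1)) at_top at_top"
    proof (rule filterlim_at_top_mono[OF filterlim_powr_at_top[of "\<sigma> - 1"]])
      show "eventually (\<lambda>x. x powr (\<sigma> - 1) \<le> (x + \<epsilon>) powr (\<sigma> - 1)) at_top"
        using eventually_ge_at_top[of 0] by eventually_elim (use assms in \<open>auto intro: powr_mono2\<close>)
    qed (use assms in auto)
    then have "((\<lambda>x. inverse ((x + \<epsilon>) powr (\<sigma> - 1))) \<longlongrightarrow> 0) at_top"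
      by (rule tendsto_inverse_0_at_top)
    then have "((\<lambda>x. - (inverse ((x + \<epsilon>) powr (\<sigma> - 1)) / (\<sigma> - 1))) \<longlongrightarrow> - (0 / (\<sigma> - 1))) at_top"
      using assms by (intro tendsto_intros) auto
    moreover have "inverse ((x + \<epsilon>) powr (\<sigma> - 1)) = (x + \<epsilon>) powr (1 - \<sigma>)" for x
      by (simp add: powr_minus[symmetric])
    ultimately show "((\<lambda>x. - ((x + \<epsilon>) powr (1 - \<sigma>) / (\<sigma> - 1))) \<longlongrightarrow> 0) at_top" by simp
  qed (use assms in auto)
  then show ?thesis by simp
qed

lemma suminf_finite_if_eventually_le:
  fixes f g :: "nat \<Rightarrow> ennreal"
  assumes "\<And>n. f n < \<infinity>" "\<And>n. n \<ge> N \<Longrightarrow> f n \<le> g n" "(\<Sum>n. g n) < \<infinity>"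
  shows "(\<Sum>n. f n) < \<infinity>"
proof -
  have "(\<Sum>n. f n) \<le> (\<Sum>n. (if n < N then f n else 0) + g n)"
    using assms(2) by (intro suminf_le summableI) (auto simp: not_less add_increasing2)
  also have "\<dots> = (\<Sum>n. if n < N then f n else 0) + (\<Sum>n. g n)"
    by (rule suminf_add[symmetric]) (auto intro: summableI)
  also have "(\<Sum>n. if n < N then f n else 0) = (\<Sum>n<N. if n < N then f n else 0)"
    by (rule suminf_finite) auto
  also have "\<dots> < \<infinity>" using assms(1) by (auto simp: ennreal_sum_less_top less_top)
  finally show ?thesis using assms(3) by (auto simp: order.strict_trans1)
qed

lemma antimono_borel_measurable:
  fixes f :: "real \<Rightarrow> real"
  assumes "antimono f"
  shows "f \<in> borel_measurable borel"
proof -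
  have "mono (\<lambda>x. - f x)" using assms by (auto simp: antimono_def mono_def)
  then have "(\<lambda>x. - (- f x)) \<in> borel_measurable borel"
    by (intro borel_measurable_uminus borel_measurable_mono)
  then show ?thesis by simp
qed

text \<open>
  The value at the right end point is a minorant on each cell, because the function decreases.
\<close>
lemma lower_sum_le_integral:
  fixes c :: "real \<Rightarrow> real"
  assumes "antimono c" "\<And>x. c x \<ge> 0" "h > 0"
  shows "ennreal (\<Sum>n<m. h * c (real (Suc n) * h)) \<le> (\<integral>\<^sup>+x\<in>{0..<real m * h}. ennreal (c x) \<partial>lborel)"
proof (induction m)
  case (Suc m)
  have [measurable]: "c \<in> borel_measurable borel" by (rule antimono_borel_measurable[OF assms(1)])
  have "ennreal (h * c (real (Suc m) * h))
      = (\<integral>\<^sup>+x\<in>{real m * h..<real (Suc m) * h}. ennreal (c (real (Suc m) * h)) \<partial>lborel)"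
  proof -
    have "(\<integral>\<^sup>+x\<in>{real m * h..<real (Suc m) * h}. ennreal (c (real (Suc m) * h)) \<partial>lborel)
        = ennreal (c (real (Suc m) * h)) * emeasure lborel {real m * h..<real (Suc m) * h}"
      by (rule nn_integral_cmult_indicator) simp
    also have "emeasure lborel {real m * h..<real (Suc m) * h} = ennreal h"
      using assms(3) by (simp add: algebra_simps)
    finally show ?thesis using assms by (simp add: ennreal_mult[symmetric] mult.commute)
  qed
  also have "\<dots> \<le> (\<integral>\<^sup>+x\<in>{real m * h..<real (Suc m) * h}. ennreal (c x) \<partial>lborel)"
    using antimonoD[OF assms(1)]
    by (intro nn_integral_mono) (auto simp: indicator_def intro!: ennreal_leI)
  finally have 1: "ennreal (h * c (real (Suc m) * h)) \<le> \<dots>" .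
  have "ennreal (\<Sum>n<Suc m. h * c (real (Suc n) * h))
      = ennreal (\<Sum>n<m. h * c (real (Suc n) * h)) + ennreal (h * c (real (Suc m) * h))"
    using assms by (simp add: ennreal_plus sum_nonneg)
  also have "\<dots> \<le> (\<integral>\<^sup>+x\<in>{0..<real m * h}. ennreal (c x) \<partial>lborel)
      + (\<integral>\<^sup>+x\<in>{real m * h..<real (Suc m) * h}. ennreal (c x) \<partial>lborel)"
    by (intro add_mono Suc 1)
  also have "\<dots> = (\<integral>\<^sup>+x\<in>{0..<real (Suc m) * h}. ennreal (c x) \<partial>lborel)"
  proof -
    have mh: "0 \<le> real m * h" "real m * h \<le> real (Suc m) * h" using assms(3) by auto
    show ?thesis
      by (subst nn_integral_add[symmetric])
        (use mh in \<open>auto intro!: nn_integral_cong simp: indicator_def\<close>)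
  qed
  finally show ?case .
qed simp

section \<open>The moment weight and the coefficients of the array\<close>

text \<open>
  The weight $\Lambda$ that converts all three moment conditions into one tail integral.
\<close>
definition moment_weight :: "real \<Rightarrow> real \<Rightarrow> real \<Rightarrow> real" where
  "moment_weight s p t = (if p < s then t powr (s - p) else if p = s then 1 + ln t else 1)"

lemma moment_weight_nonneg: "t \<ge> 1 \<Longrightarrow> moment_weight s p t \<ge> 0"
  by (auto simp: moment_weight_def)

lemma moment_weight_measurable [measurable]: "moment_weight s p \<in> borel_measurable borel"
  unfolding moment_weight_def by measurable

lemma moment_weight_scale:
  assumes "c > 0"
  shows "\<exists>C>0. \<forall>t\<ge>1. c * t \<ge> 1 \<longrightarrow> moment_weight s p (c * t) \<le> C * moment_weight s p t"
proof -
  consider "p < s" | "p = s" | "p > s" by linarith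
  then show ?thesis
  proof cases
    case 1
    with assms show ?thesis
      by (intro exI[of _ "c powr (s - p)"]) (auto simp: moment_weight_def powr_mult)
  next
    case 2
    have "1 + ln (c * t) \<le> (1 + \<bar>ln c\<bar>) * (1 + ln t)" if "t \<ge> 1" for t
    proof -
      have "ln (c * t) = ln c + ln t" using assms that by (simp add: ln_mult)
      moreover have "0 \<le> \<bar>ln c\<bar> * ln t" using that by simp
      ultimately show ?thesis by (simp add: algebra_simps)
    qed
    with 2 show ?thesis
      by (intro exI[of _ "1 + \<bar>ln c\<bar>"]) (auto simp: moment_weight_def add_pos_nonneg)
  next
    case 3
    then show ?thesis by (intro exI[of _ 1]) (auto simp: moment_weight_def)
  qed
qed

lemma moment_weight_mono:
  assumes "1 \<le> t" "t \<le> t'"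
  shows "moment_weight s p t \<le> moment_weight s p t'"
  using assms by (auto simp: moment_weight_def intro: powr_mono2)

lemma powr_le_moment_weight:
  assumes "t \<ge> 1" "\<theta> \<le> p \<or> \<theta> \<le> s"
  shows "t powr (\<theta> - 1) \<le> t powr (p - 1) * moment_weight s p t"
proof -
  consider "p < s" | "p = s" | "p > s" by linarith
  then show ?thesis
  proof cases
    case 1
    have "t powr (\<theta> - 1) \<le> t powr (s - 1)" using assms 1 by (intro powr_mono) auto
    also have "\<dots> = t powr (p - 1) * moment_weight s p t"
      using 1 by (simp add: moment_weight_def powr_add[symmetric])
    finally show ?thesis .
  next
    case 2
    have "t powr (\<theta> - 1) \<le> t powr (p - 1) * 1" using assms 2 by (auto intro: powr_mono)
    also have "\<dots> \<le> t powr (p - 1) * moment_weight s p t"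
      using 2 assms by (intro mult_left_mono) (auto simp: moment_weight_def)
    finally show ?thesis .
  next
    case 3
    then show ?thesis using assms by (auto simp: moment_weight_def intro: powr_mono)
  qed
qed

lemma powr_moment_weight_le:
  assumes "1 \<le> t" "t \<le> c"
  shows "t powr (p - 1) * moment_weight s p t \<le> c powr \<bar>p - 1\<bar> * moment_weight s p c"
proof -
  have "t powr (p - 1) \<le> t powr \<bar>p - 1\<bar>" using assms by (intro powr_mono) auto
  also have "\<dots> \<le> c powr \<bar>p - 1\<bar>" using assms by (intro powr_mono2) auto
  finally show ?thesis using assms by (intro mult_mono moment_weight_mono moment_weight_nonneg) auto
qed

definition model_coeff :: "real \<Rightarrow> real \<Rightarrow> nat \<Rightarrow> nat \<Rightarrow> real" where
  "model_coeff q \<beta> n i = (real i / real n) powr \<beta> * (1 / real n powr q)"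

lemma model_coeff_eq:
  assumes "n \<ge> 1" "i \<ge> 1"
  shows "model_coeff q \<beta> n i = real i powr \<beta> * real n powr (- (\<beta> + q))"
proof -
  have "real n powr (- (\<beta> + q)) = real n powr (- \<beta>) * real n powr (- q)"
    by (simp add: powr_add[symmetric])
  then show ?thesis
    by (simp add: model_coeff_def powr_divide powr_minus_divide)
qed

lemma model_coeff_pos: "n \<ge> 1 \<Longrightarrow> i \<ge> 1 \<Longrightarrow> model_coeff q \<beta> n i > 0"
  by (simp add: model_coeff_def)

lemma model_coeff_le_1:
  assumes "1 \<le> i" "i \<le> n" "q > 0" "\<beta> + q > 0"
  shows "model_coeff q \<beta> n i \<le> 1"
proof (cases "\<beta> \<ge> 0")
  case True
  have "(real i / real n) powr \<beta> \<le> 1" using assms True by (intro powr_le1) auto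
  moreover have "1 / real n powr q \<le> 1"
    using assms ge_one_powr_ge_zero[of "real n" q] by (auto simp: divide_le_eq_1)
  ultimately show ?thesis unfolding model_coeff_def by (intro mult_le_one) auto
next
  case False
  have "real i powr \<beta> \<le> 1" using powr_mono[of \<beta> 0 "real i"] assms False by simp
  moreover have "real n powr (- (\<beta> + q)) \<le> 1"
    using powr_mono[of "- (\<beta> + q)" 0 "real n"] assms by simp
  ultimately have "real i powr \<beta> * real n powr (- (\<beta> + q)) \<le> 1" by (intro mult_le_one) auto
  then show ?thesis using model_coeff_eq[of n i q \<beta>] assms by simp
qed

lemma sum_model_coeff_powr_le:
  assumes "\<beta> * \<theta> > -1"
  shows "\<exists>C>0. \<forall>n\<ge>1. (\<Sum>i=1..n. model_coeff q \<beta> n i powr \<theta>) \<le> C * real n powr (1 - q * \<theta>)"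
proof -
  obtain C where C: "C > 0" "\<And>n::nat. (\<Sum>i=1..n. real i powr (\<beta> * \<theta>)) \<le> C * real n powr (1 + \<beta> * \<theta>)"
    using sum_powr_le[of "1 + \<beta> * \<theta>"] assms by auto
  have "(\<Sum>i=1..n. model_coeff q \<beta> n i powr \<theta>) \<le> C * real n powr (1 - q * \<theta>)" if n: "n \<ge> 1" for n :: nat
  proof -
    have "(\<Sum>i=1..n. model_coeff q \<beta> n i powr \<theta>)
        = (\<Sum>i=1..n. real i powr (\<beta> * \<theta>) * real n powr (- (\<beta> + q) * \<theta>))"
      using n by (intro sum.cong) (auto simp: model_coeff_eq powr_mult powr_powr)
    also have "\<dots> = (\<Sum>i=1..n. real i powr (\<beta> * \<theta>)) * real n powr (- (\<beta> + q) * \<theta>)"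
      by (simp add: sum_distrib_right)
    also have "\<dots> \<le> C * real n powr (1 + \<beta> * \<theta>) * real n powr (- (\<beta> + q) * \<theta>)"
      using C by (intro mult_right_mono) auto
    also have "\<dots> = C * real n powr (1 - q * \<theta>)"
      using n by (simp add: powr_add[symmetric] algebra_simps)
    finally show ?thesis .
  qed
  with C show ?thesis by blast
qed

text \<open>
  If $\beta\theta > -1$, the sum $\sum_{i \le n} (i/n)^{\beta\theta}$ has order $n$, as an
  integral over $(0,1]$ suggests; this is where the lower bound for $\beta$ enters.
\<close>
lemma weighted_row_sum_le:
  assumes "\<beta> * \<theta> > -1"
  shows "\<exists>C>0. \<forall>n\<ge>1. real n powr (r - 2) * (\<Sum>i=1..n. model_coeff q \<beta> n i powr \<theta>)
    \<le> C * real n powr (r - q * \<theta> - 1)"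
proof -
  obtain C where C: "C > 0" "\<And>n. n \<ge> 1 \<Longrightarrow> (\<Sum>i=1..n. model_coeff q \<beta> n i powr \<theta>) \<le> C * real n powr (1 - q * \<theta>)"
    using sum_model_coeff_powr_le[OF assms, of q] by blast
  have "real n powr (r - 2) * (\<Sum>i=1..n. model_coeff q \<beta> n i powr \<theta>) \<le> C * real n powr (r - q * \<theta> - 1)"
    if "n \<ge> 1" for n
  proof -
    have "real n powr (r - 2) * (\<Sum>i=1..n. model_coeff q \<beta> n i powr \<theta>)
        \<le> real n powr (r - 2) * (C * real n powr (1 - q * \<theta>))"
      using C(2)[OF that] by (intro mult_left_mono) auto
    also have "\<dots> = C * (real n powr (r - 2) * real n powr (1 - q * \<theta>))" by simp
    also have "real n powr (r - 2) * real n powr (1 - q * \<theta>) = real n powr (r - q * \<theta> - 1)"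
      unfolding powr_add[symmetric] by (simp add: algebra_simps)
    finally show ?thesis .
  qed
  with C(1) show ?thesis by blast
qed

lemma exponent_above_minus_one:
  fixes \<beta> \<theta> s :: real
  assumes "\<beta> * s > -1" "0 < \<theta>" "\<theta> \<le> s"
  shows "\<beta> * \<theta> > -1"
proof (cases "\<beta> \<ge> 0")
  case True
  then have "\<beta> * \<theta> \<ge> 0" using assms by (intro mult_nonneg_nonneg) auto
  then show ?thesis by simp
next
  case False
  then have "\<beta> * s \<le> \<beta> * \<theta>" using assms by (intro mult_left_mono_neg) auto
  with assms show ?thesis by simp
qed

lemma exponent_sum_pos:
  fixes \<beta> q r :: real
  assumes "r > 1" "q > 0" "\<beta> > - q / r"
  shows "\<beta> + q > 0"
proof -
  have "q / r < q" using assms by (simp add: field_simps)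
  then show ?thesis using assms by simp
qed

text \<open>
  The case $p \le s$ splits the rows at $n = t^{1/q}$. In the short rows the cutoff is ignored and
  the exponent $p$ is used. In the long rows only the few $b_{ni}$ with $b_{ni} \ge 1/t$ count,
  and there $b_{ni}^p \le t^{p'-p} b_{ni}^{p'}$ for an exponent $p'$ slightly larger than $s$, for
  which the sum over $n$ converges. For $p > s$ an exponent $p' \le p$ of this kind settles all
  rows at once, as $b_{ni} \le 1$.
\<close>
lemma weighted_coeff_sum_upper:
  assumes "r > 1" "q > 0" "\<beta> > - q / r" "p > 0" and s: "s = r / q"
  shows "\<exists>C\<ge>0. \<forall>m. \<forall>t\<ge>1. (\<Sum>n=1..m. real n powr (r - 2) *
      (\<Sum>i=1..n. if 1 / t \<le> model_coeff q \<beta> n i then model_coeff q \<beta> n i powr p else 0))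
    \<le> C * moment_weight s p t"
proof -
  have s0: "s > 0" and qs: "q * s = r" using assms by auto
  have bs: "\<beta> * s > -1" using assms by (simp add: s field_simps)
  note bq = exponent_sum_pos[OF assms(1-3)]
  \<comment> \<open>Such an exponent exists because the inequality $\beta s > -1$ is strict.\<close>
  obtain p' where p': "p' > s" "\<beta> * p' > -1" "p > s \<Longrightarrow> p' \<le> p"
  proof -
    define u where "u = (if p > s then p else s + 1)"
    have u: "u > s" "p > s \<Longrightarrow> u \<le> p" by (auto simp: u_def)
    show ?thesis
    proof (cases "\<beta> \<ge> 0")
      case True
      then have "\<beta> * u \<ge> 0" using u s0 by (intro mult_nonneg_nonneg) auto
      with u show ?thesis by (intro that[of u]) auto
    next
      case False
      define w where "w = (s + (-1/\<beta>)) / 2"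
      have "s < -1/\<beta>" using bs False by (simp add: field_simps)
      then have w: "s < w" "w < -1/\<beta>" by (auto simp: w_def)
      have "\<beta> * min u w \<ge> \<beta> * w" using False by (intro mult_left_mono_neg) auto
      moreover have "\<beta> * w > -1" using w False by (simp add: field_simps)
      ultimately show ?thesis using u w by (intro that[of "min u w"]) auto
    qed
  qed
  define b where "b = model_coeff q \<beta>"
  have b1: "b n i \<le> 1" "b n i > 0" if "i \<in> {1..n}" for n i
    using model_coeff_le_1[of i n q \<beta>] model_coeff_pos[of n i q \<beta>] that assms bq by (auto simp: b_def)
  define \<delta> where "\<delta> = q * p' - r"
  have \<delta>: "\<delta> > 0" using p' qs assms by (simp add: \<delta>_def s field_simps)
  obtain C' where C': "C' > 0"
    and tail: "\<And>n. n \<ge> 1 \<Longrightarrow> real n powr (r - 2) * (\<Sum>i=1..n. b n i powr p') \<le> C' * real n powr (- \<delta> - 1)"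
    using weighted_row_sum_le[OF p'(2), of r q] by (auto simp: b_def \<delta>_def)
  define W where "W n t = real n powr (r - 2) * (\<Sum>i=1..n. if 1 / t \<le> b n i then b n i powr p else 0)" for n t
  have "\<exists>C\<ge>0. \<forall>m. \<forall>t\<ge>1. (\<Sum>n=1..m. W n t) \<le> C * moment_weight s p t"
  proof (cases "p > s")
    case True
    obtain A where A: "A \<ge> 0" "\<And>m. (\<Sum>n=1..m. real n powr (- \<delta> - 1)) \<le> A"
    proof -
      have *: "(\<Sum>n=1..m. real n powr (- \<delta> - 1)) \<le> 1 + 2 powr \<delta> / \<delta>" for m :: nat
      proof -
        have "(\<Sum>n=1..m. real n powr (- \<delta> - 1)) \<le> (\<Sum>n\<in>insert 1 {n\<in>{1..m}. real n > 1}. real n powr (- \<delta> - 1))"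
          by (intro sum_mono2) auto
        also have "\<dots> = 1 + (\<Sum>n\<in>{n\<in>{1..m}. real n > 1}. real n powr (- \<delta> - 1))"
          by (subst sum.insert) auto
        also have "\<dots> \<le> 1 + 2 powr \<delta> / \<delta>" using sum_powr_le_tail[OF \<delta>, of 1 m] by simp
        finally show ?thesis .
      qed
      show ?thesis by (rule that[of "1 + 2 powr \<delta> / \<delta>"]) (use * \<delta> in auto)
    qed
    have "(\<Sum>n=1..m. W n t) \<le> C' * A * moment_weight s p t" if "t \<ge> 1" for m t
    proof -
      have "(\<Sum>n=1..m. W n t) \<le> (\<Sum>n=1..m. C' * real n powr (- \<delta> - 1))"
      proof (rule sum_mono)
        fix n assume n: "n \<in> {1..m}"
        have "W n t \<le> real n powr (r - 2) * (\<Sum>i=1..n. b n i powr p')"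
          unfolding W_def
        proof (intro mult_left_mono sum_mono)
          fix i assume i: "i \<in> {1..n}"
          have "b n i powr p \<le> b n i powr p'"
            using b1[OF i] p'(3)[OF True] by (intro powr_mono') auto
          then show "(if 1 / t \<le> b n i then b n i powr p else 0) \<le> b n i powr p'" by auto
        qed auto
        with tail[of n] n show "W n t \<le> C' * real n powr (- \<delta> - 1)" by auto
      qed
      also have "\<dots> = C' * (\<Sum>n=1..m. real n powr (- \<delta> - 1))" by (simp add: sum_distrib_left)
      also have "\<dots> \<le> C' * A" using A C' by (intro mult_left_mono) auto
      finally show ?thesis using True by (simp add: moment_weight_def)
    qed
    then show ?thesis using A C' by (intro exI[of _ "C' * A"]) auto
  next
    case False
    have bp: "\<beta> * p > -1" using exponent_above_minus_one[OF bs] False assms by simp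
    define \<alpha> where "\<alpha> = r - q * p"
    obtain C1 where C1: "C1 > 0"
      and head: "\<And>n. n \<ge> 1 \<Longrightarrow> real n powr (r - 2) * (\<Sum>i=1..n. b n i powr p) \<le> C1 * real n powr (\<alpha> - 1)"
      using weighted_row_sum_le[OF bp, of r q] by (auto simp: b_def \<alpha>_def)
    obtain C2 where C2: "C2 > 0" "\<And>(m::nat) t. t \<ge> 1 \<Longrightarrow>
      (\<Sum>n\<in>{n\<in>{1..m}. real n \<le> t powr (1/q)}. real n powr (\<alpha> - 1)) \<le> C2 * moment_weight s p t"
    proof (cases "p = s")
      case True
      have "(\<Sum>n\<in>{n\<in>{1..m}. real n \<le> t powr (1/q)}. real n powr (\<alpha> - 1)) \<le> (1 + 1/q) * moment_weight s p t"
        if t: "t \<ge> 1" for t and m :: nat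
      proof -
        have "t powr (1/q) \<ge> 1" using t assms by (intro ge_one_powr_ge_zero) auto
        note sum_inverse_le_cutoff[OF this, of m]
        moreover have "\<alpha> = 0" using True qs by (simp add: \<alpha>_def)
        ultimately have "(\<Sum>n\<in>{n\<in>{1..m}. real n \<le> t powr (1/q)}. real n powr (\<alpha> - 1)) \<le> 1 + ln (t powr (1/q))"
          by (simp add: powr_minus_divide)
        also have "\<dots> = 1 + (1/q) * ln t" using t by (simp add: ln_powr)
        also have "\<dots> \<le> (1 + 1/q) * (1 + ln t)" using t assms by (simp add: algebra_simps)
        finally show ?thesis using True by (simp add: moment_weight_def)
      qed
      then show ?thesis using assms by (intro that[of "1 + 1/q"]) (auto simp: add_pos_pos)
    next
      case neq: False
      have "\<alpha> > 0" using neq False assms by (simp add: \<alpha>_def s field_simps)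
      from sum_powr_le_cutoff[OF this] obtain C2 where C2: "C2 > 0"
        "\<And>m N. N \<ge> 0 \<Longrightarrow> (\<Sum>n\<in>{n\<in>{1..m}. real n \<le> N}. real n powr (\<alpha> - 1)) \<le> C2 * N powr \<alpha>" by blast
      have e: "(t powr (1/q)) powr \<alpha> = moment_weight s p t" for t
      proof -
        have "1 / q * \<alpha> = s - p" using assms by (simp add: \<alpha>_def s field_simps)
        then show ?thesis using neq False by (simp add: powr_powr moment_weight_def)
      qed
      show ?thesis
      proof (rule that[of C2])
        show "(\<Sum>n\<in>{n\<in>{1..m}. real n \<le> t powr (1/q)}. real n powr (\<alpha> - 1)) \<le> C2 * moment_weight s p t"
          for m t using C2(2)[of "t powr (1/q)" m] unfolding e by simp
      qed (rule C2(1))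
    qed
    define C where "C = C1 * C2 + C' * (2 powr \<delta> / \<delta>)"
    have "(\<Sum>n=1..m. W n t) \<le> C * moment_weight s p t" if t: "t \<ge> 1" for m t
    proof -
      define N where "N = t powr (1/q)"
      have N: "N \<ge> 1" using t assms unfolding N_def by (intro ge_one_powr_ge_zero) auto
      have "(\<Sum>n=1..m. W n t) = (\<Sum>n\<in>{n\<in>{1..m}. real n \<le> N}. W n t) + (\<Sum>n\<in>{n\<in>{1..m}. real n > N}. W n t)"
        by (subst sum.union_disjoint[symmetric]) (auto intro!: sum.cong)
      also have "(\<Sum>n\<in>{n\<in>{1..m}. real n \<le> N}. W n t) \<le> (\<Sum>n\<in>{n\<in>{1..m}. real n \<le> N}. C1 * real n powr (\<alpha> - 1))"
      proof (rule sum_mono)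
        fix n assume n: "n \<in> {n\<in>{1..m}. real n \<le> N}"
        have "W n t \<le> real n powr (r - 2) * (\<Sum>i=1..n. b n i powr p)"
          unfolding W_def by (intro mult_left_mono sum_mono) auto
        with head[of n] n show "W n t \<le> C1 * real n powr (\<alpha> - 1)" by auto
      qed
      also have "\<dots> = C1 * (\<Sum>n\<in>{n\<in>{1..m}. real n \<le> N}. real n powr (\<alpha> - 1))" by (simp add: sum_distrib_left)
      also have "\<dots> \<le> C1 * (C2 * moment_weight s p t)"
        using C1 C2(2)[OF t, of m] by (intro mult_left_mono) (auto simp: N_def)
      also have "(\<Sum>n\<in>{n\<in>{1..m}. real n > N}. W n t)
          \<le> (\<Sum>n\<in>{n\<in>{1..m}. real n > N}. t powr (p' - p) * (C' * real n powr (- \<delta> - 1)))"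
      proof (rule sum_mono)
        fix n assume n: "n \<in> {n\<in>{1..m}. real n > N}"
        have "W n t \<le> real n powr (r - 2) * (\<Sum>i=1..n. t powr (p' - p) * b n i powr p')"
          unfolding W_def
        proof (intro mult_left_mono sum_mono)
          fix i assume i: "i \<in> {1..n}"
          show "(if 1 / t \<le> b n i then b n i powr p else 0) \<le> t powr (p' - p) * b n i powr p'"
          proof (cases "1 / t \<le> b n i")
            case True
            have "1 \<le> t * b n i" using True t by (simp add: field_simps)
            then have "1 \<le> (t * b n i) powr (p' - p)"
              using p' False by (intro ge_one_powr_ge_zero) auto
            then have "b n i powr p * 1 \<le> b n i powr p * (t * b n i) powr (p' - p)"
              by (intro mult_left_mono) auto
            also have "\<dots> = t powr (p' - p) * b n i powr p'"
              using b1[OF i] t by (simp add: powr_mult powr_diff)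
            finally show ?thesis using True by simp
          qed auto
        qed auto
        also have "\<dots> = t powr (p' - p) * (real n powr (r - 2) * (\<Sum>i=1..n. b n i powr p'))"
          by (simp add: sum_distrib_left[symmetric])
        also have "\<dots> \<le> t powr (p' - p) * (C' * real n powr (- \<delta> - 1))"
          using tail[of n] n by (intro mult_left_mono) auto
        finally show "W n t \<le> t powr (p' - p) * (C' * real n powr (- \<delta> - 1))" .
      qed
      also have "\<dots> = t powr (p' - p) * C' * (\<Sum>n\<in>{n\<in>{1..m}. real n > N}. real n powr (- \<delta> - 1))"
        by (simp add: sum_distrib_left mult.assoc)
      also have "\<dots> \<le> t powr (p' - p) * C' * (2 powr \<delta> / \<delta> * N powr (- \<delta>))"
        using sum_powr_le_tail[OF \<delta> N, of m] C' by (intro mult_left_mono) auto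
      also have "\<dots> = C' * (2 powr \<delta> / \<delta>) * (t powr (p' - p) * N powr (- \<delta>))" by simp
      also have "t powr (p' - p) * N powr (- \<delta>) = t powr (s - p)"
      proof -
        have e: "1 / q * (- \<delta>) = s - p'" using assms by (simp add: \<delta>_def s field_simps)
        have "N powr (- \<delta>) = t powr (s - p')" unfolding N_def powr_powr e ..
        then show ?thesis by (simp add: powr_add[symmetric])
      qed
      also have "C' * (2 powr \<delta> / \<delta>) * t powr (s - p) \<le> C' * (2 powr \<delta> / \<delta>) * moment_weight s p t"
        using False C' \<delta> t by (intro mult_left_mono) (auto simp: moment_weight_def)
      finally show ?thesis by (simp add: C_def algebra_simps)
    qed
    moreover have "C \<ge> 0" using C1 C2 C' \<delta> by (simp add: C_def)
    ultimately show ?thesis by blast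
  qed
  then show ?thesis unfolding W_def b_def .
qed

lemma power_sum_lower:
  fixes \<alpha> :: real
  assumes "\<alpha> > 0" and n1: "n1 \<ge> (1::nat)"
  shows "\<exists>c>0. \<exists>N0. \<forall>N\<ge>N0. c * N powr \<alpha> \<le> (\<Sum>n=n1..nat \<lfloor>N\<rfloor>. real n powr (\<alpha> - 1))"
proof -
  define G where "G = max 1 (2 powr (\<alpha> - 1))"
  have G: "G \<ge> 1" by (simp add: G_def)
  have inc: "real (Suc n) powr \<alpha> - real n powr \<alpha> \<le> \<alpha> * G * real n powr (\<alpha> - 1)" if "n \<ge> 1" for n :: nat
  proof -
    have "\<exists>z>real n. z < real (Suc n) \<and> real (Suc n) powr \<alpha> - real n powr \<alpha>
        = (real (Suc n) - real n) * (\<alpha> * z powr (\<alpha> - 1))"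
      by (rule MVT2) (use that assms in \<open>auto intro!: derivative_eq_intros simp: field_simps\<close>)
    then obtain z where z: "z > real n" "z < real (Suc n)"
      "real (Suc n) powr \<alpha> - real n powr \<alpha> = \<alpha> * z powr (\<alpha> - 1)" by auto
    have "z powr (\<alpha> - 1) \<le> G * real n powr (\<alpha> - 1)"
    proof (cases "\<alpha> \<ge> 1")
      case True
      have "z powr (\<alpha> - 1) \<le> (2 * real n) powr (\<alpha> - 1)"
        using z that True by (intro powr_mono2) auto
      also have "\<dots> = 2 powr (\<alpha> - 1) * real n powr (\<alpha> - 1)" by (simp add: powr_mult)
      also have "\<dots> \<le> G * real n powr (\<alpha> - 1)" by (intro mult_right_mono) (auto simp: G_def)
      finally show ?thesis .
    next
      case False
      have "z powr (\<alpha> - 1) \<le> 1 * real n powr (\<alpha> - 1)"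
        using z that False by (simp add: powr_mono2')
      also have "\<dots> \<le> G * real n powr (\<alpha> - 1)" using G by (intro mult_right_mono) auto
      finally show ?thesis .
    qed
    then have "\<alpha> * z powr (\<alpha> - 1) \<le> \<alpha> * (G * real n powr (\<alpha> - 1))"
      using assms by (intro mult_left_mono) auto
    with z show ?thesis by simp
  qed
  have tele: "real (Suc k) powr \<alpha> - real n1 powr \<alpha> \<le> \<alpha> * G * (\<Sum>n=n1..k. real n powr (\<alpha> - 1))"
    if "k \<ge> n1" for k
    using that
  proof (induction k rule: dec_induct)
    case base
    then show ?case using inc[OF n1] by simp
  next
    case (step k)
    then show ?case using inc[of "Suc k"] by (simp add: algebra_simps)
  qed
  \<comment> \<open>From this point on $n_1^\alpha \le N^\alpha/2$, so the telescoping sum keeps half of $N^\alpha$.\<close>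
  define N0 where "N0 = 2 powr (1/\<alpha>) * real n1"
  show ?thesis
  proof (rule exI[of _ "1 / (2 * \<alpha> * G)"], rule conjI[rotated], rule exI[of _ N0], intro conjI allI impI)
    show "1 / (2 * \<alpha> * G) > 0" using assms G by simp
    fix N assume N: "N \<ge> N0"
    have "1 \<le> (2::real) powr (1/\<alpha>)" using assms by (intro ge_one_powr_ge_zero) auto
    then have "1 * real n1 \<le> N0" unfolding N0_def by (intro mult_right_mono) auto
    then have N1: "N \<ge> real n1" using N by simp
    then have k: "nat \<lfloor>N\<rfloor> \<ge> n1" by (simp add: le_nat_floor)
    have "2 * real n1 powr \<alpha> = N0 powr \<alpha>" using assms by (simp add: N0_def powr_mult powr_powr)
    also have "\<dots> \<le> N powr \<alpha>" using N assms by (intro powr_mono2) (auto simp: N0_def)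
    finally have "N powr \<alpha> / 2 \<le> N powr \<alpha> - real n1 powr \<alpha>" by simp
    also have "N powr \<alpha> \<le> real (Suc (nat \<lfloor>N\<rfloor>)) powr \<alpha>"
      using N1 assms by (intro powr_mono2) linarith+
    also have "real (Suc (nat \<lfloor>N\<rfloor>)) powr \<alpha> - real n1 powr \<alpha>
        \<le> \<alpha> * G * (\<Sum>n=n1..nat \<lfloor>N\<rfloor>. real n powr (\<alpha> - 1))" using tele[OF k] by simp
    finally show "1 / (2 * \<alpha> * G) * N powr \<alpha> \<le> (\<Sum>n=n1..nat \<lfloor>N\<rfloor>. real n powr (\<alpha> - 1))"
      using assms G by (simp add: field_simps)
  qed
qed

lemma harmonic_sum_lower:
  assumes n1: "n1 \<ge> (1::nat)" and N: "N \<ge> real n1"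
  shows "ln N - ln (real n1) \<le> (\<Sum>n=n1..nat \<lfloor>N\<rfloor>. 1 / real n)"
proof -
  have inc: "ln (real (Suc n)) - ln (real n) \<le> 1 / real n" if "n \<ge> 1" for n :: nat
  proof -
    have "ln (real (Suc n) / real n) \<le> real (Suc n) / real n - 1"
      using that by (intro ln_le_minus_one) auto
    also have "\<dots> = 1 / real n" using that by (simp add: field_simps)
    also have "ln (real (Suc n) / real n) = ln (real (Suc n)) - ln (real n)"
      using that by (simp add: ln_div)
    finally show ?thesis .
  qed
  have tele: "ln (real (Suc k)) - ln (real n1) \<le> (\<Sum>n=n1..k. 1 / real n)" if "k \<ge> n1" for k
    using that
  proof (induction k rule: dec_induct)
    case base
    then show ?case using inc[OF n1] by simp
  next
    case (step k)
    then show ?case using inc[of "Suc k"] by simp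
  qed
  have "ln N \<le> ln (real (Suc (nat \<lfloor>N\<rfloor>)))" using N n1 by (subst ln_le_cancel_iff) linarith+
  moreover have "nat \<lfloor>N\<rfloor> \<ge> n1" using N by (simp add: le_nat_floor)
  ultimately show ?thesis using tele[of "nat \<lfloor>N\<rfloor>"] by simp
qed

text \<open>
  The exponent $r - qp - 1$ is larger than, equal to or less than $-1$ according as $p < s$, $p =
  s$ or $p > s$, so the sum up to $t^{1/q}$ grows like $t^{s-p}$, like $\ln t$, or stays bounded
  below by its first term. The start $n_1$ of the summation only matters for small $t$.
\<close>
lemma weighted_sum_lower:
  assumes "q > 0" and s: "s = r / q" and n1: "n1 \<ge> (1::nat)"
  shows "\<exists>c>0. \<exists>t0\<ge>1. \<forall>t\<ge>t0. c * moment_weight s p t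
      \<le> (\<Sum>n=n1..nat \<lfloor>t powr (1/q)\<rfloor>. real n powr (r - q * p - 1))"
proof -
  consider "p < s" | "p = s" | "p > s" by linarith
  then show ?thesis
  proof cases
    case 1
    have a0: "r - q * p > 0" using 1 assms by (simp add: field_simps)
    from power_sum_lower[OF a0 n1] obtain c N0 where c: "c > 0"
      "\<And>N. N \<ge> N0 \<Longrightarrow> c * N powr (r - q * p) \<le> (\<Sum>n=n1..nat \<lfloor>N\<rfloor>. real n powr (r - q * p - 1))"
      by blast
    define t0 where "t0 = max 1 ((max N0 0) powr q)"
    show ?thesis
    proof (rule exI[of _ c], rule conjI[rotated], rule exI[of _ t0], intro conjI allI impI)
      fix t assume t: "t \<ge> t0"
      have t1: "t \<ge> 1" using t by (simp add: t0_def)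
      have "(max N0 0) powr q \<le> t" using t by (simp add: t0_def field_simps)
      then have "((max N0 0) powr q) powr (1/q) \<le> t powr (1/q)"
        using assms by (intro powr_mono2) auto
      then have "N0 \<le> t powr (1/q)" using assms by (simp add: powr_powr)
      from c(2)[OF this] have "c * (t powr (1/q)) powr (r - q * p)
        \<le> (\<Sum>n=n1..nat \<lfloor>t powr (1/q)\<rfloor>. real n powr (r - q * p - 1))" .
      moreover have "(t powr (1/q)) powr (r - q * p) = moment_weight s p t"
      proof -
        have e: "1 / q * (r - q * p) = s - p" using assms by (simp add: field_simps)
        show ?thesis unfolding powr_powr e using 1 t1
          by (simp add: moment_weight_def )
      qed
      ultimately show "c * moment_weight s p t
        \<le> (\<Sum>n=n1..nat \<lfloor>t powr (1/q)\<rfloor>. real n powr (r - q * p - 1))" by simp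
    qed (use c in \<open>auto simp: t0_def\<close>)
  next
    case 2
    have a0: "r - q * p - 1 = -1" using 2 assms by simp
    \<comment> \<open>This bound gives $\ln t \ge 1$ and $\ln n_1 \le \frac{1}{4q}\ln t$.\<close>
    define t0 where "t0 = max (exp 1) (real n1 powr (4 * q))"
    show ?thesis
    proof (rule exI[of _ "1 / (8 * q)"], rule conjI[rotated], rule exI[of _ t0], intro conjI allI impI)
      show "t0 \<ge> 1" using exp_ge_add_one_self[of 1] by (simp add: t0_def)
      fix t assume t: "t \<ge> t0"
      have t1: "t > 0" "t \<ge> exp 1" using t exp_gt_zero[of 1] unfolding t0_def by linarith+
      have lt: "ln t \<ge> 1" using t1 by (simp add: ln_ge_iff)
      have "ln (real n1 powr (4 * q)) \<le> ln t"
        using t t1 n1 by (subst ln_le_cancel_iff) (auto simp: t0_def)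
      moreover have "ln (real n1 powr (4 * q)) = 4 * q * ln (real n1)"
        using n1 by (simp add: ln_powr)
      ultimately have L: "4 * q * ln (real n1) \<le> ln t" by simp
      define N where "N = t powr (1/q)"
      have lnN: "ln N = ln t / q" using t1 by (simp add: N_def ln_powr)
      have n0: "ln (real n1) \<ge> 0" using n1 by simp
      have qn0: "q * ln (real n1) \<ge> 0" using n0 assms by simp
      have "q * ln (real n1) \<le> ln t" using L qn0 by linarith
      then have "ln (real n1) \<le> ln N" unfolding lnN using assms by (simp add: field_simps)
      moreover have "N > 0" using t1 by (simp add: N_def)
      ultimately have N1: "real n1 \<le> N" using n1 by (subst (asm) ln_le_cancel_iff) auto
      have "ln t / 4 \<le> ln t - q * ln (real n1)" using L qn0 by linarith
      then have "ln t / (4 * q) \<le> ln N - ln (real n1)" unfolding lnN using assms by (simp add: field_simps)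
      also have "\<dots> \<le> (\<Sum>n=n1..nat \<lfloor>N\<rfloor>. 1 / real n)" by (rule harmonic_sum_lower[OF n1 N1])
      finally have "ln t / (4 * q) \<le> (\<Sum>n=n1..nat \<lfloor>N\<rfloor>. 1 / real n)" .
      moreover have "(1 + ln t) / (8 * q) \<le> ln t / (4 * q)" using lt assms by (simp add: field_simps)
      ultimately show "1 / (8 * q) * moment_weight s p t
        \<le> (\<Sum>n=n1..nat \<lfloor>t powr (1/q)\<rfloor>. real n powr (r - q * p - 1))"
        unfolding a0 using 2 by (simp add: moment_weight_def N_def powr_minus_divide)
    qed (use assms in auto)
  next
    case 3
    define t0 where "t0 = max 1 (real n1 powr q)"
    show ?thesis
    proof (rule exI[of _ "real n1 powr (r - q * p - 1)"], rule conjI[rotated], rule exI[of _ t0], intro conjI allI impI)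
      fix t assume t: "t \<ge> t0"
      have "real n1 powr q \<le> t" using t by (simp add: t0_def field_simps)
      then have "(real n1 powr q) powr (1/q) \<le> t powr (1/q)"
        using assms by (intro powr_mono2) auto
      then have "n1 \<le> nat \<lfloor>t powr (1/q)\<rfloor>" using assms by (simp add: powr_powr le_nat_floor)
      then have "(\<Sum>n\<in>{n1}. real n powr (r - q * p - 1))
        \<le> (\<Sum>n=n1..nat \<lfloor>t powr (1/q)\<rfloor>. real n powr (r - q * p - 1))"
        by (intro sum_mono2) auto
      then show "real n1 powr (r - q * p - 1) * moment_weight s p t
        \<le> (\<Sum>n=n1..nat \<lfloor>t powr (1/q)\<rfloor>. real n powr (r - q * p - 1))"
        using 3 by (simp add: moment_weight_def)
    qed (use n1 in \<open>auto simp: t0_def\<close>)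
  qed
qed

lemma model_coeff_upper_half:
  assumes "i \<in> {n div 2 + 1..n}"
  shows "min 1 (2 powr (- \<beta>)) * real n powr (- q) \<le> model_coeff q \<beta> n i"
proof -
  have n: "n \<ge> 1" using assms by auto
  have "2 * i \<ge> n" using assms by auto
  then have i: "1 / 2 \<le> real i / real n" "real i / real n \<le> 1" using assms n by (auto simp: field_simps)
  have "min 1 (2 powr (- \<beta>)) \<le> (real i / real n) powr \<beta>"
  proof (cases "\<beta> \<ge> 0")
    case True
    have "2 powr (- \<beta>) = (1 / 2) powr \<beta>" by (simp add: powr_divide powr_minus_divide)
    also have "\<dots> \<le> (real i / real n) powr \<beta>" using i True by (intro powr_mono2) auto
    finally show ?thesis by simp
  next
    case False
    have "0 < real i / real n" using i(1) by linarith
    then have "1 powr \<beta> \<le> (real i / real n) powr \<beta>"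
      using False by (intro powr_mono2'[OF _ _ i(2)]) auto
    then show ?thesis by simp
  qed
  then have "min 1 (2 powr (- \<beta>)) * real n powr (- q) \<le> (real i / real n) powr \<beta> * real n powr (- q)"
    by (intro mult_right_mono) auto
  then show ?thesis by (simp add: model_coeff_def powr_minus_divide)
qed

section \<open>Calculus of a sublinear expectation\<close>

context sublinear_expectation_space
begin

text \<open>
  The space $H$ need not be closed under uniform limits or under all bounded measurable functions.
  Membership is therefore always derived from local Lipschitz continuity and from indicators.
\<close>
lemma H_unary:
  assumes "X \<in> H" "C > 0" "\<And>x y. \<bar>f x - f y\<bar> \<le> C * (1 + \<bar>x\<bar> ^ m + \<bar>y\<bar> ^ m) * \<bar>x - y\<bar>"
  shows "(\<lambda>\<omega>. f (X \<omega>)) \<in> H"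
proof -
  have "(\<lambda>v. f (v 1)) \<in> C_l_Lip 1"
    unfolding C_l_Lip_def
  proof (intro CollectI exI[of _ C] exI[of _ m] conjI ballI)
    show "\<bar>f (x 1) - f (y 1)\<bar> \<le> C * (1 + vec_norm 1 x ^ m + vec_norm 1 y ^ m) * vec_norm 1 (\<lambda>i. x i - y i)"
      for x y using assms(3)[of "x 1" "y 1"] by simp
  qed (rule assms(2))
  from H_C_l_Lip[OF _ _ this, of "\<lambda>_. X"] assms(1) show ?thesis by (simp add: rvec_def)
qed

lemma H_Lipschitz:
  assumes "X \<in> H" "\<And>x y. \<bar>f x - f y\<bar> \<le> C * \<bar>x - y\<bar>"
  shows "(\<lambda>\<omega>. f (X \<omega>)) \<in> H"
proof (rule H_unary[OF assms(1), of "\<bar>C\<bar> + 1" f 0])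
  fix x y
  have "\<bar>f x - f y\<bar> \<le> C * \<bar>x - y\<bar>" by (rule assms(2))
  also have "\<dots> \<le> (\<bar>C\<bar> + 1) * (1 + \<bar>x\<bar> ^ 0 + \<bar>y\<bar> ^ 0) * \<bar>x - y\<bar>" by (intro mult_right_mono) auto
  finally show "\<bar>f x - f y\<bar> \<le> (\<bar>C\<bar> + 1) * (1 + \<bar>x\<bar> ^ 0 + \<bar>y\<bar> ^ 0) * \<bar>x - y\<bar>" .
qed simp

text \<open>
  Addition and multiplication satisfy this bound; the mixed factor $1 + |x_1| + |y_2|$ is what the
  product needs.
\<close>
lemma H_binary:
  assumes "X \<in> H" "Y \<in> H"
    "\<And>x1 x2 y1 y2. \<bar>f x1 x2 - f y1 y2\<bar> \<le> (1 + \<bar>x1\<bar> + \<bar>y2\<bar>) * (\<bar>x1 - y1\<bar> + \<bar>x2 - y2\<bar>)"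
  shows "(\<lambda>\<omega>. f (X \<omega>) (Y \<omega>)) \<in> H"
proof -
  have "(\<lambda>v. f (v 1) (v 2)) \<in> C_l_Lip 2"
    unfolding C_l_Lip_def
  proof (intro CollectI exI[of _ "2::real"] exI[of _ "1::nat"] conjI ballI)
    fix x y :: "nat \<Rightarrow> real"
    have le: "\<bar>v i\<bar> \<le> vec_norm 2 v" if "i \<in> {1..2}" for v i
      using member_le_L2_set[of "{1..2}" i "\<lambda>i. \<bar>v i\<bar>"] that by (simp add: L2_set_def)
    have "\<bar>f (x 1) (x 2) - f (y 1) (y 2)\<bar>
        \<le> (1 + \<bar>x 1\<bar> + \<bar>y 2\<bar>) * (\<bar>x 1 - y 1\<bar> + \<bar>x 2 - y 2\<bar>)" by (rule assms(3))
    also have "\<dots> \<le> (1 + vec_norm 2 x + vec_norm 2 y)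
        * (vec_norm 2 (\<lambda>i. x i - y i) + vec_norm 2 (\<lambda>i. x i - y i))"
      using le[of 1 x] le[of 2 y] le[of 1 "\<lambda>i. x i - y i"] le[of 2 "\<lambda>i. x i - y i"]
      by (intro mult_mono add_mono) auto
    finally show "\<bar>f (x 1) (x 2) - f (y 1) (y 2)\<bar>
        \<le> 2 * (1 + vec_norm 2 x ^ 1 + vec_norm 2 y ^ 1) * vec_norm 2 (\<lambda>i. x i - y i)"
      by (simp add: algebra_simps)
  qed simp
  from H_C_l_Lip[OF _ _ this, of "\<lambda>i. if i = 1 then X else Y"] assms(1,2)
  show ?thesis by (simp add: rvec_def)
qed

lemma H_add: "X \<in> H \<Longrightarrow> Y \<in> H \<Longrightarrow> (\<lambda>\<omega>. X \<omega> + Y \<omega>) \<in> H"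
proof (erule (1) H_binary)
  fix x1 x2 y1 y2 :: real
  have "1 * (\<bar>x1 - y1\<bar> + \<bar>x2 - y2\<bar>) \<le> (1 + \<bar>x1\<bar> + \<bar>y2\<bar>) * (\<bar>x1 - y1\<bar> + \<bar>x2 - y2\<bar>)"
    by (intro mult_right_mono) auto
  moreover have "\<bar>x1 + x2 - (y1 + y2)\<bar> \<le> 1 * (\<bar>x1 - y1\<bar> + \<bar>x2 - y2\<bar>)"
    using abs_triangle_ineq[of "x1 - y1" "x2 - y2"] by (simp add: algebra_simps)
  ultimately show "\<bar>x1 + x2 - (y1 + y2)\<bar> \<le> (1 + \<bar>x1\<bar> + \<bar>y2\<bar>) * (\<bar>x1 - y1\<bar> + \<bar>x2 - y2\<bar>)"
    by (rule order_trans[rotated])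
qed

lemma H_mult: "X \<in> H \<Longrightarrow> Y \<in> H \<Longrightarrow> (\<lambda>\<omega>. X \<omega> * Y \<omega>) \<in> H"
proof (erule (1) H_binary)
  fix x1 x2 y1 y2 :: real
  have "x1 * x2 - y1 * y2 = x1 * (x2 - y2) + y2 * (x1 - y1)" by (simp add: algebra_simps)
  then have "\<bar>x1 * x2 - y1 * y2\<bar> \<le> \<bar>x1\<bar> * \<bar>x2 - y2\<bar> + \<bar>y2\<bar> * \<bar>x1 - y1\<bar>"
    by (metis abs_mult abs_triangle_ineq)
  also have "\<dots> \<le> (1 + \<bar>x1\<bar> + \<bar>y2\<bar>) * \<bar>x2 - y2\<bar> + (1 + \<bar>x1\<bar> + \<bar>y2\<bar>) * \<bar>x1 - y1\<bar>"
    by (intro add_mono mult_right_mono) auto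
  finally show "\<bar>x1 * x2 - y1 * y2\<bar> \<le> (1 + \<bar>x1\<bar> + \<bar>y2\<bar>) * (\<bar>x1 - y1\<bar> + \<bar>x2 - y2\<bar>)"
    by (simp add: algebra_simps)
qed

lemma H_const: "(\<lambda>_. c) \<in> H"
proof -
  have "indicator {} \<in> H" by (rule H_indicator) simp
  from H_Lipschitz[OF this, of "\<lambda>_. c" 0] show ?thesis by simp
qed

lemma H_cmult: "X \<in> H \<Longrightarrow> (\<lambda>\<omega>. c * X \<omega>) \<in> H"
  by (rule H_mult[OF H_const])

lemma H_abs: "X \<in> H \<Longrightarrow> (\<lambda>\<omega>. \<bar>X \<omega>\<bar>) \<in> H"
  by (erule H_Lipschitz[where C=1]) auto

lemma H_event: "{\<omega> \<in> space M. P \<omega>} \<in> sets M \<Longrightarrow> (\<lambda>\<omega>. of_bool (P \<omega>)) \<in> H"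
  by (rule H_cong[OF H_indicator]) (auto simp: indicator_def)

lemma E_cong: "X \<in> H \<Longrightarrow> (\<And>\<omega>. \<omega> \<in> space M \<Longrightarrow> X \<omega> = Y \<omega>) \<Longrightarrow> \<E> X = \<E> Y"
  using H_cong[of X Y] by (intro antisym mono) auto

definition mean :: "('a \<Rightarrow> real) \<Rightarrow> real" where
  "mean X = real_of_ereal (\<E> X)"

text \<open>
  On these variables the extended real functional is finite, so the remaining arithmetic can be
  carried out with the real number \<open>mean\<close>.
\<close>
definition bounded_rv :: "('a \<Rightarrow> real) \<Rightarrow> bool" where
  "bounded_rv X \<longleftrightarrow> X \<in> H \<and> (\<exists>K. \<forall>\<omega>\<in>space M. \<bar>X \<omega>\<bar> \<le> K)"

lemma bounded_rvI: "X \<in> H \<Longrightarrow> (\<And>\<omega>. \<omega> \<in> space M \<Longrightarrow> \<bar>X \<omega>\<bar> \<le> K) \<Longrightarrow> bounded_rv X"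
  by (auto simp: bounded_rv_def)

lemma E_eq_mean: "bounded_rv X \<Longrightarrow> \<E> X = ereal (mean X)"
proof -
  assume "bounded_rv X"
  then obtain K where K: "X \<in> H" "\<And>\<omega>. \<omega> \<in> space M \<Longrightarrow> \<bar>X \<omega>\<bar> \<le> K"
    by (auto simp: bounded_rv_def)
  have "\<E> X \<le> \<E> (\<lambda>_. K)" using K by (intro mono H_const) (auto simp: abs_le_iff)
  moreover have "\<E> (\<lambda>_. -K) \<le> \<E> X" using K by (intro mono H_const) (auto simp: abs_le_iff minus_le_iff)
  ultimately show ?thesis unfolding const mean_def by (cases "\<E> X") auto
qed

lemma bounded_rv_H: "bounded_rv X \<Longrightarrow> X \<in> H"
  by (simp add: bounded_rv_def)

lemma bounded_rv_const: "bounded_rv (\<lambda>_. c)"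
  by (rule bounded_rvI[of _ "\<bar>c\<bar>"]) (auto intro: H_const)

lemma bounded_rv_add: "bounded_rv X \<Longrightarrow> bounded_rv Y \<Longrightarrow> bounded_rv (\<lambda>\<omega>. X \<omega> + Y \<omega>)"
proof -
  assume "bounded_rv X" "bounded_rv Y"
  then obtain K L where "X \<in> H" "Y \<in> H" "\<And>\<omega>. \<omega> \<in> space M \<Longrightarrow> \<bar>X \<omega>\<bar> \<le> K" "\<And>\<omega>. \<omega> \<in> space M \<Longrightarrow> \<bar>Y \<omega>\<bar> \<le> L"
    unfolding bounded_rv_def by blast
  then show ?thesis
    by (intro bounded_rvI[of _ "K + L"] H_add) (auto intro: order_trans[OF abs_triangle_ineq add_mono])
qed

lemma bounded_rv_cmult: "bounded_rv X \<Longrightarrow> bounded_rv (\<lambda>\<omega>. c * X \<omega>)"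
proof -
  assume "bounded_rv X"
  then obtain K where "X \<in> H" "\<And>\<omega>. \<omega> \<in> space M \<Longrightarrow> \<bar>X \<omega>\<bar> \<le> K" unfolding bounded_rv_def by blast
  then show ?thesis
    by (intro bounded_rvI[of _ "\<bar>c\<bar> * K"] H_cmult) (auto simp: abs_mult intro: mult_left_mono)
qed

lemma mean_mono:
  "bounded_rv X \<Longrightarrow> bounded_rv Y \<Longrightarrow> (\<And>\<omega>. \<omega> \<in> space M \<Longrightarrow> X \<omega> \<le> Y \<omega>) \<Longrightarrow> mean X \<le> mean Y"
  using mono[of Y X] bounded_rv_H E_eq_mean by fastforce

lemma mean_const: "mean (\<lambda>_. c) = c"
  by (simp add: mean_def const)

lemma mean_cmult: "bounded_rv X \<Longrightarrow> c \<ge> 0 \<Longrightarrow> mean (\<lambda>\<omega>. c * X \<omega>) = c * mean X"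
  using pos_homogeneous[OF bounded_rv_H, of X c] E_eq_mean[of X]
  by (simp add: mean_def[of "\<lambda>\<omega>. c * X \<omega>"])

lemma mean_add_le: "bounded_rv X \<Longrightarrow> bounded_rv Y \<Longrightarrow> mean (\<lambda>\<omega>. X \<omega> + Y \<omega>) \<le> mean X + mean Y"
  using subadditive[OF bounded_rv_H bounded_rv_H, of X Y] E_eq_mean[of X] E_eq_mean[of Y]
    E_eq_mean[OF bounded_rv_add, of X Y] by simp

lemma mean_add_const: "bounded_rv X \<Longrightarrow> mean (\<lambda>\<omega>. c + X \<omega>) = c + mean X"
proof (rule antisym)
  assume X: "bounded_rv X"
  show "mean (\<lambda>\<omega>. c + X \<omega>) \<le> c + mean X"
    using mean_add_le[OF bounded_rv_const X, of c] by (simp add: mean_const)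
  show "c + mean X \<le> mean (\<lambda>\<omega>. c + X \<omega>)"
    using mean_add_le[OF bounded_rv_const bounded_rv_add[OF bounded_rv_const X], of "-c" c]
    by (simp add: mean_const)
qed

definition cap :: "'a set \<Rightarrow> real" where
  "cap A = real_of_ereal (capacity \<E> A)"

lemma bounded_rv_indicator: "A \<in> sets M \<Longrightarrow> bounded_rv (indicator A)"
  by (rule bounded_rvI[of _ 1]) (auto intro: H_indicator simp: indicator_def)

lemma capacity_eq_cap: "A \<in> sets M \<Longrightarrow> capacity \<E> A = ereal (cap A)"
  unfolding cap_def capacity_def using E_eq_mean[OF bounded_rv_indicator] by (simp add: mean_def)

lemma cap_eq_mean: "cap A = mean (indicator A)"
  by (simp add: cap_def mean_def capacity_def)

lemma cap_mono: "A \<in> sets M \<Longrightarrow> B \<in> sets M \<Longrightarrow> A \<subseteq> B \<Longrightarrow> cap A \<le> cap B"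
  unfolding cap_eq_mean by (intro mean_mono bounded_rv_indicator) (auto simp: indicator_def)

lemma cap_nonneg: "A \<in> sets M \<Longrightarrow> 0 \<le> cap A"
  using mean_mono[OF bounded_rv_const bounded_rv_indicator, of A 0]
  by (simp add: cap_eq_mean mean_const)

lemma cap_le_1: "A \<in> sets M \<Longrightarrow> cap A \<le> 1"
  using mean_mono[OF bounded_rv_indicator bounded_rv_const, of A 1]
  by (simp add: cap_eq_mean mean_const indicator_def)

lemma cap_space: "cap (space M) = 1"
proof -
  have "\<E> (indicator (space M)) = \<E> (\<lambda>_. 1)" by (rule E_cong[OF H_indicator]) auto
  then show ?thesis by (simp add: cap_eq_mean mean_def const)
qed

lemma cap_empty: "cap {} = 0"
  using const[of 0] by (simp add: cap_eq_mean mean_def indicator_def[abs_def])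

lemma cap_Un: "A \<in> sets M \<Longrightarrow> B \<in> sets M \<Longrightarrow> cap (A \<union> B) \<le> cap A + cap B"
proof -
  assume A: "A \<in> sets M" and B: "B \<in> sets M"
  have "cap (A \<union> B) \<le> mean (\<lambda>\<omega>. indicator A \<omega> + indicator B \<omega>)"
    unfolding cap_eq_mean using A B
    by (intro mean_mono bounded_rv_add bounded_rv_indicator) (auto simp: indicator_def)
  also have "\<dots> \<le> cap A + cap B"
    unfolding cap_eq_mean using A B by (intro mean_add_le bounded_rv_indicator)
  finally show ?thesis .
qed

lemma cap_UN:
  assumes "finite I" "\<And>i. i \<in> I \<Longrightarrow> A i \<in> sets M"
  shows "cap (\<Union>i\<in>I. A i) \<le> (\<Sum>i\<in>I. cap (A i))"
  using assms
proof (induction I rule: finite_induct)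
  case (insert i I)
  have "cap (\<Union>i\<in>insert i I. A i) \<le> cap (A i) + cap (\<Union>i\<in>I. A i)"
    using insert cap_Un[of "A i" "\<Union>i\<in>I. A i"] sets.finite_UN[of I A M] by simp
  with insert show ?case by auto
qed (simp add: cap_empty)

lemma H_borel_measurable: "X \<in> H \<Longrightarrow> X \<in> borel_measurable M"
  using H_measurable by auto

text \<open>
  For such test functions the conditions in the definition of independence that ask for elements
  of $H$ and for finite expectations hold automatically. The integrand is nonnegative, hence equal
  to its absolute value, and $E[A(x) + B(x)g(Y)] = A(x) + B(x)E[g(Y)]$ because $E$ is translation
  invariant and positively homogeneous.
\<close>
lemma indep_affine:
  assumes ind: "indep_of H \<E> n X 1 (\<lambda>_. Y)"
    and A [measurable]: "A \<in> borel_measurable (borel_vec n)"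
    and B [measurable]: "B \<in> borel_measurable (borel_vec n)"
    and g [measurable]: "g \<in> borel_measurable borel"
    and nonneg: "\<And>x. 0 \<le> A x" "\<And>x. 0 \<le> B x" "\<And>y. 0 \<le> g y"
    and bounded: "\<And>x. A x \<le> K" "\<And>x. B x \<le> K" "\<And>y. g y \<le> K"
    and AH: "(\<lambda>\<omega>. A (rvec n X \<omega>)) \<in> H" and BH: "(\<lambda>\<omega>. B (rvec n X \<omega>)) \<in> H"
    and gH: "(\<lambda>\<omega>. g (Y \<omega>)) \<in> H"
  shows "mean (\<lambda>\<omega>. A (rvec n X \<omega>) + B (rvec n X \<omega>) * g (Y \<omega>))
    = mean (\<lambda>\<omega>. A (rvec n X \<omega>) + B (rvec n X \<omega>) * mean (\<lambda>\<omega>. g (Y \<omega>)))"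
proof -
  define G where "G = mean (\<lambda>\<omega>. g (Y \<omega>))"
  define \<psi> where "\<psi> = (\<lambda>(x :: nat \<Rightarrow> real, y :: nat \<Rightarrow> real). A x + B x * g (y 1))"
  have m1: "(\<lambda>y. y 1) \<in> borel_measurable (borel_vec 1)"
    by (rule measurable_component_singleton) simp
  have \<psi>m: "\<psi> \<in> borel_measurable (borel_vec n \<Otimes>\<^sub>M borel_vec 1)"
    unfolding \<psi>_def case_prod_beta using m1 by measurable
  have r1: "rvec 1 (\<lambda>_. Y) \<omega> 1 = Y \<omega>" for \<omega> by (simp add: rvec_def)
  have gb: "bounded_rv (\<lambda>\<omega>. g (Y \<omega>))"
    using nonneg(3) bounded(3) by (intro bounded_rvI[OF gH, of K]) simp
  have G0: "G \<ge> 0"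
    using mean_mono[OF bounded_rv_const gb, of 0] nonneg(3) by (simp add: G_def mean_const)
  have sec: "bounded_rv (\<lambda>\<omega>. A x + B x * g (Y \<omega>))" for x
    by (intro bounded_rv_add bounded_rv_const bounded_rv_cmult gb)
  have secE: "\<E> (\<lambda>\<omega>. A x + B x * g (Y \<omega>)) = ereal (A x + B x * G)" for x
    using E_eq_mean[OF sec] mean_add_const[OF bounded_rv_cmult[OF gb]] mean_cmult[OF gb] nonneg(2)
    by (simp add: G_def)
  have rH: "(\<lambda>\<omega>. A (rvec n X \<omega>) + B (rvec n X \<omega>) * G) \<in> H"
    by (intro H_add H_mult H_const AH BH)
  have rb: "bounded_rv (\<lambda>\<omega>. A (rvec n X \<omega>) + B (rvec n X \<omega>) * G)"
    using nonneg bounded G0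
    by (intro bounded_rvI[OF rH, of "K + K * G"]) (auto intro!: add_mono mult_right_mono)
  have pos: "0 \<le> A x + B x * g y" "0 \<le> A x + B x * G" for x y
    using nonneg G0 by auto
  have \<psi>: "\<psi> (x, rvec 1 (\<lambda>_. Y) \<omega>) = A x + B x * g (Y \<omega>)" for x \<omega>
    unfolding \<psi>_def by (simp only: prod.case r1)
  have abs: "\<bar>A x + B x * g y\<bar> = A x + B x * g y" "\<bar>A x + B x * G\<bar> = A x + B x * G" for x y
    using pos by simp_all
  have fin: "\<E> (\<lambda>\<omega>. A (rvec n X \<omega>) + B (rvec n X \<omega>) * G) < \<infinity>"
    using E_eq_mean[OF rb] by simp
  have "\<E> (\<lambda>\<omega>. \<psi> (rvec n X \<omega>, rvec 1 (\<lambda>_. Y) \<omega>))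
      = \<E> (\<lambda>\<omega>. real_of_ereal (\<E> (\<lambda>\<omega>'. \<psi> (rvec n X \<omega>, rvec 1 (\<lambda>_. Y) \<omega>'))))"
  proof (rule ind[unfolded indep_of_def Let_def, rule_format, OF \<psi>m])
    show "(\<lambda>\<omega>. \<psi> (rvec n X \<omega>, rvec 1 (\<lambda>_. Y) \<omega>)) \<in> H"
      unfolding \<psi> by (intro H_add H_mult AH BH gH)
    show "(\<lambda>\<omega>. \<psi> (x, rvec 1 (\<lambda>_. Y) \<omega>)) \<in> H" for x
      unfolding \<psi> by (rule bounded_rv_H[OF sec])
    show "\<E> (\<lambda>\<omega>. \<bar>\<psi> (x, rvec 1 (\<lambda>_. Y) \<omega>)\<bar>) < \<infinity>" for x
      unfolding \<psi> abs secE by simp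
    show "(\<lambda>\<omega>. \<bar>real_of_ereal (\<E> (\<lambda>\<omega>'. \<bar>\<psi> (rvec n X \<omega>, rvec 1 (\<lambda>_. Y) \<omega>')\<bar>))\<bar>) \<in> H"
      unfolding \<psi> abs secE real_of_ereal.simps by (rule rH)
    show "\<E> (\<lambda>\<omega>. \<bar>real_of_ereal (\<E> (\<lambda>\<omega>'. \<bar>\<psi> (rvec n X \<omega>, rvec 1 (\<lambda>_. Y) \<omega>')\<bar>))\<bar>) < \<infinity>"
      unfolding \<psi> abs secE real_of_ereal.simps by (rule fin)
    show "(\<lambda>\<omega>. real_of_ereal (\<E> (\<lambda>\<omega>'. \<psi> (rvec n X \<omega>, rvec 1 (\<lambda>_. Y) \<omega>')))) \<in> H"
      unfolding \<psi> secE real_of_ereal.simps by (rule rH)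
  qed
  then have "\<E> (\<lambda>\<omega>. A (rvec n X \<omega>) + B (rvec n X \<omega>) * g (Y \<omega>))
      = \<E> (\<lambda>\<omega>. A (rvec n X \<omega>) + B (rvec n X \<omega>) * G)"
    unfolding \<psi> secE real_of_ereal.simps .
  then show ?thesis by (simp add: mean_def G_def)
qed

end

section \<open>Independent sequences\<close>

definition exceeds :: "(nat \<Rightarrow> real \<Rightarrow> real) \<Rightarrow> real \<Rightarrow> nat \<Rightarrow> (nat \<Rightarrow> real) \<Rightarrow> bool" where
  "exceeds h y k x \<longleftrightarrow> (\<exists>j\<in>{1..k}. (\<Sum>i=1..j. h i (x i)) > y)"

text \<open>
  A function of the vector rather than of $\omega$, so that independence can be applied to it: the
  exponential of $l$ times the partial sum, frozen at the first index where the partial sum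
  exceeds $y$.
\<close>
fun stopped_exp :: "(nat \<Rightarrow> real \<Rightarrow> real) \<Rightarrow> real \<Rightarrow> real \<Rightarrow> nat \<Rightarrow> (nat \<Rightarrow> real) \<Rightarrow> real" where
  "stopped_exp h y l 0 x = 1"
| "stopped_exp h y l (Suc k) x =
    stopped_exp h y l k x * (if exceeds h y k x then 1 else exp (l * h (Suc k) (x (Suc k))))"

lemma exceeds_cong: "(\<And>i. i \<in> {1..k} \<Longrightarrow> x i = x' i) \<Longrightarrow> exceeds h y k x \<longleftrightarrow> exceeds h y k x'"
  unfolding exceeds_def by (intro bex_cong refl arg_cong[where f="\<lambda>z. y < z"] sum.cong) auto

lemma stopped_exp_cong:
  "(\<And>i. i \<in> {1..k} \<Longrightarrow> x i = x' i) \<Longrightarrow> stopped_exp h y l k x = stopped_exp h y l k x'"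
proof (induction k)
  case (Suc k)
  have "exceeds h y k x \<longleftrightarrow> exceeds h y k x'" by (rule exceeds_cong) (use Suc in auto)
  moreover have "stopped_exp h y l k x = stopped_exp h y l k x'" by (rule Suc.IH) (use Suc in auto)
  ultimately show ?case using Suc.prems by simp
qed simp

lemma stopped_exp_pos: "stopped_exp h y l k x > 0"
  by (induction k) auto

lemma stopped_exp_le:
  assumes "l \<ge> 0" "L \<ge> 0" "\<And>i z. h i z \<le> L"
  shows "stopped_exp h y l k x \<le> exp (l * L) ^ k"
proof (induction k)
  case (Suc k)
  have "l * h (Suc k) (x (Suc k)) \<le> l * L" using assms by (intro mult_left_mono)
  moreover have "1 \<le> exp (l * L)" using assms by simp
  ultimately have "(if exceeds h y k x then 1 else exp (l * h (Suc k) (x (Suc k)))) \<le> exp (l * L)" by auto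
  with Suc have "stopped_exp h y l (Suc k) x \<le> exp (l * L) ^ k * exp (l * L)"
    unfolding stopped_exp.simps by (intro mult_mono) auto
  then show ?case by (simp add: mult.commute)
qed simp

lemma exceeds_Suc: "exceeds h y (Suc k) x \<longleftrightarrow> exceeds h y k x \<or> (\<Sum>i=1..Suc k. h i (x i)) > y"
proof -
  have "{1..Suc k} = insert (Suc k) {1..k}" by auto
  then show ?thesis unfolding exceeds_def by auto
qed

text \<open>
  Before the crossing the stopped product is the exponential of the current sum; at the crossing
  its value is at least $e^{ly}$, and it does not change afterwards.
\<close>
lemma stopped_exp_cases:
  assumes "l \<ge> 0"
  shows "(\<not> exceeds h y k x \<longrightarrow> stopped_exp h y l k x = exp (l * (\<Sum>i=1..k. h i (x i))))
    \<and> (exceeds h y k x \<longrightarrow> stopped_exp h y l k x \<ge> exp (l * y))"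
proof (induction k)
  case 0
  then show ?case by (simp add: exceeds_def)
next
  case (Suc k)
  show ?case
  proof (cases "exceeds h y k x")
    case True
    then show ?thesis using Suc by (simp add: exceeds_Suc)
  next
    case False
    then have "stopped_exp h y l (Suc k) x = exp (l * (\<Sum>i=1..Suc k. h i (x i)))"
      using Suc by (simp add: exp_add distrib_left)
    then show ?thesis using False assms
      by (auto simp: exceeds_Suc intro!: mult_left_mono)
  qed
qed

lemma measurable_coordinate:
  assumes "f \<in> measurable borel N" "i \<in> {1..k}"
  shows "(\<lambda>x. f (x i)) \<in> measurable (borel_vec k) N"
  using measurable_compose[OF measurable_component_singleton[OF assms(2), of "\<lambda>_. borel"] assms(1)] .

lemma exceeds_measurable:
  assumes "\<And>i. h i \<in> borel_measurable borel"
  shows "Measurable.pred (borel_vec k) (exceeds h y k)"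
proof -
  have "(\<lambda>x. \<Sum>i=1..j. h i (x i)) \<in> borel_measurable (borel_vec k)" if "j \<in> {1..k}" for j
    using that
    by (intro borel_measurable_sum measurable_coordinate assms) auto
  then show ?thesis unfolding exceeds_def by (intro pred_intros_finite) auto
qed

lemma exceeds_indicator_measurable:
  assumes "\<And>i. h i \<in> borel_measurable borel"
  shows "(\<lambda>x. of_bool (exceeds h y k x) :: real) \<in> borel_measurable (borel_vec k)"
  using exceeds_measurable[OF assms, where k=k and y=y] by measurable

lemma stopped_exp_measurable:
  assumes "\<And>i. h i \<in> borel_measurable borel"
  shows "j \<le> k \<Longrightarrow> stopped_exp h y l j \<in> borel_measurable (borel_vec k)"
proof (induction j)
  case 0
  show ?case by (simp add: stopped_exp.simps(1)[abs_def])
next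
  case (Suc j)
  have ih: "stopped_exp h y l j \<in> borel_measurable (borel_vec k)" using Suc by simp
  have "(\<lambda>x. \<Sum>i=1..m. h i (x i)) \<in> borel_measurable (borel_vec k)" if "m \<in> {1..j}" for m
    using that Suc.prems
    by (intro borel_measurable_sum measurable_coordinate assms) auto
  then have e: "Measurable.pred (borel_vec k) (exceeds h y j)"
    unfolding exceeds_def by (intro pred_intros_finite) auto
  have "(\<lambda>x. h (Suc j) (x (Suc j))) \<in> borel_measurable (borel_vec k)"
    using Suc.prems by (intro measurable_coordinate assms) auto
  then show ?case unfolding stopped_exp.simps using ih e by measurable
qed

context sublinear_expectation_space
begin

lemma exceeds_event:
  assumes "\<And>i. i \<ge> 1 \<Longrightarrow> X i \<in> H" "\<And>i. h i \<in> borel_measurable borel"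
  shows "{\<omega> \<in> space M. exceeds h y k (\<lambda>i. X i \<omega>)} \<in> sets M"
proof -
  have [measurable]: "(\<lambda>\<omega>. \<Sum>i=1..j. h i (X i \<omega>)) \<in> borel_measurable M" for j
    using assms
    by (intro borel_measurable_sum measurable_compose[OF H_borel_measurable assms(2)]) auto
  show ?thesis unfolding exceeds_def by measurable
qed

lemma H_exp_bounded_above:
  assumes "Y \<in> H" "l \<ge> 0" "\<And>z. h z \<le> L" "\<And>x y. \<bar>h x - h y\<bar> \<le> C * \<bar>x - y\<bar>"
  shows "(\<lambda>\<omega>. exp (l * h (Y \<omega>))) \<in> H"
proof (rule H_Lipschitz[OF assms(1), of _ "exp (l * L) * l * C"])
  fix x y
  have *: "exp a - exp b \<le> exp (l * L) * \<bar>a - b\<bar>" if "a \<le> l * L" for a b :: real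
  proof (cases "b \<le> a")
    case True
    have "exp a - exp b \<le> exp a * (a - b)"
    proof -
      have "1 + (b - a) \<le> exp (b - a)" by (rule exp_ge_add_one_self)
      then have "exp a * (1 + (b - a)) \<le> exp a * exp (b - a)" by (intro mult_left_mono) auto
      then show ?thesis by (simp add: exp_diff algebra_simps)
    qed
    also have "\<dots> \<le> exp (l * L) * (a - b)" using that True by (intro mult_right_mono) auto
    finally show ?thesis using True by simp
  next
    case False
    then have "exp a - exp b \<le> 0" by simp
    also have "0 \<le> exp (l * L) * \<bar>a - b\<bar>" by simp
    finally show ?thesis .
  qed
  have le: "l * h z \<le> l * L" for z using assms by (intro mult_left_mono)
  have "\<bar>exp (l * h x) - exp (l * h y)\<bar> \<le> exp (l * L) * \<bar>l * h x - l * h y\<bar>"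
    using *[OF le, of x "l * h y"] *[OF le, of y "l * h x"] by (simp add: abs_minus_commute abs_le_iff)
  also have "\<dots> = exp (l * L) * l * \<bar>h x - h y\<bar>"
    using assms(2) by (simp add: abs_mult right_diff_distrib[symmetric])
  also have "\<dots> \<le> exp (l * L) * l * (C * \<bar>x - y\<bar>)"
    using assms(2) assms(4) by (intro mult_left_mono) auto
  finally show "\<bar>exp (l * h x) - exp (l * h y)\<bar> \<le> exp (l * L) * l * C * \<bar>x - y\<bar>" by simp
qed

text \<open>
  Each step multiplies the expectation of the stopped product by at most $\max(1, E[e^{lh(X)}])$:
  on the crossed part the factor is $1$, on the other part independence gives $E[e^{lh(X)}]$. The
  Markov inequality at level $e^{ly}$ then bounds the crossing event itself, so the maximum costs
  nothing compared with the last partial sum.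
\<close>
proposition exponential_maximal_inequality:
  assumes XH: "\<And>i. i \<ge> 1 \<Longrightarrow> X i \<in> H" and ind: "indep_seq H \<E> X"
    and l: "l \<ge> 0" and L: "L \<ge> 0" "\<And>i z. h i z \<le> L"
    and lip: "\<And>i x y. \<bar>h i x - h i y\<bar> \<le> C i * \<bar>x - y\<bar>"
  shows "cap {\<omega> \<in> space M. \<exists>k\<in>{1..n}. (\<Sum>i=1..k. h i (X i \<omega>)) > y}
    \<le> exp (- l * y) * (\<Prod>i=1..n. max 1 (mean (\<lambda>\<omega>. exp (l * h i (X i \<omega>)))))"
proof -
  define x where "x \<omega> = (\<lambda>i. X i \<omega>)" for \<omega>
  define Z where "Z = stopped_exp h y l"
  define G where "G i = mean (\<lambda>\<omega>. exp (l * h i (X i \<omega>)))" for i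
  have hm: "h i \<in> borel_measurable borel" for i
  proof (rule borel_measurable_continuous_onI)
    have "\<bar>C i\<bar>-lipschitz_on UNIV (h i)"
    proof (rule lipschitz_onI)
      fix u v
      have "\<bar>h i u - h i v\<bar> \<le> \<bar>C i\<bar> * \<bar>u - v\<bar>"
        using lip[of i u v] mult_right_mono[of "C i" "\<bar>C i\<bar>" "\<bar>u - v\<bar>"] by linarith
      then show "dist (h i u) (h i v) \<le> \<bar>C i\<bar> * dist u v" by (simp add: dist_real_def)
    qed simp
    then show "continuous_on UNIV (h i)" by (rule lipschitz_on_continuous_on)
  qed
  have expH: "(\<lambda>\<omega>. exp (l * h i (X i \<omega>))) \<in> H" if "i \<ge> 1" for i
    using XH[OF that] l L(2) lip by (rule H_exp_bounded_above)
  have expb: "exp (l * h i z) \<le> exp (l * L)" for i z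
    using l L(2)[of i z] by (simp add: mult_left_mono)
  have expbr: "bounded_rv (\<lambda>\<omega>. exp (l * h i (X i \<omega>)))" if "i \<ge> 1" for i
    using expb by (intro bounded_rvI[OF expH[OF that], of "exp (l * L)"]) auto
  have G0: "G i \<ge> 0" if "i \<ge> 1" for i
    using mean_mono[OF bounded_rv_const expbr[OF that], of 0] by (simp add: G_def mean_const)
  have exH: "(\<lambda>\<omega>. of_bool (exceeds h y k (x \<omega>))) \<in> H" for k
    unfolding x_def using exceeds_event[OF XH hm] by (intro H_event)
  have split: "Z (Suc k) v = Z k v * of_bool (exceeds h y k v)
      + Z k v * (1 - of_bool (exceeds h y k v)) * exp (l * h (Suc k) (v (Suc k)))" for k v
    by (auto simp: Z_def)
  have ZH: "(\<lambda>\<omega>. Z k (x \<omega>)) \<in> H" for k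
  proof (induction k)
    case 0
    show ?case by (simp add: Z_def H_const)
  next
    case (Suc k)
    have "(\<lambda>\<omega>. 1 + (-1) * of_bool (exceeds h y k (x \<omega>))) \<in> H"
      by (intro H_add H_cmult H_const exH)
    then have "(\<lambda>\<omega>. 1 - of_bool (exceeds h y k (x \<omega>))) \<in> H" by simp
    moreover have "(\<lambda>\<omega>. exp (l * h (Suc k) (x \<omega> (Suc k)))) \<in> H" unfolding x_def by (rule expH) simp
    ultimately show ?case unfolding split using Suc exH by (intro H_add H_mult)
  qed
  have Zpos: "Z k v > 0" for k v by (simp add: Z_def stopped_exp_pos)
  have Zle: "Z k v \<le> exp (l * L) ^ k" for k v unfolding Z_def by (rule stopped_exp_le[OF l L])
  have Zb: "bounded_rv (\<lambda>\<omega>. Z k (x \<omega>))" for k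
    using Zle[of k] less_imp_le[OF Zpos, of k] by (intro bounded_rvI[OF ZH, of _ "exp (l * L) ^ k"]) auto
  have step: "mean (\<lambda>\<omega>. Z (Suc k) (x \<omega>)) \<le> max 1 (G (Suc k)) * mean (\<lambda>\<omega>. Z k (x \<omega>))" for k
  proof (cases "k = 0")
    case True
    have "mean (\<lambda>\<omega>. Z (Suc k) (x \<omega>)) = G (Suc k)"
      using True by (simp add: Z_def G_def x_def exceeds_def)
    moreover have "mean (\<lambda>\<omega>. Z k (x \<omega>)) = 1" using True by (simp add: Z_def mean_const)
    ultimately show ?thesis by simp
  next
    case False
    define A where "A v = Z k v * of_bool (exceeds h y k v)" for v
    define B where "B v = Z k v * (1 - of_bool (exceeds h y k v))" for v
    have Zm: "Z k \<in> borel_measurable (borel_vec k)"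
      unfolding Z_def by (rule stopped_exp_measurable[OF hm order_refl])
    note em = exceeds_indicator_measurable[OF hm, where k=k and y=y]
    have Am: "A \<in> borel_measurable (borel_vec k)" and Bm: "B \<in> borel_measurable (borel_vec k)"
      unfolding A_def[abs_def] B_def[abs_def] using Zm em by measurable
    have rv: "Z k (rvec k X \<omega>) = Z k (x \<omega>)" "exceeds h y k (rvec k X \<omega>) = exceeds h y k (x \<omega>)" for \<omega>
      unfolding Z_def by (rule stopped_exp_cong exceeds_cong, simp add: rvec_def x_def)+
    have rvA: "A (rvec k X \<omega>) = A (x \<omega>)" "B (rvec k X \<omega>) = B (x \<omega>)" for \<omega>
      by (simp_all add: A_def B_def rv)
    have "(\<lambda>\<omega>. 1 + (-1) * of_bool (exceeds h y k (x \<omega>))) \<in> H"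
      by (intro H_add H_cmult H_const exH)
    then have AH: "(\<lambda>\<omega>. A (x \<omega>)) \<in> H" and BH: "(\<lambda>\<omega>. B (x \<omega>)) \<in> H"
      unfolding A_def B_def using exH ZH by (auto intro!: H_mult)
    define K where "K = max (exp (l * L) ^ k) (exp (l * L))"
    have nn: "0 \<le> A v" "0 \<le> B v" "A v \<le> K" "B v \<le> K" "A v + B v = Z k v" for v
      using Zpos[of k v] Zle[of k v] by (auto simp: A_def B_def K_def algebra_simps)
    have indk: "indep_of H \<E> k X 1 (\<lambda>_. X (Suc k))" using ind False by (simp add: indep_seq_def)
    have "mean (\<lambda>\<omega>. A (rvec k X \<omega>) + B (rvec k X \<omega>) * exp (l * h (Suc k) (X (Suc k) \<omega>)))
        = mean (\<lambda>\<omega>. A (rvec k X \<omega>) + B (rvec k X \<omega>) * mean (\<lambda>\<omega>. exp (l * h (Suc k) (X (Suc k) \<omega>))))"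
    proof (rule indep_affine[OF indk Am Bm, where K=K and g="\<lambda>z. exp (l * h (Suc k) z)"])
      show "(\<lambda>z. exp (l * h (Suc k) z)) \<in> borel_measurable borel" using hm by measurable
      show "exp (l * h (Suc k) z) \<le> K" for z unfolding K_def by (rule max.coboundedI2[OF expb])
    qed (use nn rvA AH BH expH in auto)
    then have "mean (\<lambda>\<omega>. Z (Suc k) (x \<omega>)) = mean (\<lambda>\<omega>. A (x \<omega>) + B (x \<omega>) * G (Suc k))"
      unfolding rvA G_def split A_def[symmetric] B_def[symmetric] x_def .
    also have "\<dots> \<le> mean (\<lambda>\<omega>. max 1 (G (Suc k)) * Z k (x \<omega>))"
    proof (rule mean_mono)
      show "bounded_rv (\<lambda>\<omega>. A (x \<omega>) + B (x \<omega>) * G (Suc k))"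
      proof (rule bounded_rvI)
        show "(\<lambda>\<omega>. A (x \<omega>) + B (x \<omega>) * G (Suc k)) \<in> H" by (intro H_add H_mult AH BH H_const)
        show "\<bar>A (x \<omega>) + B (x \<omega>) * G (Suc k)\<bar> \<le> K + K * G (Suc k)" for \<omega>
          using nn[of "x \<omega>"] G0[of "Suc k"] by (auto intro!: add_mono mult_right_mono)
      qed
      show "bounded_rv (\<lambda>\<omega>. max 1 (G (Suc k)) * Z k (x \<omega>))" by (intro bounded_rv_cmult Zb)
      fix \<omega>
      have "A (x \<omega>) + B (x \<omega>) * G (Suc k) \<le> A (x \<omega>) * max 1 (G (Suc k)) + B (x \<omega>) * max 1 (G (Suc k))"
        using nn[of "x \<omega>"] mult_left_mono[of 1 "max 1 (G (Suc k))" "A (x \<omega>)"]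
        by (intro add_mono mult_left_mono) auto
      also have "\<dots> = max 1 (G (Suc k)) * Z k (x \<omega>)"
        unfolding nn(5)[symmetric] by (simp add: algebra_simps)
      finally show "A (x \<omega>) + B (x \<omega>) * G (Suc k) \<le> max 1 (G (Suc k)) * Z k (x \<omega>)" .
    qed
    also have "\<dots> = max 1 (G (Suc k)) * mean (\<lambda>\<omega>. Z k (x \<omega>))" by (intro mean_cmult Zb) auto
    finally show ?thesis .
  qed
  have prod: "mean (\<lambda>\<omega>. Z k (x \<omega>)) \<le> (\<Prod>i=1..k. max 1 (G i))" for k
  proof (induction k)
    case 0
    show ?case by (simp add: Z_def mean_const)
  next
    case (Suc k)
    have "mean (\<lambda>\<omega>. Z (Suc k) (x \<omega>)) \<le> max 1 (G (Suc k)) * mean (\<lambda>\<omega>. Z k (x \<omega>))" by (rule step)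
    also have "\<dots> \<le> max 1 (G (Suc k)) * (\<Prod>i=1..k. max 1 (G i))" using Suc by (intro mult_left_mono) auto
    finally show ?case by (simp add: mult.commute)
  qed
  have S: "{\<omega> \<in> space M. exceeds h y n (x \<omega>)} \<in> sets M"
    unfolding x_def by (rule exceeds_event[OF XH hm])
  have "cap {\<omega> \<in> space M. exceeds h y n (x \<omega>)} \<le> mean (\<lambda>\<omega>. exp (- l * y) * Z n (x \<omega>))"
    unfolding cap_eq_mean
  proof (intro mean_mono bounded_rv_indicator bounded_rv_cmult Zb S)
    fix \<omega>
    have "exceeds h y n (x \<omega>) \<Longrightarrow> exp (l * y) \<le> Z n (x \<omega>)"
      using stopped_exp_cases[OF l, of h y n "x \<omega>"] by (simp add: Z_def)
    then show "indicator {\<omega> \<in> space M. exceeds h y n (x \<omega>)} \<omega> \<le> exp (- l * y) * Z n (x \<omega>)"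
      using Zpos[of n "x \<omega>"] by (auto simp: indicator_def exp_minus field_simps)
  qed
  also have "\<dots> = exp (- l * y) * mean (\<lambda>\<omega>. Z n (x \<omega>))" by (intro mean_cmult Zb) auto
  also have "\<dots> \<le> exp (- l * y) * (\<Prod>i=1..n. max 1 (G i))" using prod by (intro mult_left_mono) auto
  finally show ?thesis unfolding exceeds_def x_def G_def .
qed

text \<open>
  If $u_k$ is the capacity of the union of the first $k$ events, then independence of the next
  variable gives $u_{k+1} = p_{k+1} + (1-p_{k+1})u_k$ exactly: if $U$ indicates that union, the
  test function is $U + (1-U)g$, whose coefficients are nonnegative.
\<close>
proposition cap_union_indep:
  assumes XH: "\<And>i. i \<ge> 1 \<Longrightarrow> X i \<in> H" and ind: "indep_seq H \<E> X"
    and T: "\<And>i. T i \<in> sets borel"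
  shows "cap {\<omega> \<in> space M. \<exists>i\<in>{1..n}. X i \<omega> \<in> T i}
    = 1 - (\<Prod>i=1..n. 1 - cap {\<omega> \<in> space M. X i \<omega> \<in> T i})"
proof -
  define U where "U k v \<longleftrightarrow> (\<exists>i\<in>{1..k}. v i \<in> T i)" for k and v :: "nat \<Rightarrow> real"
  define x where "x \<omega> = (\<lambda>i. X i \<omega>)" for \<omega>
  define P where "P i = cap {\<omega> \<in> space M. X i \<omega> \<in> T i}" for i
  define u where "u k = cap {\<omega> \<in> space M. U k (x \<omega>)}" for k
  have S: "{\<omega> \<in> space M. X i \<omega> \<in> T i} \<in> sets M" if "i \<ge> 1" for i
    using measurable_sets[OF H_borel_measurable[OF XH[OF that]] T[of i]] by (simp add: vimage_def Int_def conj_commute)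
  have SU: "{\<omega> \<in> space M. U k (x \<omega>)} \<in> sets M" for k
  proof -
    have "{\<omega> \<in> space M. U k (x \<omega>)} = (\<Union>i\<in>{1..k}. {\<omega> \<in> space M. X i \<omega> \<in> T i})"
      by (auto simp: U_def x_def)
    then show ?thesis using S by auto
  qed
  have capP: "cap {\<omega> \<in> space M. Q \<omega>} = mean (\<lambda>\<omega>. of_bool (Q \<omega>))" if "{\<omega> \<in> space M. Q \<omega>} \<in> sets M" for Q
    unfolding cap_eq_mean mean_def
    by (rule arg_cong[where f=real_of_ereal], rule E_cong) (use that in \<open>auto intro: H_indicator\<close>)
  have brU: "bounded_rv (\<lambda>\<omega>. of_bool (U k (x \<omega>)))" for k
    by (rule bounded_rvI[OF H_event[OF SU], of _ 1]) auto
  have USuc: "U (Suc k) v \<longleftrightarrow> U k v \<or> v (Suc k) \<in> T (Suc k)" for k v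
  proof -
    have "{1..Suc k} = insert (Suc k) {1..k}" by auto
    then show ?thesis unfolding U_def by auto
  qed
  have step: "u (Suc k) = P (Suc k) + (1 - P (Suc k)) * u k" for k
  proof (cases "k = 0")
    case True
    have "u k = 0" using True by (simp add: u_def U_def cap_empty)
    moreover have "u (Suc k) = P (Suc k)" using True by (simp add: u_def U_def P_def x_def)
    ultimately show ?thesis by simp
  next
    case False
    define A where "A v = (of_bool (U k v) :: real)" for v
    define B where "B v = (1 - of_bool (U k v) :: real)" for v
    have "Measurable.pred (borel_vec k) (U k)"
    proof -
      have "Measurable.pred (borel_vec k) (\<lambda>v. v i \<in> T i)" if "i \<in> {1..k}" for i
        using T[of i] by (intro measurable_coordinate that pred_in_If pred_sets2) auto
      then show ?thesis unfolding U_def[abs_def] by (intro pred_intros_finite) auto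
    qed
    then have Am: "A \<in> borel_measurable (borel_vec k)" and Bm: "B \<in> borel_measurable (borel_vec k)"
      unfolding A_def[abs_def] B_def[abs_def] by measurable
    have rv: "U k (rvec k X \<omega>) = U k (x \<omega>)" for \<omega>
      unfolding U_def by (intro bex_cong refl) (simp add: rvec_def x_def)
    have rvA: "A (rvec k X \<omega>) = A (x \<omega>)" "B (rvec k X \<omega>) = B (x \<omega>)" for \<omega>
      by (simp_all add: A_def B_def rv)
    have AH: "(\<lambda>\<omega>. A (x \<omega>)) \<in> H" unfolding A_def by (rule H_event[OF SU])
    have "(\<lambda>\<omega>. 1 + (-1) * A (x \<omega>)) \<in> H" by (intro H_add H_cmult H_const AH)
    then have BH: "(\<lambda>\<omega>. B (x \<omega>)) \<in> H" by (simp add: A_def B_def)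
    have gH: "(\<lambda>\<omega>. indicator (T (Suc k)) (X (Suc k) \<omega>)) \<in> H"
      using H_event[OF S[of "Suc k"]] by (simp add: indicator_def of_bool_def)
    have mg: "mean (\<lambda>\<omega>. indicator (T (Suc k)) (X (Suc k) \<omega>)) = P (Suc k)"
      unfolding P_def capP[OF S[of "Suc k", simplified]] by (simp add: indicator_def of_bool_def)
    have indk: "indep_of H \<E> k X 1 (\<lambda>_. X (Suc k))" using ind False by (simp add: indep_seq_def)
    have "mean (\<lambda>\<omega>. A (rvec k X \<omega>) + B (rvec k X \<omega>) * indicator (T (Suc k)) (X (Suc k) \<omega>))
        = mean (\<lambda>\<omega>. A (rvec k X \<omega>) + B (rvec k X \<omega>) * mean (\<lambda>\<omega>. indicator (T (Suc k)) (X (Suc k) \<omega>)))"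
    proof (rule indep_affine[OF indk Am Bm, where K=1 and g="indicator (T (Suc k))"])
      show "(indicator (T (Suc k)) :: real \<Rightarrow> real) \<in> borel_measurable borel"
        using T by (intro borel_measurable_indicator) auto
    qed (use rvA AH BH gH in \<open>auto simp: A_def B_def indicator_def\<close>)
    then have eq: "mean (\<lambda>\<omega>. A (x \<omega>) + B (x \<omega>) * indicator (T (Suc k)) (X (Suc k) \<omega>))
        = mean (\<lambda>\<omega>. A (x \<omega>) + B (x \<omega>) * P (Suc k))" unfolding rvA mg .
    have "u (Suc k) = mean (\<lambda>\<omega>. A (x \<omega>) + B (x \<omega>) * indicator (T (Suc k)) (X (Suc k) \<omega>))"
      unfolding u_def capP[OF SU]
      by (rule arg_cong[where f=mean]) (auto simp: USuc A_def B_def x_def indicator_def)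
    also note eq
    also have "mean (\<lambda>\<omega>. A (x \<omega>) + B (x \<omega>) * P (Suc k)) = mean (\<lambda>\<omega>. P (Suc k) + (1 - P (Suc k)) * of_bool (U k (x \<omega>)))"
      by (rule arg_cong[where f=mean]) (auto simp: A_def B_def)
    also have "\<dots> = P (Suc k) + (1 - P (Suc k)) * mean (\<lambda>\<omega>. of_bool (U k (x \<omega>)))"
      using cap_le_1[OF S[of "Suc k"]]
      by (subst mean_add_const, intro bounded_rv_cmult brU, subst mean_cmult[OF brU]) (auto simp: P_def)
    also have "mean (\<lambda>\<omega>. of_bool (U k (x \<omega>))) = u k" unfolding u_def by (rule capP[OF SU, symmetric])
    finally show ?thesis .
  qed
  have "u n = 1 - (\<Prod>i=1..n. 1 - P i)"
  proof (induction n)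
    case 0
    then show ?case by (simp add: u_def U_def cap_empty)
  next
    case (Suc n)
    have "u (Suc n) = P (Suc n) + (1 - P (Suc n)) * (1 - (\<Prod>i=1..n. 1 - P i))"
      unfolding step Suc.IH ..
    then show ?case by (simp add: algebra_simps)
  qed
  then show ?thesis by (simp add: u_def U_def P_def x_def)
qed

end

section \<open>Tail bounds for weighted sums\<close>

definition trunc :: "real \<Rightarrow> real \<Rightarrow> real" where
  "trunc L z = max (- L) (min L z)"

lemma trunc_lipschitz: "\<bar>trunc L x - trunc L y\<bar> \<le> \<bar>x - y\<bar>"
  unfolding trunc_def by linarith

lemma trunc_le: "L \<ge> 0 \<Longrightarrow> trunc L z \<le> L"
  by (auto simp: trunc_def)

lemma abs_trunc_le: "L \<ge> 0 \<Longrightarrow> \<bar>trunc L z\<bar> \<le> L" "L \<ge> 0 \<Longrightarrow> \<bar>trunc L z\<bar> \<le> \<bar>z\<bar>"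
  by (auto simp: trunc_def)

lemma trunc_eq: "\<bar>z\<bar> \<le> L \<Longrightarrow> trunc L z = z"
  by (auto simp: trunc_def)

context sublinear_expectation_space
begin

lemma sets_greater: "X \<in> H \<Longrightarrow> {\<omega> \<in> space M. X \<omega> > u} \<in> sets M"
  using H_borel_measurable by measurable

lemma sets_abs_greater: "X \<in> H \<Longrightarrow> {\<omega> \<in> space M. \<bar>X \<omega>\<bar> > u} \<in> sets M"
  using sets_greater[OF H_abs] by simp

text \<open>
  The layers $h\,I(Z > nh)$, $n \ge 0$, add up to at least $Z$. Countable sub-additivity bounds
  $E[Z]$ by $h\sum_n V(Z > nh)$, a Riemann sum that exceeds the integral by at most its first term
  $h$; let $h \to 0$. In this way capacities control expectations of unbounded variables.
\<close>
lemma E_le_integral_tail: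
  assumes ca: "countably_subadditive_exp M H \<E>" and Z: "Z \<in> H" "\<And>\<omega>. \<omega> \<in> space M \<Longrightarrow> Z \<omega> \<ge> 0"
  shows "\<E> Z \<le> enn2ereal (\<integral>\<^sup>+x\<in>{0..}. ennreal (cap {\<omega> \<in> space M. Z \<omega> > x}) \<partial>lborel)"
    (is "_ \<le> enn2ereal ?I")
proof (rule ereal_le_epsilon2)
  fix h :: real assume h: "h > 0"
  define c where "c x = cap {\<omega> \<in> space M. Z \<omega> > x}" for x
  note S = sets_greater[OF Z(1)]
  have c: "antimono c" "c x \<ge> 0" "c x \<le> 1" for x
    unfolding c_def using S by (auto intro!: antimonoI cap_mono cap_nonneg cap_le_1)
  define W where "W n \<omega> = h * of_bool (Z \<omega> > real n * h)" for n :: nat and \<omega>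
  have WH: "W n \<in> H" for n unfolding W_def[abs_def] by (intro H_cmult H_event S)
  have EW: "\<E> (W n) = ereal (h * c (real n * h))" for n
  proof -
    have "\<E> (W n) = \<E> (\<lambda>\<omega>. h * indicator {\<omega> \<in> space M. Z \<omega> > real n * h} \<omega>)"
      by (rule E_cong[OF WH]) (auto simp: W_def)
    also have "\<dots> = ereal h * ereal (c (real n * h))"
      using h pos_homogeneous[OF H_indicator[OF S]] capacity_eq_cap[OF S]
      by (simp add: c_def capacity_def)
    finally show ?thesis by simp
  qed
  have "\<E> Z \<le> (\<Sum>n. \<E> (W n))"
  proof (rule ca[unfolded countably_subadditive_exp_def, rule_format, OF Z(1) WH Z(2)])
    show "0 \<le> W n \<omega>" for n \<omega> using h by (simp add: W_def)
    fix \<omega> assume w: "\<omega> \<in> space M"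
    define m where "m = nat \<lceil>Z \<omega> / h\<rceil>"
    have "Z \<omega> / h \<le> real m" unfolding m_def by (rule real_nat_ceiling_ge)
    then have "ereal (Z \<omega>) \<le> ereal (real m * h)" using h by (simp add: field_simps)
    also have "real m * h = (\<Sum>n<m. W n \<omega>)"
    proof -
      have "W n \<omega> = h" if "n < m" for n
      proof -
        have "real n < Z \<omega> / h" using that unfolding m_def by linarith
        then show ?thesis using h by (simp add: W_def field_simps)
      qed
      then show ?thesis by simp
    qed
    also have "ereal (\<Sum>n<m. W n \<omega>) = (\<Sum>n<m. ereal (W n \<omega>))" by simp
    also have "\<dots> \<le> (\<Sum>n. ereal (W n \<omega>))" using h by (intro suminf_upper) (simp add: W_def)
    finally show "ereal (Z \<omega>) \<le> (\<Sum>n. ereal (W n \<omega>))" .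
  qed
  also have "\<dots> = (\<Sum>n. enn2ereal (ennreal (h * c (real n * h))))"
    using h c by (simp add: EW enn2ereal_ennreal)
  also have "\<dots> = enn2ereal (\<Sum>n. ennreal (h * c (real n * h)))" by simp
  also have "(\<Sum>n. ennreal (h * c (real n * h))) \<le> ?I + ennreal h"
  proof (rule suminf_le_const[OF summableI])
    fix m
    have "(\<Sum>n<m. ennreal (h * c (real n * h))) \<le> (\<Sum>n<Suc m. ennreal (h * c (real n * h)))"
      by simp
    also have "\<dots> = ennreal (\<Sum>n<Suc m. h * c (real n * h))" using h c by (intro sum_ennreal) simp
    also have "(\<Sum>n<Suc m. h * c (real n * h)) = h * c 0 + (\<Sum>n<m. h * c (real (Suc n) * h))"
      by (simp add: sum.lessThan_Suc_shift del: sum.lessThan_Suc)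
    also have "ennreal \<dots> \<le> ennreal h + ennreal (\<Sum>n<m. h * c (real (Suc n) * h))"
      using h c by (subst ennreal_plus[symmetric]) (auto intro!: sum_nonneg ennreal_leI mult_left_le)
    also have "\<dots> \<le> ennreal h + (\<integral>\<^sup>+x\<in>{0..<real m * h}. ennreal (c x) \<partial>lborel)"
      by (intro add_left_mono lower_sum_le_integral c h)
    also have "\<dots> \<le> ennreal h + ?I"
      unfolding c_def by (intro add_left_mono nn_integral_mono) (auto simp: indicator_def)
    finally show "(\<Sum>n<m. ennreal (h * c (real n * h))) \<le> ?I + ennreal h" by (simp add: add.commute)
  qed
  finally show "\<E> Z \<le> enn2ereal ?I + ereal h"
    using h by (simp add: plus_ennreal.rep_eq enn2ereal_ennreal less_eq_ennreal.rep_eq)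
qed

definition tail :: "('a \<Rightarrow> real) \<Rightarrow> real \<Rightarrow> real" where
  "tail X u = cap {\<omega> \<in> space M. \<bar>X \<omega>\<bar> > u}"

text \<open>
  The Choquet integral of $|X|^\theta$, written in terms of the tail of $X$. The variable
  $|X|^\theta$ itself need not belong to $H$ when $\theta < 1$, since $z \mapsto |z|^\theta$ is
  not locally Lipschitz at $0$.
\<close>
definition abs_moment :: "('a \<Rightarrow> real) \<Rightarrow> real \<Rightarrow> ennreal" where
  "abs_moment X \<theta> = (\<integral>\<^sup>+x\<in>{0..}. ennreal (tail X (x powr (1 / \<theta>))) \<partial>lborel)"

lemma tail_antimono: "X \<in> H \<Longrightarrow> antimono (tail X)"
  unfolding tail_def by (intro antimonoI cap_mono sets_abs_greater) auto

lemma tail_bounds: "X \<in> H \<Longrightarrow> 0 \<le> tail X u" "X \<in> H \<Longrightarrow> tail X u \<le> 1"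
  unfolding tail_def by (simp_all add: cap_nonneg cap_le_1 sets_abs_greater)

lemma tail_measurable: "X \<in> H \<Longrightarrow> tail X \<in> borel_measurable borel"
  by (intro antimono_borel_measurable tail_antimono)

lemma abs_powr_greater_iff:
  assumes "\<theta> > 0" "x \<ge> (0::real)"
  shows "\<bar>z\<bar> powr \<theta> > x \<longleftrightarrow> \<bar>z\<bar> > x powr (1 / \<theta>)"
proof -
  have "x = (x powr (1 / \<theta>)) powr \<theta>" using assms by (simp add: powr_powr)
  then have "\<bar>z\<bar> powr \<theta> > x \<longleftrightarrow> (x powr (1 / \<theta>)) powr \<theta> < \<bar>z\<bar> powr \<theta>" by simp
  also have "\<dots> \<longleftrightarrow> x powr (1 / \<theta>) < \<bar>z\<bar>"
    using assms powr_less_mono2[of \<theta> "x powr (1/\<theta>)" "\<bar>z\<bar>"] powr_mono2[of \<theta> "\<bar>z\<bar>" "x powr (1/\<theta>)"]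
    by (metis abs_ge_zero linorder_not_less less_imp_le powr_ge_zero)
  finally show ?thesis .
qed

text \<open>
  Only level sets of $|X|^\theta$ are used, so that the bound holds although the dominating
  function may lie outside $H$.
\<close>
lemma E_dominated_by_moment:
  assumes ca: "countably_subadditive_exp M H \<E>" and X: "X \<in> H" and Z: "Z \<in> H"
    and dom: "\<And>\<omega>. \<omega> \<in> space M \<Longrightarrow> 0 \<le> Z \<omega>" "\<And>\<omega>. \<omega> \<in> space M \<Longrightarrow> Z \<omega> \<le> K * \<bar>X \<omega>\<bar> powr \<theta>"
    and \<theta>: "\<theta> > 0" and K: "K \<ge> 0" and \<mu>: "abs_moment X \<theta> \<le> ennreal \<mu>" "\<mu> \<ge> 0"
  shows "\<E> Z \<le> ereal (K * \<mu>)"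
proof (cases "K = 0")
  case True
  then have "\<E> Z = \<E> (\<lambda>_. 0)" using dom by (intro E_cong[OF Z]) (auto intro: antisym)
  then show ?thesis using True by (simp add: const)
next
  case False
  then have K0: "K > 0" using K by simp
  have tm [measurable]: "tail X \<in> borel_measurable borel" by (rule tail_measurable[OF X])
  have "(\<integral>\<^sup>+x\<in>{0..}. ennreal (cap {\<omega> \<in> space M. Z \<omega> > x}) \<partial>lborel)
      \<le> (\<integral>\<^sup>+x\<in>{0..}. ennreal (tail X ((x / K) powr (1 / \<theta>))) \<partial>lborel)"
  proof (intro nn_integral_mono)
    fix x :: real
    have "cap {\<omega> \<in> space M. Z \<omega> > x} \<le> tail X ((x / K) powr (1 / \<theta>))" if "x \<ge> 0"
      unfolding tail_def
    proof (intro cap_mono sets_greater[OF Z] sets_abs_greater[OF X] subsetI)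
      fix \<omega> assume w: "\<omega> \<in> {\<omega> \<in> space M. Z \<omega> > x}"
      then have "x / K < \<bar>X \<omega>\<bar> powr \<theta>" using dom(2)[of \<omega>] K0 by (auto simp: field_simps)
      then show "\<omega> \<in> {\<omega> \<in> space M. \<bar>X \<omega>\<bar> > (x / K) powr (1 / \<theta>)}"
        using w abs_powr_greater_iff[OF \<theta>, of "x / K" "X \<omega>"] that K0 by auto
    qed
    then show "ennreal (cap {\<omega> \<in> space M. Z \<omega> > x}) * indicator {0..} x
        \<le> ennreal (tail X ((x / K) powr (1 / \<theta>))) * indicator {0..} x"
      by (auto simp: indicator_def intro: ennreal_leI)
  qed
  also have "\<dots> = ennreal \<bar>K\<bar> * (\<integral>\<^sup>+x. ennreal (tail X (((0 + K * x) / K) powr (1 / \<theta>))) * indicator {0..} (0 + K * x) \<partial>lborel)"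
    using K0 by (intro nn_integral_real_affine) auto
  also have "(\<integral>\<^sup>+x. ennreal (tail X (((0 + K * x) / K) powr (1 / \<theta>))) * indicator {0..} (0 + K * x) \<partial>lborel)
      = abs_moment X \<theta>"
    unfolding abs_moment_def using K0 by (intro nn_integral_cong) (auto simp: indicator_def zero_le_mult_iff)
  also have "ennreal \<bar>K\<bar> * abs_moment X \<theta> \<le> ennreal K * ennreal \<mu>"
    using K \<mu> by (auto intro: mult_left_mono)
  also have "\<dots> = ennreal (K * \<mu>)" using K \<mu> by (simp add: ennreal_mult)
  finally have "enn2ereal (\<integral>\<^sup>+x\<in>{0..}. ennreal (cap {\<omega> \<in> space M. Z \<omega> > x}) \<partial>lborel) \<le> enn2ereal (ennreal (K * \<mu>))"
    by (simp add: less_eq_ennreal.rep_eq)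
  with E_le_integral_tail[OF ca Z dom(1)] K \<mu> show ?thesis
    by (simp add: enn2ereal_ennreal)
qed

text \<open>
  Write $Y$ for the truncation of $cX$ and $l = w/L$. If $\theta \le 1$, then $e^{lY} - 1 \le
  (l|Y|)^\theta e^w$ suffices. If $\theta > 1$, use $e^{lY} \le 1 + lY + |lY|^\theta e^w$. The
  linear term is small because $X$ is centred: $E[Y] \le E[cX] + E[(|cX| - L)^+]$, where $(|cX| -
  L)^+ \le L\,(|cX|/L)^\theta$. The constant $3$ collects $1$ from the linear term and $2$ from
  $w^\theta \le 2e^w$.
\<close>
lemma mean_exp_trunc_le:
  assumes ca: "countably_subadditive_exp M H \<E>" and X: "X \<in> H"
    and L: "L > 0" and w: "w \<ge> 0"
    and \<theta>: "0 < \<theta>" "\<theta> \<le> 2" and centred: "\<theta> > 1 \<Longrightarrow> \<E> X = 0 \<and> \<E> (\<lambda>\<omega>. - X \<omega>) = 0"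
    and \<mu>: "abs_moment X \<theta> \<le> ennreal \<mu>" "\<mu> \<ge> 0"
  shows "mean (\<lambda>\<omega>. exp (w / L * trunc L (c * X \<omega>))) \<le> 1 + 3 * exp (2 * w) * ((\<bar>c\<bar> / L) powr \<theta> * \<mu>)"
proof -
  define l where "l = w / L"
  have l: "l \<ge> 0" "l * L = w" using L w by (auto simp: l_def)
  define Y where "Y \<omega> = trunc L (c * X \<omega>)" for \<omega>
  define d where "d = (\<bar>c\<bar> / L) powr \<theta>"
  have d0: "d \<ge> 0" by (simp add: d_def)
  have lipc: "\<bar>trunc L (c * u) - trunc L (c * v)\<bar> \<le> \<bar>c\<bar> * \<bar>u - v\<bar>" for u v
    using trunc_lipschitz[of L "c * u" "c * v"] by (simp add: abs_mult right_diff_distrib[symmetric])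
  have Yb: "\<bar>Y \<omega>\<bar> \<le> L" for \<omega> unfolding Y_def using L by (intro abs_trunc_le) auto
  have YH: "Y \<in> H" unfolding Y_def[abs_def] using X lipc by (rule H_Lipschitz)
  have Ybr: "bounded_rv Y" using Yb by (intro bounded_rvI[OF YH]) auto
  have lY: "\<bar>l * Y \<omega>\<bar> \<le> w" for \<omega>
    using Yb[of \<omega>] l mult_left_mono[of "\<bar>Y \<omega>\<bar>" L l] by (simp add: abs_mult)
  have lYX: "\<bar>l * Y \<omega>\<bar> powr \<theta> \<le> w powr \<theta> * (d * \<bar>X \<omega>\<bar> powr \<theta>)" for \<omega>
  proof -
    have "\<bar>Y \<omega>\<bar> \<le> \<bar>c * X \<omega>\<bar>" unfolding Y_def using L by (intro abs_trunc_le) auto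
    then have "\<bar>l * Y \<omega>\<bar> \<le> l * \<bar>c * X \<omega>\<bar>" using l by (simp add: abs_mult mult_left_mono)
    also have "\<dots> = w * (\<bar>c\<bar> / L * \<bar>X \<omega>\<bar>)" by (simp add: l_def abs_mult)
    finally have "\<bar>l * Y \<omega>\<bar> powr \<theta> \<le> (w * (\<bar>c\<bar> / L * \<bar>X \<omega>\<bar>)) powr \<theta>"
      using \<theta> by (intro powr_mono2) auto
    also have "\<dots> = w powr \<theta> * (d * \<bar>X \<omega>\<bar> powr \<theta>)"
      using w L by (simp add: powr_mult d_def del: times_divide_eq_left times_divide_eq_right)
    finally show ?thesis .
  qed
  have eH: "(\<lambda>\<omega>. exp (l * Y \<omega>)) \<in> H"
    unfolding Y_def using X l(1) trunc_le[of L] L lipc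
    by (intro H_exp_bounded_above[where h="\<lambda>z. trunc L (c * z)" and L=L and C="\<bar>c\<bar>"]) auto
  have eb: "bounded_rv (\<lambda>\<omega>. exp (l * Y \<omega>))"
    using lY by (intro bounded_rvI[OF eH, of "exp w"]) (auto simp: abs_le_iff)
  have w1: "w \<le> exp w" using exp_ge_add_one_self[of w] by linarith
  have e2: "exp w * exp w = exp (2 * w)" by (simp add: exp_add[symmetric])
  show ?thesis
  proof (cases "\<theta> \<le> 1")
    case True
    define Z where "Z \<omega> = exp (l * \<bar>Y \<omega>\<bar>) - 1" for \<omega>
    have ZH: "Z \<in> H"
    proof -
      have "(\<lambda>\<omega>. exp (l * \<bar>Y \<omega>\<bar>)) \<in> H"
        unfolding Y_def using X l(1) abs_trunc_le(1)[of L] L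
        by (intro H_exp_bounded_above[where h="\<lambda>z. \<bar>trunc L (c * z)\<bar>" and L=L and C="\<bar>c\<bar>"])
          (auto intro: order_trans[OF abs_triangle_ineq3 lipc])
      from H_add[OF this H_const[of "-1"]] show ?thesis by (simp add: Z_def[abs_def])
    qed
    have Z0: "Z \<omega> \<ge> 0" for \<omega> using l by (simp add: Z_def)
    have wp: "w powr \<theta> \<le> exp w"
    proof (cases "w \<le> 1")
      case True
      then have "w powr \<theta> \<le> 1" using w \<theta> by (intro powr_le1) auto
      also have "1 \<le> exp w" using w by simp
      finally show ?thesis .
    next
      case False
      then have "w powr \<theta> \<le> w powr 1" using \<open>\<theta> \<le> 1\<close> by (intro powr_mono) auto
      then show ?thesis using w1 w by simp
    qed
    have Zle: "Z \<omega> \<le> exp (2 * w) * d * \<bar>X \<omega>\<bar> powr \<theta>" for \<omega>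
    proof -
      have "Z \<omega> \<le> (l * \<bar>Y \<omega>\<bar>) powr \<theta> * exp (l * \<bar>Y \<omega>\<bar>)"
        unfolding Z_def using l \<theta> True by (intro exp_minus_one_le) auto
      also have "l * \<bar>Y \<omega>\<bar> = \<bar>l * Y \<omega>\<bar>" using l by (simp add: abs_mult)
      also have "\<bar>l * Y \<omega>\<bar> powr \<theta> * exp \<bar>l * Y \<omega>\<bar> \<le> (w powr \<theta> * (d * \<bar>X \<omega>\<bar> powr \<theta>)) * exp w"
        using lYX lY d0 by (intro mult_mono) auto
      also have "\<dots> \<le> (exp w * (d * \<bar>X \<omega>\<bar> powr \<theta>)) * exp w"
        using wp d0 by (intro mult_right_mono) auto
      also have "\<dots> = exp (2 * w) * d * \<bar>X \<omega>\<bar> powr \<theta>" by (simp add: e2[symmetric])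
      finally show ?thesis .
    qed
    have "\<E> Z \<le> ereal (exp (2 * w) * d * \<mu>)"
      using Zle Z0 d0 \<theta>(1) by (intro E_dominated_by_moment[OF ca X ZH _ _ _ _ \<mu>]) auto
    moreover have Zb: "bounded_rv Z"
    proof (rule bounded_rvI[OF ZH])
      show "\<bar>Z \<omega>\<bar> \<le> exp w" for \<omega>
      proof -
        have "l * \<bar>Y \<omega>\<bar> \<le> w" using lY[of \<omega>] l by (simp add: abs_mult)
        then have "exp (l * \<bar>Y \<omega>\<bar>) \<le> exp w" by simp
        then have "Z \<omega> \<le> exp w" unfolding Z_def by linarith
        then show ?thesis using Z0[of \<omega>] by simp
      qed
    qed
    ultimately have mZ: "mean Z \<le> exp (2 * w) * d * \<mu>" by (simp add: E_eq_mean)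
    have "mean (\<lambda>\<omega>. exp (l * Y \<omega>)) \<le> mean (\<lambda>\<omega>. 1 + Z \<omega>)"
    proof (intro mean_mono eb bounded_rv_add bounded_rv_const Zb)
      show "exp (l * Y \<omega>) \<le> 1 + Z \<omega>" for \<omega>
        using l mult_left_mono[of "Y \<omega>" "\<bar>Y \<omega>\<bar>" l] by (simp add: Z_def)
    qed
    also have "\<dots> = 1 + mean Z" by (rule mean_add_const[OF Zb])
    also have "\<dots> \<le> 1 + exp (2 * w) * d * \<mu>" using mZ by simp
    also have "\<dots> \<le> 1 + 3 * exp (2 * w) * (d * \<mu>)" using d0 \<mu>(2) by simp
    finally show ?thesis by (simp add: l_def Y_def d_def)
  next
    case False
    then have \<theta>1: "\<theta> > 1" by simp
    have EcX: "\<E> (\<lambda>\<omega>. c * X \<omega>) = 0"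
    proof (cases "c \<ge> 0")
      case True
      then show ?thesis using pos_homogeneous[OF X True] centred[OF \<theta>1] by simp
    next
      case False
      have "(\<lambda>\<omega>. - X \<omega>) \<in> H" using H_cmult[OF X, of "-1"] by simp
      from pos_homogeneous[OF this, of "-c"] False centred[OF \<theta>1] show ?thesis by simp
    qed
    define Q where "Q \<omega> = max 0 (\<bar>c * X \<omega>\<bar> - L)" for \<omega>
    have QH: "Q \<in> H" unfolding Q_def[abs_def]
    proof (rule H_Lipschitz[OF X, where f="\<lambda>z. max 0 (\<bar>c * z\<bar> - L)"])
      fix u v
      have "\<bar>max 0 (\<bar>c * u\<bar> - L) - max 0 (\<bar>c * v\<bar> - L)\<bar> \<le> \<bar>c * u - c * v\<bar>" by linarith
      then show "\<bar>max 0 (\<bar>c * u\<bar> - L) - max 0 (\<bar>c * v\<bar> - L)\<bar> \<le> \<bar>c\<bar> * \<bar>u - v\<bar>"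
        by (simp add: abs_mult right_diff_distrib[symmetric])
    qed
    have Qle: "Q \<omega> \<le> L * d * \<bar>X \<omega>\<bar> powr \<theta>" for \<omega>
    proof (cases "\<bar>c * X \<omega>\<bar> \<le> L")
      case True
      then show ?thesis using L d0 by (simp add: Q_def)
    next
      case False
      define t where "t = \<bar>c\<bar> / L * \<bar>X \<omega>\<bar>"
      have t: "t > 1" "L * t = \<bar>c * X \<omega>\<bar>" using False L by (auto simp: t_def abs_mult field_simps)
      have "t powr 1 \<le> t powr \<theta>" using t \<theta>1 by (intro powr_mono) auto
      then have "L * t \<le> L * t powr \<theta>" using t(1) L by (intro mult_left_mono) auto
      moreover have "Q \<omega> \<le> L * t" using t False L by (simp add: Q_def)
      moreover have "t powr \<theta> = d * \<bar>X \<omega>\<bar> powr \<theta>" unfolding t_def d_def powr_mult ..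
      ultimately show ?thesis by simp
    qed
    have EQ: "\<E> Q \<le> ereal (L * d * \<mu>)"
      using Qle d0 L \<theta>(1) by (intro E_dominated_by_moment[OF ca X QH _ _ _ _ \<mu>]) (auto simp: Q_def)
    have "\<E> Y \<le> \<E> (\<lambda>\<omega>. c * X \<omega> + Q \<omega>)"
    proof (intro mono H_add H_cmult X QH YH)
      show "Y \<omega> \<le> c * X \<omega> + Q \<omega>" for \<omega> unfolding Y_def trunc_def Q_def using L by linarith
    qed
    also have "\<dots> \<le> \<E> (\<lambda>\<omega>. c * X \<omega>) + \<E> Q"
      using EcX by (intro subadditive H_cmult X QH) auto
    also have "\<dots> \<le> ereal (L * d * \<mu>)" using EcX EQ by simp
    finally have mY: "mean Y \<le> L * d * \<mu>" by (simp add: E_eq_mean[OF Ybr])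
    define R where "R \<omega> = exp (l * Y \<omega>) - 1 - l * Y \<omega>" for \<omega>
    have R: "R \<omega> = exp (l * Y \<omega>) + ((-1) + (-l) * Y \<omega>)" for \<omega> by (simp add: R_def)
    have RH: "R \<in> H" unfolding R[abs_def] by (intro H_add H_const H_cmult eH YH)
    have Rb: "bounded_rv R" unfolding R[abs_def]
      by (intro bounded_rv_add bounded_rv_const bounded_rv_cmult eb Ybr)
    have R0: "R \<omega> \<ge> 0" for \<omega> unfolding R_def using exp_ge_add_one_self[of "l * Y \<omega>"] by linarith
    have wp: "w powr \<theta> \<le> 2 * exp w"
    proof (cases "w \<le> 1")
      case True
      then have "w powr \<theta> \<le> 1" using w \<theta> by (intro powr_le1) auto
      also have "1 \<le> 2 * exp w" using w one_le_exp_iff[of w] by linarith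
      finally show ?thesis .
    next
      case False
      then have "w powr \<theta> \<le> w powr 2" using \<theta> by (intro powr_mono) auto
      also have "\<dots> = w\<^sup>2" using False by simp
      also have "\<dots> \<le> 2 * exp w" using exp_lower_Taylor_quadratic[OF w] w by simp
      finally show ?thesis .
    qed
    have Rle: "R \<omega> \<le> 2 * exp (2 * w) * d * \<bar>X \<omega>\<bar> powr \<theta>" for \<omega>
    proof -
      have "R \<omega> \<le> \<bar>l * Y \<omega>\<bar> powr \<theta> * exp \<bar>l * Y \<omega>\<bar>"
        unfolding R_def using \<theta>1 \<theta>(2) by (intro exp_minus_one_minus_le) auto
      also have "\<dots> \<le> (w powr \<theta> * (d * \<bar>X \<omega>\<bar> powr \<theta>)) * exp w"
        using lYX lY d0 by (intro mult_mono) auto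
      also have "\<dots> \<le> (2 * exp w * (d * \<bar>X \<omega>\<bar> powr \<theta>)) * exp w"
        using wp d0 by (intro mult_right_mono) auto
      also have "\<dots> = 2 * exp (2 * w) * d * \<bar>X \<omega>\<bar> powr \<theta>" by (simp add: e2[symmetric])
      finally show ?thesis .
    qed
    have "\<E> R \<le> ereal (2 * exp (2 * w) * d * \<mu>)"
      using Rle R0 d0 \<theta>(1) by (intro E_dominated_by_moment[OF ca X RH _ _ _ _ \<mu>]) auto
    then have mR: "mean R \<le> 2 * exp (2 * w) * d * \<mu>" by (simp add: E_eq_mean[OF Rb])
    have "mean (\<lambda>\<omega>. exp (l * Y \<omega>)) = mean (\<lambda>\<omega>. 1 + (l * Y \<omega> + R \<omega>))" by (simp add: R_def)
    also have "\<dots> = 1 + mean (\<lambda>\<omega>. l * Y \<omega> + R \<omega>)"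
      by (intro mean_add_const bounded_rv_add bounded_rv_cmult Ybr Rb)
    also have "\<dots> \<le> 1 + (mean (\<lambda>\<omega>. l * Y \<omega>) + mean R)"
      by (intro add_left_mono mean_add_le bounded_rv_cmult Ybr Rb)
    also have "mean (\<lambda>\<omega>. l * Y \<omega>) = l * mean Y" by (rule mean_cmult[OF Ybr l(1)])
    also have "l * mean Y \<le> l * (L * d * \<mu>)" using mY l by (intro mult_left_mono)
    also have "l * (L * d * \<mu>) = w * (d * \<mu>)" using l by (simp add: mult.assoc[symmetric])
    also have "\<dots> \<le> exp (2 * w) * (d * \<mu>)"
    proof (rule mult_right_mono)
      have "exp w \<le> exp (2 * w)" using w by simp
      then show "w \<le> exp (2 * w)" using w1 by linarith
    qed (use d0 \<mu> in simp)
    also note mR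
    finally show ?thesis by (simp add: l_def Y_def d_def algebra_simps)
  qed
qed

text \<open>
  The exponential inequality with $w = -\frac12 \ln B$. This choice makes $e^{2w}B = 1$, so the
  product of expectations stays below $e^3$ while the factor $e^{-wy/L}$ becomes $B^{y/(2L)}$.
\<close>
lemma truncated_sum_tail_le:
  assumes ca: "countably_subadditive_exp M H \<E>" and XH: "\<And>i. i \<ge> 1 \<Longrightarrow> X i \<in> H"
    and ind: "indep_seq H \<E> X" and L: "L > 0"
    and \<theta>: "0 < \<theta>" "\<theta> \<le> 2"
    and centred: "\<And>i. i \<ge> 1 \<Longrightarrow> \<theta> > 1 \<Longrightarrow> \<E> (X i) = 0 \<and> \<E> (\<lambda>\<omega>. - X i \<omega>) = 0"
    and \<mu>: "\<And>i. i \<ge> 1 \<Longrightarrow> abs_moment (X i) \<theta> \<le> ennreal \<mu>" "\<mu> \<ge> 0"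
    and B: "(\<Sum>i=1..n. (\<bar>c i\<bar> / L) powr \<theta> * \<mu>) \<le> B" "0 < B" "B \<le> 1"
  shows "cap {\<omega> \<in> space M. \<exists>k\<in>{1..n}. (\<Sum>i=1..k. trunc L (c i * X i \<omega>)) > y}
    \<le> exp 3 * B powr (y / L / 2)"
proof -
  define w where "w = - ln B / 2"
  have w: "w \<ge> 0" using B by (simp add: w_def)
  have lip: "\<bar>trunc L (c i * u) - trunc L (c i * v)\<bar> \<le> \<bar>c i\<bar> * \<bar>u - v\<bar>" for i u v
    using trunc_lipschitz[of L "c i * u" "c i * v"] by (simp add: abs_mult right_diff_distrib[symmetric])
  have "cap {\<omega> \<in> space M. \<exists>k\<in>{1..n}. (\<Sum>i=1..k. trunc L (c i * X i \<omega>)) > y}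
      \<le> exp (- (w / L) * y) * (\<Prod>i=1..n. max 1 (mean (\<lambda>\<omega>. exp (w / L * trunc L (c i * X i \<omega>)))))"
    by (rule exponential_maximal_inequality[OF XH ind, where h="\<lambda>i z. trunc L (c i * z)" and L=L and C="\<lambda>i. \<bar>c i\<bar>"])
      (use w L lip trunc_le in auto)
  also have "\<dots> \<le> exp (- (w / L) * y) * exp 3"
  proof (rule mult_left_mono)
    have "(\<Prod>i=1..n. max 1 (mean (\<lambda>\<omega>. exp (w / L * trunc L (c i * X i \<omega>)))))
        \<le> (\<Prod>i=1..n. exp (3 * exp (2 * w) * ((\<bar>c i\<bar> / L) powr \<theta> * \<mu>)))"
    proof (rule prod_mono)
      fix i assume i: "i \<in> {1..n}"
      have "mean (\<lambda>\<omega>. exp (w / L * trunc L (c i * X i \<omega>))) \<le> 1 + 3 * exp (2 * w) * ((\<bar>c i\<bar> / L) powr \<theta> * \<mu>)"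
        using i by (intro mean_exp_trunc_le ca XH L w \<theta> \<mu> centred) auto
      also have "\<dots> \<le> exp (3 * exp (2 * w) * ((\<bar>c i\<bar> / L) powr \<theta> * \<mu>))" by (rule exp_ge_add_one_self)
      finally show "0 \<le> max 1 (mean (\<lambda>\<omega>. exp (w / L * trunc L (c i * X i \<omega>)))) \<and>
          max 1 (mean (\<lambda>\<omega>. exp (w / L * trunc L (c i * X i \<omega>))))
          \<le> exp (3 * exp (2 * w) * ((\<bar>c i\<bar> / L) powr \<theta> * \<mu>))"
        using \<mu>(2) by simp
    qed
    also have "\<dots> = exp (3 * exp (2 * w) * (\<Sum>i=1..n. (\<bar>c i\<bar> / L) powr \<theta> * \<mu>))"
      by (simp add: exp_sum[symmetric] sum_distrib_left)
    also have "\<dots> \<le> exp (3 * exp (2 * w) * B)" using B by simp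
    also have "exp (2 * w) * B = 1" using B by (simp add: w_def exp_minus)
    then have "3 * exp (2 * w) * B = 3" by simp
    finally show "(\<Prod>i=1..n. max 1 (mean (\<lambda>\<omega>. exp (w / L * trunc L (c i * X i \<omega>))))) \<le> exp 3" .
  qed simp
  also have "exp (- (w / L) * y) = B powr (y / L / 2)"
    using B by (simp add: w_def powr_def field_simps)
  finally show ?thesis by (simp add: mult.commute)
qed

text \<open>
  If no summand exceeds the truncation level, all partial sums agree with the truncated ones; the
  two signs of the sum are treated by the weights $c_i$ and $-c_i$.
\<close>
proposition max_weighted_sum_tail_le:
  assumes ca: "countably_subadditive_exp M H \<E>" and XH: "\<And>i. i \<ge> 1 \<Longrightarrow> X i \<in> H"
    and ind: "indep_seq H \<E> X" and L: "L > 0"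
    and \<theta>: "0 < \<theta>" "\<theta> \<le> 2"
    and centred: "\<And>i. i \<ge> 1 \<Longrightarrow> \<theta> > 1 \<Longrightarrow> \<E> (X i) = 0 \<and> \<E> (\<lambda>\<omega>. - X i \<omega>) = 0"
    and \<mu>: "\<And>i. i \<ge> 1 \<Longrightarrow> abs_moment (X i) \<theta> \<le> ennreal \<mu>" "\<mu> \<ge> 0"
    and B: "(\<Sum>i=1..n. (\<bar>c i\<bar> / L) powr \<theta> * \<mu>) \<le> B" "0 < B" "B \<le> 1"
  shows "cap {\<omega> \<in> space M. \<exists>k\<in>{1..n}. \<bar>\<Sum>i=1..k. c i * X i \<omega>\<bar> > y}
    \<le> (\<Sum>i=1..n. cap {\<omega> \<in> space M. \<bar>c i * X i \<omega>\<bar> > L}) + 2 * exp 3 * B powr (y / L / 2)"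
proof -
  define A where "A = (\<Union>i\<in>{1..n}. {\<omega> \<in> space M. \<bar>c i * X i \<omega>\<bar> > L})"
  define P where "P = {\<omega> \<in> space M. \<exists>k\<in>{1..n}. (\<Sum>i=1..k. trunc L (c i * X i \<omega>)) > y}"
  define N where "N = {\<omega> \<in> space M. \<exists>k\<in>{1..n}. (\<Sum>i=1..k. trunc L ((- c i) * X i \<omega>)) > y}"
  have [measurable]: "X i \<in> borel_measurable M" if "i \<in> {1..k}" for i k
    using H_borel_measurable[OF XH] that by auto
  have sA: "{\<omega> \<in> space M. \<bar>c i * X i \<omega>\<bar> > L} \<in> sets M" if "i \<in> {1..n}" for i
    using that by (intro sets_abs_greater H_cmult XH) auto
  have A: "A \<in> sets M" using sA by (auto simp: A_def)
  have Sm: "(\<lambda>\<omega>. \<Sum>i=1..k. f i (X i \<omega>)) \<in> borel_measurable M"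
    if "\<And>i. f i \<in> borel_measurable borel" for k and f :: "nat \<Rightarrow> real \<Rightarrow> real"
    using that by (intro borel_measurable_sum measurable_compose[OF H_borel_measurable[OF XH] that]) auto
  have cm: "(\<lambda>z. trunc L (d * z)) \<in> borel_measurable borel" for d unfolding trunc_def by measurable
  have P: "P \<in> sets M" and N: "N \<in> sets M"
    unfolding P_def N_def using Sm[OF cm] by measurable
  have sub: "{\<omega> \<in> space M. \<exists>k\<in>{1..n}. \<bar>\<Sum>i=1..k. c i * X i \<omega>\<bar> > y} \<subseteq> A \<union> (P \<union> N)"
  proof (intro subsetI)
    fix \<omega> assume "\<omega> \<in> {\<omega> \<in> space M. \<exists>k\<in>{1..n}. \<bar>\<Sum>i=1..k. c i * X i \<omega>\<bar> > y}"
    then obtain k where k: "\<omega> \<in> space M" "k \<in> {1..n}" "\<bar>\<Sum>i=1..k. c i * X i \<omega>\<bar> > y" by auto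
    show "\<omega> \<in> A \<union> (P \<union> N)"
    proof (cases "\<omega> \<in> A")
      case False
      then have "\<bar>c i * X i \<omega>\<bar> \<le> L" if "i \<in> {1..n}" for i
        using that k(1) by (auto simp: A_def not_less)
      then have "trunc L (c i * X i \<omega>) = c i * X i \<omega>" "trunc L ((- c i) * X i \<omega>) = - (c i * X i \<omega>)"
        if "i \<in> {1..k}" for i
        using that k(2) by (auto intro!: trunc_eq)
      then have "(\<Sum>i=1..k. trunc L (c i * X i \<omega>)) = (\<Sum>i=1..k. c i * X i \<omega>)"
        "(\<Sum>i=1..k. trunc L ((- c i) * X i \<omega>)) = - (\<Sum>i=1..k. c i * X i \<omega>)"
        by (auto simp: sum_negf[symmetric] intro!: sum.cong)
      moreover have "y < (\<Sum>i=1..k. c i * X i \<omega>) \<or> y < - (\<Sum>i=1..k. c i * X i \<omega>)"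
        using k(3) by linarith
      ultimately have "y < (\<Sum>i=1..k. trunc L (c i * X i \<omega>)) \<or> y < (\<Sum>i=1..k. trunc L ((- c i) * X i \<omega>))"
        by simp
      then have "\<omega> \<in> P \<or> \<omega> \<in> N" using k(1,2) unfolding P_def N_def by blast
      then show ?thesis by auto
    qed auto
  qed
  have SS: "{\<omega> \<in> space M. \<exists>k\<in>{1..n}. \<bar>\<Sum>i=1..k. c i * X i \<omega>\<bar> > y} \<in> sets M"
    using Sm[of "\<lambda>i z. c i * z"] by measurable
  have "cap {\<omega> \<in> space M. \<exists>k\<in>{1..n}. \<bar>\<Sum>i=1..k. c i * X i \<omega>\<bar> > y} \<le> cap (A \<union> (P \<union> N))"
    using sub A P N SS by (intro cap_mono) auto
  also have "\<dots> \<le> cap A + cap (P \<union> N)" using A P N by (intro cap_Un) auto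
  also have "cap (P \<union> N) \<le> cap P + cap N" using P N by (intro cap_Un)
  also have "cap A \<le> (\<Sum>i=1..n. cap {\<omega> \<in> space M. \<bar>c i * X i \<omega>\<bar> > L})"
    unfolding A_def using sA by (intro cap_UN) auto
  also have "cap P \<le> exp 3 * B powr (y / L / 2)"
    unfolding P_def by (rule truncated_sum_tail_le[OF ca XH ind L \<theta> centred \<mu> B])
  also have "cap N \<le> exp 3 * B powr (y / L / 2)"
    unfolding N_def by (rule truncated_sum_tail_le[OF ca XH ind L \<theta> centred \<mu>, where c="\<lambda>i. - c i"]) (use B in auto)
  finally show ?thesis by simp
qed

section \<open>Choquet integrals as tail integrals\<close>

text \<open>
  Below the level $-b$ the event is the whole space, of capacity $1$, so the integrand of the
  second part vanishes there and is at most $1$ elsewhere.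
\<close>
lemma choquet_lower_part_le:
  assumes S: "\<And>u. {\<omega> \<in> space M. f \<omega> > u} \<in> sets M"
    and low: "\<And>\<omega>. \<omega> \<in> space M \<Longrightarrow> - b \<le> f \<omega>" and b: "b \<ge> 0"
  shows "(\<integral>\<^sup>+x\<in>{..0}. e2ennreal (1 - capacity \<E> {\<omega> \<in> space M. f \<omega> > x}) \<partial>lborel) \<le> ennreal b"
proof -
  have "(\<integral>\<^sup>+x\<in>{..0}. e2ennreal (1 - capacity \<E> {\<omega> \<in> space M. f \<omega> > x}) \<partial>lborel)
      \<le> (\<integral>\<^sup>+x. indicator {-b..0} x \<partial>lborel)"
  proof (intro nn_integral_mono)
    fix x :: real
    have eq: "e2ennreal (1 - capacity \<E> {\<omega> \<in> space M. f \<omega> > x}) = ennreal (1 - cap {\<omega> \<in> space M. f \<omega> > x})"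
      unfolding capacity_eq_cap[OF S] one_ereal_def by (simp add: e2ennreal_ereal)
    show "e2ennreal (1 - capacity \<E> {\<omega> \<in> space M. f \<omega> > x}) * indicator {..0} x \<le> (indicator {-b..0} x :: ennreal)"
    proof (cases "x < - b")
      case True
      then have "{\<omega> \<in> space M. f \<omega> > x} = space M" using low by force
      then have "1 - cap {\<omega> \<in> space M. f \<omega> > x} = 0" by (simp add: cap_space)
      then show ?thesis unfolding eq by simp
    next
      case False
      have "ennreal (1 - cap {\<omega> \<in> space M. f \<omega> > x}) \<le> ennreal 1"
        using cap_nonneg[OF S, of x] by (intro ennreal_leI) simp
      then show ?thesis unfolding eq using False by (auto simp: indicator_def)
    qed
  qed
  also have "\<dots> = ennreal b" using b by simp
  finally show ?thesis .
qed

lemma choquet_upper_part: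
  assumes S: "\<And>u. {\<omega> \<in> space M. f \<omega> > u} \<in> sets M"
  shows "(\<integral>\<^sup>+x\<in>{0..}. e2ennreal (capacity \<E> {\<omega> \<in> space M. f \<omega> > x}) \<partial>lborel)
    = (\<integral>\<^sup>+x\<in>{0..}. ennreal (cap {\<omega> \<in> space M. f \<omega> > x}) \<partial>lborel)"
  unfolding capacity_eq_cap[OF S] by (simp add: e2ennreal_ereal)

lemma choquet_nonneg:
  assumes S: "\<And>u. {\<omega> \<in> space M. f \<omega> > u} \<in> sets M" and f: "\<And>\<omega>. \<omega> \<in> space M \<Longrightarrow> 0 \<le> f \<omega>"
  shows "choquet M \<E> f = enn2ereal (\<integral>\<^sup>+x\<in>{0..}. ennreal (cap {\<omega> \<in> space M. f \<omega> > x}) \<partial>lborel)"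
proof -
  have "(\<integral>\<^sup>+x\<in>{..0}. e2ennreal (1 - capacity \<E> {\<omega> \<in> space M. f \<omega> > x}) \<partial>lborel) \<le> ennreal 0"
    by (rule choquet_lower_part_le[OF S]) (use f in auto)
  then have "(\<integral>\<^sup>+x\<in>{..0}. e2ennreal (1 - capacity \<E> {\<omega> \<in> space M. f \<omega> > x}) \<partial>lborel) = 0" by simp
  then show ?thesis unfolding choquet_def choquet_upper_part[OF S] by (simp add: zero_ennreal.rep_eq)
qed

lemma choquet_finite_iff:
  assumes S: "\<And>u. {\<omega> \<in> space M. f \<omega> > u} \<in> sets M"
    and low: "\<And>\<omega>. \<omega> \<in> space M \<Longrightarrow> - b \<le> f \<omega>" and b: "b \<ge> 0"
  shows "choquet M \<E> f < \<infinity> \<longleftrightarrow> (\<integral>\<^sup>+x\<in>{0..}. ennreal (cap {\<omega> \<in> space M. f \<omega> > x}) \<partial>lborel) < \<infinity>"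
proof -
  define A where "A = (\<integral>\<^sup>+x\<in>{0..}. ennreal (cap {\<omega> \<in> space M. f \<omega> > x}) \<partial>lborel)"
  define B where "B = (\<integral>\<^sup>+x\<in>{..0}. e2ennreal (1 - capacity \<E> {\<omega> \<in> space M. f \<omega> > x}) \<partial>lborel)"
  have "B \<le> ennreal b" unfolding B_def by (rule choquet_lower_part_le[OF S low b])
  then have "B < \<infinity>" by (simp add: order.strict_trans1)
  then obtain b' where b': "B = ennreal b'" "b' \<ge> 0" by (cases B) auto
  have "choquet M \<E> f = enn2ereal A - enn2ereal B"
    unfolding choquet_def choquet_upper_part[OF S] A_def B_def ..
  also have "\<dots> < \<infinity> \<longleftrightarrow> A < \<infinity>"
    using b' by (cases A) (auto simp: enn2ereal_ennreal)
  finally show ?thesis by (simp add: A_def)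
qed

lemma moment_integral_finite_iff:
  assumes X: "X \<in> H" and \<theta>: "\<theta> > 0"
  shows "abs_moment X \<theta> < \<infinity> \<longleftrightarrow> (\<integral>\<^sup>+t\<in>{1..}. ennreal (tail X t * t powr (\<theta> - 1)) \<partial>lborel) < \<infinity>"
proof -
  have [measurable]: "tail X \<in> borel_measurable borel" by (rule tail_measurable[OF X])
  define F where "F x = tail X (x powr (1 / \<theta>))" for x
  have Fm [measurable]: "F \<in> borel_measurable borel" unfolding F_def by measurable
  have "(\<integral>\<^sup>+x\<in>{(1::real) powr \<theta>..}. ennreal (F x) \<partial>lborel)
      = (\<integral>\<^sup>+t\<in>{1..}. ennreal (F (t powr \<theta>) * (\<theta> * t powr (\<theta> - 1))) \<partial>lborel)"
  proof (rule nn_integral_substitution_at_top[OF Fm])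
    show "((\<lambda>t. t powr \<theta>) has_real_derivative \<theta> * t powr (\<theta> - 1)) (at t)" if "t \<ge> 1" for t
      using that by (auto intro!: derivative_eq_intros)
    show "continuous_on {1..} (\<lambda>t. \<theta> * t powr (\<theta> - 1))" by (intro continuous_intros) auto
    show "\<theta> * t powr (\<theta> - 1) \<ge> 0" if "t \<ge> 1" for t using \<theta> by simp
    show "filterlim (\<lambda>t. t powr \<theta>) at_top at_top" by (rule filterlim_powr_at_top[OF \<theta>])
  qed
  also have "\<dots> = (\<integral>\<^sup>+t. ennreal \<theta> * (ennreal (tail X t * t powr (\<theta> - 1)) * indicator {1..} t) \<partial>lborel)"
    using \<theta> tail_bounds(1)[OF X]
    by (intro nn_integral_cong)
      (auto simp: F_def powr_powr indicator_def ennreal_mult[symmetric] mult_ac)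
  also have "\<dots> = ennreal \<theta> * (\<integral>\<^sup>+t\<in>{1..}. ennreal (tail X t * t powr (\<theta> - 1)) \<partial>lborel)"
    by (rule nn_integral_cmult) measurable
  finally have eq: "(\<integral>\<^sup>+x\<in>{1..}. ennreal (F x) \<partial>lborel)
      = ennreal \<theta> * (\<integral>\<^sup>+t\<in>{1..}. ennreal (tail X t * t powr (\<theta> - 1)) \<partial>lborel)" by simp
  have "abs_moment X \<theta> < \<infinity> \<longleftrightarrow> (\<integral>\<^sup>+x\<in>{1..}. ennreal (F x) \<partial>lborel) < \<infinity>"
  proof
    assume "abs_moment X \<theta> < \<infinity>"
    moreover have "(\<integral>\<^sup>+x\<in>{1..}. ennreal (F x) \<partial>lborel) \<le> abs_moment X \<theta>"
      unfolding abs_moment_def F_def by (intro nn_integral_mono) (auto simp: indicator_def)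
    ultimately show "(\<integral>\<^sup>+x\<in>{1..}. ennreal (F x) \<partial>lborel) < \<infinity>" by (rule order.strict_trans1[rotated])
  next
    assume fin: "(\<integral>\<^sup>+x\<in>{1..}. ennreal (F x) \<partial>lborel) < \<infinity>"
    have "abs_moment X \<theta> \<le> (\<integral>\<^sup>+x\<in>{0..1}. ennreal (F x) \<partial>lborel) + (\<integral>\<^sup>+x\<in>{1..}. ennreal (F x) \<partial>lborel)"
      unfolding abs_moment_def F_def[symmetric] by (intro nn_integral_split_at Fm) simp
    also have "(\<integral>\<^sup>+x\<in>{0..1}. ennreal (F x) \<partial>lborel) \<le> ennreal (1 * (1 - 0))"
      using tail_bounds(2)[OF X] by (intro nn_integral_interval_le) (auto simp: F_def)
    finally show "abs_moment X \<theta> < \<infinity>" using fin by (auto simp: order.strict_trans1)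
  qed
  also have "\<dots> \<longleftrightarrow> (\<integral>\<^sup>+t\<in>{1..}. ennreal (tail X t * t powr (\<theta> - 1)) \<partial>lborel) < \<infinity>"
    unfolding eq using \<theta> by (auto simp: ennreal_mult_less_top)
  finally show ?thesis .
qed

lemma sets_abs_powr_greater: "X \<in> H \<Longrightarrow> {\<omega> \<in> space M. \<bar>X \<omega>\<bar> powr \<theta> > u} \<in> sets M"
  using H_borel_measurable by measurable

lemma choquet_powr_finite_iff:
  assumes X: "X \<in> H" and \<theta>: "\<theta> > 0"
  shows "choquet M \<E> (\<lambda>\<omega>. \<bar>X \<omega>\<bar> powr \<theta>) < \<infinity>
    \<longleftrightarrow> (\<integral>\<^sup>+t\<in>{1..}. ennreal (tail X t * t powr (\<theta> - 1)) \<partial>lborel) < \<infinity>"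
proof -
  have "choquet M \<E> (\<lambda>\<omega>. \<bar>X \<omega>\<bar> powr \<theta>) < \<infinity>
    \<longleftrightarrow> (\<integral>\<^sup>+x\<in>{0..}. ennreal (cap {\<omega> \<in> space M. \<bar>X \<omega>\<bar> powr \<theta> > x}) \<partial>lborel) < \<infinity>"
    by (rule choquet_finite_iff[OF sets_abs_powr_greater[OF X], of 0]) auto
  also have "(\<integral>\<^sup>+x\<in>{0..}. ennreal (cap {\<omega> \<in> space M. \<bar>X \<omega>\<bar> powr \<theta> > x}) \<partial>lborel) = abs_moment X \<theta>"
    unfolding abs_moment_def tail_def
    by (intro nn_integral_cong) (auto simp: indicator_def abs_powr_greater_iff[OF \<theta>])
  finally show ?thesis unfolding moment_integral_finite_iff[OF X \<theta>] .
qed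

text \<open>
  The function $u^s \ln u$ is bounded below by $-1/s$, is nonpositive on $[0,1]$ and increases
  from $0$ on $[1,\infty)$. Hence for levels $f(t)$ with $t \ge 1$ the level sets are those of
  $|X|$, and the substitution $x = f(t)$ produces the density $t^{s-1}(s \ln t + 1)$.
\<close>
lemma choquet_powr_ln_finite_iff:
  assumes X: "X \<in> H" and s: "s > 0"
  shows "choquet M \<E> (\<lambda>\<omega>. \<bar>X \<omega>\<bar> powr s * ln \<bar>X \<omega>\<bar>) < \<infinity>
    \<longleftrightarrow> (\<integral>\<^sup>+t\<in>{1..}. ennreal (tail X t * (t powr (s - 1) * (1 + ln t))) \<partial>lborel) < \<infinity>"
proof -
  define f where "f u = u powr s * ln u" for u :: real
  have [measurable]: "tail X \<in> borel_measurable borel" by (rule tail_measurable[OF X])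
  have [measurable]: "X \<in> borel_measurable M" by (rule H_borel_measurable[OF X])
  have S: "{\<omega> \<in> space M. f \<bar>X \<omega>\<bar> > u} \<in> sets M" for u unfolding f_def by measurable
  have low: "- (1 / s) \<le> f \<bar>z\<bar>" for z
  proof (cases "z = 0")
    case True
    then show ?thesis using s by (simp add: f_def)
  next
    case False
    define t where "t = \<bar>z\<bar> powr s"
    have t: "t > 0" using False by (simp add: t_def)
    have "ln (1 / t) \<le> 1 / t - 1" using t by (intro ln_le_minus_one) auto
    then have "- 1 \<le> t * ln t" using t by (simp add: ln_div field_simps)
    also have "t * ln t = s * f \<bar>z\<bar>" using False by (simp add: t_def f_def ln_powr)
    finally show ?thesis using s by (simp add: field_simps)
  qed
  have f1: "f t < f u" if "1 \<le> t" "t < u" for t u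
  proof -
    have "t powr s < u powr s" "ln t < ln u" "ln t \<ge> 0" "t powr s > 0"
      using that s by (auto intro: powr_less_mono2)
    then show ?thesis unfolding f_def by (intro mult_strict_mono) auto
  qed
  have f2: "f u \<le> f t" if "0 \<le> u" "u \<le> t" "1 \<le> t" for t u
  proof (cases "u \<le> 1")
    case True
    then have "ln u \<le> 0" using that by (cases "u = 0") auto
    then have "f u \<le> 0" by (simp add: f_def mult_nonneg_nonpos)
    also have "0 \<le> f t" using that by (simp add: f_def)
    finally show ?thesis .
  next
    case False
    then show ?thesis using f1[of u t] that by (cases "u = t") auto
  qed
  have fiff: "f \<bar>z\<bar> > f t \<longleftrightarrow> \<bar>z\<bar> > t" if "t \<ge> 1" for z t
    using f1[OF that, of "\<bar>z\<bar>"] f2[of "\<bar>z\<bar>" t] that by (meson abs_ge_zero linorder_not_less)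
  define F where "F x = cap {\<omega> \<in> space M. f \<bar>X \<omega>\<bar> > x}" for x
  have Fm: "F \<in> borel_measurable borel"
    unfolding F_def using S by (intro antimono_borel_measurable antimonoI cap_mono) auto
  define g' where "g' t = t powr (s - 1) * (s * ln t + 1)" for t
  have "(\<integral>\<^sup>+x\<in>{f 1..}. ennreal (F x) \<partial>lborel) = (\<integral>\<^sup>+t\<in>{1..}. ennreal (F (f t) * g' t) \<partial>lborel)"
  proof (rule nn_integral_substitution_at_top[OF Fm])
    show "(f has_real_derivative g' t) (at t)" if "t \<ge> 1" for t
    proof -
      have "(f has_real_derivative (s * t powr (s - 1)) * ln t + t powr s * (1 / t)) (at t)"
        unfolding f_def using that by (auto intro!: derivative_eq_intros)
      also have "(s * t powr (s - 1)) * ln t + t powr s * (1 / t) = g' t"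
        using that by (simp add: g'_def powr_diff field_simps)
      finally show ?thesis .
    qed
    show "continuous_on {1..} g'" unfolding g'_def by (intro continuous_intros) auto
    show "g' t \<ge> 0" if "t \<ge> 1" for t using that s by (simp add: g'_def)
    show "filterlim f at_top at_top" unfolding f_def
      by (intro filterlim_at_top_mult_at_top filterlim_powr_at_top s ln_at_top)
  qed
  also have "f 1 = 0" by (simp add: f_def)
  also have "(\<integral>\<^sup>+t\<in>{1..}. ennreal (F (f t) * g' t) \<partial>lborel) = (\<integral>\<^sup>+t\<in>{1..}. ennreal (tail X t * g' t) \<partial>lborel)"
    by (intro nn_integral_cong) (auto simp: indicator_def F_def tail_def fiff)
  finally have eq: "(\<integral>\<^sup>+x\<in>{0..}. ennreal (F x) \<partial>lborel) = \<dots>" .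
  have "choquet M \<E> (\<lambda>\<omega>. f \<bar>X \<omega>\<bar>) < \<infinity> \<longleftrightarrow> (\<integral>\<^sup>+t\<in>{1..}. ennreal (tail X t * g' t) \<partial>lborel) < \<infinity>"
    unfolding choquet_finite_iff[OF S low divide_nonneg_nonneg[OF zero_le_one less_imp_le[OF s]]] F_def[symmetric] eq ..
  also have "\<dots> \<longleftrightarrow> (\<integral>\<^sup>+t\<in>{1..}. ennreal (tail X t * (t powr (s - 1) * (1 + ln t))) \<partial>lborel) < \<infinity>"
  proof
    assume fin: "(\<integral>\<^sup>+t\<in>{1..}. ennreal (tail X t * g' t) \<partial>lborel) < \<infinity>"
    show "(\<integral>\<^sup>+t\<in>{1..}. ennreal (tail X t * (t powr (s - 1) * (1 + ln t))) \<partial>lborel) < \<infinity>"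
    proof (rule nn_integral_finite_mono[OF fin, where C="1 + 1/s"])
      fix t :: real assume t: "t \<in> {1..}"
      have "1 + ln t \<le> (1 + 1/s) * (s * ln t + 1)" using t s by (simp add: field_simps)
      then have "(tail X t * t powr (s - 1)) * (1 + ln t) \<le> (tail X t * t powr (s - 1)) * ((1 + 1/s) * (s * ln t + 1))"
        using tail_bounds[OF X] by (intro mult_left_mono) auto
      then show "tail X t * (t powr (s - 1) * (1 + ln t)) \<le> (1 + 1/s) * (tail X t * g' t)"
        by (simp add: g'_def mult_ac)
      show "tail X t * g' t \<ge> 0" using t s tail_bounds[OF X] by (simp add: g'_def)
    qed (use s in \<open>auto simp: g'_def\<close>)
  next
    assume fin: "(\<integral>\<^sup>+t\<in>{1..}. ennreal (tail X t * (t powr (s - 1) * (1 + ln t))) \<partial>lborel) < \<infinity>"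
    show "(\<integral>\<^sup>+t\<in>{1..}. ennreal (tail X t * g' t) \<partial>lborel) < \<infinity>"
    proof (rule nn_integral_finite_mono[OF fin, where C="1 + s"])
      fix t :: real assume t: "t \<in> {1..}"
      have "s * ln t + 1 \<le> (1 + s) * (1 + ln t)" using t s by (simp add: field_simps)
      then have "(tail X t * t powr (s - 1)) * (s * ln t + 1) \<le> (tail X t * t powr (s - 1)) * ((1 + s) * (1 + ln t))"
        using tail_bounds[OF X] by (intro mult_left_mono) auto
      then show "tail X t * g' t \<le> (1 + s) * (tail X t * (t powr (s - 1) * (1 + ln t)))"
        by (simp add: g'_def mult_ac)
      show "tail X t * (t powr (s - 1) * (1 + ln t)) \<ge> 0" using t s tail_bounds[OF X] by simp
    qed (use s in auto)
  qed
  finally show ?thesis by (simp add: f_def)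
qed

text \<open>
  The scale $\kappa$ collects the constants that arise when levels of sums are compared with
  levels of single variables; finiteness does not depend on it.
\<close>
definition tail_integral :: "('a \<Rightarrow> real) \<Rightarrow> real \<Rightarrow> real \<Rightarrow> real \<Rightarrow> ennreal" where
  "tail_integral X s p \<kappa>
    = (\<integral>\<^sup>+t\<in>{1..}. ennreal (tail X (\<kappa> * t) * (t powr (p - 1) * moment_weight s p t)) \<partial>lborel)"

text \<open>
  In each regime $t^{p-1}\Lambda(t)$ is, up to a constant factor, the density that the change of
  variables in the Choquet integral produces.
\<close>
proposition moment_condition_iff_tail_integral:
  assumes X: "X \<in> H" and "p > 0" "s > 0"
  shows "((p > s \<longrightarrow> choquet M \<E> (\<lambda>\<omega>. \<bar>X \<omega>\<bar> powr p) < \<infinity>) \<and>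
      (p = s \<longrightarrow> choquet M \<E> (\<lambda>\<omega>. \<bar>X \<omega>\<bar> powr s * ln \<bar>X \<omega>\<bar>) < \<infinity>) \<and>
      (p < s \<longrightarrow> choquet M \<E> (\<lambda>\<omega>. \<bar>X \<omega>\<bar> powr s) < \<infinity>))
    \<longleftrightarrow> tail_integral X s p 1 < \<infinity>"
proof -
  consider "p < s" | "p = s" | "p > s" by linarith
  then show ?thesis
  proof cases
    case 1
    have "tail_integral X s p 1 = (\<integral>\<^sup>+t\<in>{1..}. ennreal (tail X t * t powr (s - 1)) \<partial>lborel)"
      unfolding tail_integral_def using 1
      by (intro nn_integral_cong) (auto simp: moment_weight_def powr_add[symmetric])
    then show ?thesis using 1 choquet_powr_finite_iff[OF X assms(3)] by simp
  next
    case 2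
    then show ?thesis using choquet_powr_ln_finite_iff[OF X assms(3)]
      by (simp add: tail_integral_def moment_weight_def)
  next
    case 3
    then show ?thesis using choquet_powr_finite_iff[OF X assms(2)]
      by (simp add: tail_integral_def moment_weight_def)
  qed
qed

text \<open>
  Enlarging $\kappa$ decreases the tail. For a smaller $\kappa$ substitute $t \mapsto ct$: the
  weight changes only by a constant factor, and the part near the lower limit is finite because
  tails are at most $1$.
\<close>
lemma tail_integral_scale:
  assumes X: "X \<in> H" and "\<kappa>1 > 0" "\<kappa>2 > 0" and fin: "tail_integral X s p \<kappa>1 < \<infinity>"
  shows "tail_integral X s p \<kappa>2 < \<infinity>"
proof (cases "\<kappa>1 \<le> \<kappa>2")
  case True
  have "tail_integral X s p \<kappa>2 \<le> tail_integral X s p \<kappa>1"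
    unfolding tail_integral_def
    using antimonoD[OF tail_antimono[OF X]] True
    by (intro nn_integral_mono)
      (auto simp: indicator_def intro!: ennreal_leI mult_right_mono mult_nonneg_nonneg moment_weight_nonneg)
  with fin show ?thesis by (rule order.strict_trans1[rotated])
next
  case False
  have [measurable]: "tail X \<in> borel_measurable borel" by (rule tail_measurable[OF X])
  define c where "c = \<kappa>1 / \<kappa>2"
  have c: "c > 1" using False assms by (simp add: c_def)
  define W where "W t = t powr (p - 1) * moment_weight s p t" for t
  have Wm [measurable]: "W \<in> borel_measurable borel" unfolding W_def by measurable
  have W0: "W t \<ge> 0" if "t \<ge> 1" for t using moment_weight_nonneg[OF that] by (simp add: W_def)
  obtain C where C: "C > 0" "\<And>t. t \<ge> 1 \<Longrightarrow> c * t \<ge> 1 \<Longrightarrow> moment_weight s p (c * t) \<le> C * moment_weight s p t"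
    using moment_weight_scale[of c s p] c by auto
  have ct: "c * t \<ge> 1" if "t \<ge> 1" for t using mult_mono[of 1 c 1 t] c that by simp
  define f where "f t = tail X (\<kappa>2 * t) * W t" for t
  have fm [measurable]: "f \<in> borel_measurable borel" unfolding f_def by measurable
  have "tail_integral X s p \<kappa>2 = (\<integral>\<^sup>+t\<in>{1..}. ennreal (f t) \<partial>lborel)"
    by (simp add: tail_integral_def f_def W_def)
  also have "\<dots> \<le> (\<integral>\<^sup>+t\<in>{1..c}. ennreal (f t) \<partial>lborel) + (\<integral>\<^sup>+t\<in>{c..}. ennreal (f t) \<partial>lborel)"
    using c by (intro nn_integral_split_at) auto
  also have "(\<integral>\<^sup>+t\<in>{1..c}. ennreal (f t) \<partial>lborel) \<le> ennreal ((c powr \<bar>p - 1\<bar> * moment_weight s p c) * (c - 1))"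
  proof (rule nn_integral_interval_le)
    fix t assume t: "t \<in> {1..c}"
    have "W t \<le> c powr \<bar>p - 1\<bar> * moment_weight s p c"
      unfolding W_def using t by (intro powr_moment_weight_le) auto
    moreover have "f t \<le> 1 * W t"
      unfolding f_def using tail_bounds(2)[OF X] W0 t by (intro mult_right_mono) auto
    ultimately show "f t \<le> c powr \<bar>p - 1\<bar> * moment_weight s p c" by simp
  qed (use c moment_weight_nonneg[of c] in auto)
  also have "(\<integral>\<^sup>+t\<in>{c..}. ennreal (f t) \<partial>lborel)
      = ennreal \<bar>c\<bar> * (\<integral>\<^sup>+t. ennreal (f (0 + c * t)) * indicator {c..} (0 + c * t) \<partial>lborel)"
    using c by (intro nn_integral_real_affine) auto
  also have "(\<integral>\<^sup>+t. ennreal (f (0 + c * t)) * indicator {c..} (0 + c * t) \<partial>lborel)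
      = (\<integral>\<^sup>+t\<in>{1..}. ennreal (f (c * t)) \<partial>lborel)"
    using c by (intro nn_integral_cong) (auto simp: indicator_def)
  finally have le: "tail_integral X s p \<kappa>2 \<le> ennreal ((c powr \<bar>p - 1\<bar> * moment_weight s p c) * (c - 1))
      + ennreal \<bar>c\<bar> * (\<integral>\<^sup>+t\<in>{1..}. ennreal (f (c * t)) \<partial>lborel)"
    by (auto intro: add_right_mono)
  have "(\<integral>\<^sup>+t\<in>{1..}. ennreal (f (c * t)) \<partial>lborel) < \<infinity>"
  proof (rule nn_integral_finite_mono[where C="c powr (p - 1) * C" and g="\<lambda>t. tail X (\<kappa>1 * t) * W t"])
    show "(\<integral>\<^sup>+t\<in>{1..}. ennreal (tail X (\<kappa>1 * t) * W t) \<partial>lborel) < \<infinity>"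
      using fin by (simp add: tail_integral_def W_def)
    fix t :: real assume t: "t \<in> {1..}"
    have "W (c * t) \<le> c powr (p - 1) * t powr (p - 1) * (C * moment_weight s p t)"
      unfolding W_def powr_mult using t C(2)[of t] ct by (intro mult_left_mono) auto
    then have "tail X (\<kappa>1 * t) * W (c * t) \<le> tail X (\<kappa>1 * t) * (c powr (p - 1) * C * W t)"
      using tail_bounds[OF X] by (intro mult_left_mono) (auto simp: W_def mult_ac)
    moreover have e: "\<kappa>2 * (c * t) = \<kappa>1 * t" using assms by (simp add: c_def)
    ultimately show "f (c * t) \<le> c powr (p - 1) * C * (tail X (\<kappa>1 * t) * W t)"
      unfolding f_def e by (simp only: mult_ac)
    show "tail X (\<kappa>1 * t) * W t \<ge> 0" using tail_bounds[OF X] W0 t by auto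
  qed (use C in auto)
  then have "ennreal ((c powr \<bar>p - 1\<bar> * moment_weight s p c) * (c - 1))
      + ennreal \<bar>c\<bar> * (\<integral>\<^sup>+t\<in>{1..}. ennreal (f (c * t)) \<partial>lborel) < \<infinity>"
    by (simp add: ennreal_mult_less_top)
  with le show ?thesis by (rule order.strict_trans1)
qed

lemma abs_moment_finite:
  assumes X: "X \<in> H" and fin: "tail_integral X s p \<kappa> < \<infinity>" "\<kappa> > 0" and \<theta>: "\<theta> > 0" "\<theta> \<le> p \<or> \<theta> \<le> s"
  shows "abs_moment X \<theta> < \<infinity>"
  unfolding moment_integral_finite_iff[OF X \<theta>(1)]
proof (rule nn_integral_finite_mono[where C=1 and g="\<lambda>t. tail X t * (t powr (p - 1) * moment_weight s p t)"])
  have [measurable]: "tail X \<in> borel_measurable borel" by (rule tail_measurable[OF X])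
  show "(\<integral>\<^sup>+t\<in>{1..}. ennreal (tail X t * (t powr (p - 1) * moment_weight s p t)) \<partial>lborel) < \<infinity>"
    using tail_integral_scale[OF X fin(2) zero_less_one fin(1)] by (simp add: tail_integral_def)
  show "(\<lambda>t. tail X t * (t powr (p - 1) * moment_weight s p t)) \<in> borel_measurable borel" by measurable
  fix t :: real assume t: "t \<in> {1..}"
  show "tail X t * t powr (\<theta> - 1) \<le> 1 * (tail X t * (t powr (p - 1) * moment_weight s p t))"
    using powr_le_moment_weight[of t \<theta> p s] t \<theta> tail_bounds[OF X] by (auto intro!: mult_left_mono)
  show "0 \<le> tail X t * (t powr (p - 1) * moment_weight s p t)"
    using tail_bounds[OF X] moment_weight_nonneg[of t] t by auto
qed auto

section \<open>From the moment condition to the series\<close>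

definition max_exceeds :: "(nat \<Rightarrow> nat \<Rightarrow> real) \<Rightarrow> (nat \<Rightarrow> 'a \<Rightarrow> real) \<Rightarrow> nat \<Rightarrow> real \<Rightarrow> 'a set" where
  "max_exceeds a X n y = {\<omega> \<in> space M. \<exists>k\<in>{1..n}. \<bar>\<Sum>i=1..k. a n i * X i \<omega>\<bar> > y}"

text \<open>
  The Choquet integral in (ii), with the maximum expressed by its level sets (see
  \<open>choquet_excess_eq\<close>).
\<close>
definition excess_integral ::
  "(nat \<Rightarrow> nat \<Rightarrow> real) \<Rightarrow> (nat \<Rightarrow> 'a \<Rightarrow> real) \<Rightarrow> real \<Rightarrow> real \<Rightarrow> nat \<Rightarrow> ennreal" where
  "excess_integral a X p \<epsilon> n
    = (\<integral>\<^sup>+x\<in>{0..}. ennreal (cap (max_exceeds a X n ((x + \<epsilon>) powr (1 / p)))) \<partial>lborel)"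

lemma sets_max_exceeds:
  assumes XH: "\<And>i. i \<ge> 1 \<Longrightarrow> X i \<in> H"
  shows "max_exceeds a X n y \<in> sets M"
proof -
  have "(\<lambda>\<omega>. \<Sum>i=1..k. a n i * X i \<omega>) \<in> borel_measurable M" for k
    using H_borel_measurable[OF XH] by (intro borel_measurable_sum borel_measurable_times) auto
  then show ?thesis unfolding max_exceeds_def by measurable
qed

lemma choquet_excess_eq:
  assumes XH: "\<And>i. i \<ge> 1 \<Longrightarrow> X i \<in> H" and n: "n \<ge> 1" and p: "p > 0" and \<epsilon>: "\<epsilon> > 0"
  shows "choquet M \<E> (\<lambda>\<omega>. max 0 (Max ((\<lambda>k. \<bar>\<Sum>i=1..k. a n i * X i \<omega>\<bar> powr p) ` {1..n}) - \<epsilon>))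
    = enn2ereal (excess_integral a X p \<epsilon> n)"
proof -
  define f where "f \<omega> = max 0 (Max ((\<lambda>k. \<bar>\<Sum>i=1..k. a n i * X i \<omega>\<bar> powr p) ` {1..n}) - \<epsilon>)" for \<omega>
  have ne: "(\<lambda>k. \<bar>\<Sum>i=1..k. a n i * X i \<omega>\<bar> powr p) ` {1..n} \<noteq> {}" for \<omega> using n by auto
  have lev: "{\<omega> \<in> space M. f \<omega> > x} = max_exceeds a X n ((x + \<epsilon>) powr (1 / p))" if x: "x \<ge> 0" for x
  proof -
    have "f \<omega> > x \<longleftrightarrow> (\<exists>k\<in>{1..n}. \<bar>\<Sum>i=1..k. a n i * X i \<omega>\<bar> > (x + \<epsilon>) powr (1 / p))" for \<omega>
    proof -
      have "f \<omega> > x \<longleftrightarrow> Max ((\<lambda>k. \<bar>\<Sum>i=1..k. a n i * X i \<omega>\<bar> powr p) ` {1..n}) > x + \<epsilon>"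
        using x by (auto simp: f_def)
      also have "\<dots> \<longleftrightarrow> (\<exists>k\<in>{1..n}. \<bar>\<Sum>i=1..k. a n i * X i \<omega>\<bar> powr p > x + \<epsilon>)"
        using ne by (subst Max_gr_iff) auto
      also have "\<dots> \<longleftrightarrow> (\<exists>k\<in>{1..n}. \<bar>\<Sum>i=1..k. a n i * X i \<omega>\<bar> > (x + \<epsilon>) powr (1 / p))"
        using x \<epsilon> p by (simp add: abs_powr_greater_iff)
      finally show ?thesis .
    qed
    then show ?thesis by (simp add: max_exceeds_def)
  qed
  have S: "{\<omega> \<in> space M. f \<omega> > x} \<in> sets M" for x
  proof (cases "x \<ge> 0")
    case True
    then show ?thesis using lev sets_max_exceeds[OF XH] by simp
  next
    case False
    then have "{\<omega> \<in> space M. f \<omega> > x} = space M" by (auto simp: f_def)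
    then show ?thesis by simp
  qed
  have "choquet M \<E> f = enn2ereal (\<integral>\<^sup>+x\<in>{0..}. ennreal (cap {\<omega> \<in> space M. f \<omega> > x}) \<partial>lborel)"
    by (rule choquet_nonneg[OF S]) (simp add: f_def)
  also have "(\<integral>\<^sup>+x\<in>{0..}. ennreal (cap {\<omega> \<in> space M. f \<omega> > x}) \<partial>lborel) = excess_integral a X p \<epsilon> n"
    unfolding excess_integral_def by (intro nn_integral_cong) (auto simp: indicator_def lev)
  finally show ?thesis by (simp add: f_def)
qed

text \<open>
  The contribution of one summand with coefficient $b$, after the substitution of
  \<open>weighted_tail_eq\<close> has moved $b$ from the argument of the tail into the weight.
\<close>
definition weighted_tail :: "('a \<Rightarrow> real) \<Rightarrow> real \<Rightarrow> real \<Rightarrow> real \<Rightarrow> ennreal" where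
  "weighted_tail X p \<kappa> b
    = (\<integral>\<^sup>+t\<in>{1..}. ennreal (tail X (\<kappa> * t) * (t powr (p - 1) * (if 1 / t \<le> b then b powr p else 0))) \<partial>lborel)"

text \<open>
  The substitution is $x = \epsilon((bt)^p - 1)$, which makes $(x + \epsilon)^{1/p} =
  \epsilon^{1/p}bt$ and sends $t = 1/b$ to the lower limit $x = 0$.
\<close>
lemma weighted_tail_eq:
  assumes X: "X \<in> H" and b: "0 < b" "b \<le> 1" and "p > 0" "\<epsilon> > 0" "D > 0"
  shows "(\<integral>\<^sup>+x\<in>{0..}. ennreal (tail X ((x + \<epsilon>) powr (1 / p) / (D * b))) \<partial>lborel)
    = ennreal (p * \<epsilon>) * weighted_tail X p (\<epsilon> powr (1 / p) / D) b"
proof -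
  have [measurable]: "tail X \<in> borel_measurable borel" by (rule tail_measurable[OF X])
  define F where "F x = tail X ((x + \<epsilon>) powr (1 / p) / (D * b))" for x
  define g where "g t = \<epsilon> * ((b * t) powr p - 1)" for t
  define g' where "g' t = p * \<epsilon> * (b powr p * t powr (p - 1))" for t
  have Fm [measurable]: "F \<in> borel_measurable borel" unfolding F_def by measurable
  have ib: "1 / b > 0" "1 / b \<ge> 1" using b by auto
  have g0: "g (1 / b) = 0" using b by (simp add: g_def)
  have "(\<integral>\<^sup>+x\<in>{g (1 / b)..}. ennreal (F x) \<partial>lborel) = (\<integral>\<^sup>+t\<in>{1 / b..}. ennreal (F (g t) * g' t) \<partial>lborel)"
  proof (rule nn_integral_substitution_at_top[OF Fm])
    show "(g has_real_derivative g' t) (at t)" if "t \<ge> 1 / b" for t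
    proof -
      have t: "t > 0" using that ib by linarith
      have "((\<lambda>t. \<epsilon> * (b powr p * t powr p - 1)) has_real_derivative g' t) (at t)"
        unfolding g'_def using t by (auto intro!: derivative_eq_intros)
      then show ?thesis unfolding g_def powr_mult .
    qed
    show "continuous_on {1 / b..} g'" unfolding g'_def using ib by (intro continuous_intros) auto
    show "g' t \<ge> 0" if "t \<ge> 1 / b" for t using assms by (simp add: g'_def)
    have "filterlim (\<lambda>t. \<epsilon> * b powr p * t powr p) at_top at_top"
      using assms by (intro filterlim_tendsto_pos_mult_at_top[OF tendsto_const _ filterlim_powr_at_top]) auto
    from filterlim_tendsto_add_at_top[OF tendsto_const[of "- \<epsilon>"] this]
    show "filterlim g at_top at_top" by (simp add: g_def[abs_def] powr_mult algebra_simps)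
  qed
  also have "\<dots> = (\<integral>\<^sup>+t. ennreal (p * \<epsilon>) * (ennreal (tail X (\<epsilon> powr (1 / p) / D * t)
      * (t powr (p - 1) * (if 1 / t \<le> b then b powr p else 0))) * indicator {1..} t) \<partial>lborel)"
  proof (intro nn_integral_cong)
    fix t :: real
    show "ennreal (F (g t) * g' t) * indicator {1 / b..} t
        = ennreal (p * \<epsilon>) * (ennreal (tail X (\<epsilon> powr (1 / p) / D * t)
          * (t powr (p - 1) * (if 1 / t \<le> b then b powr p else 0))) * indicator {1..} t)"
    proof (cases "t \<ge> 1 / b")
      case True
      then have t: "t \<ge> 1" using ib by linarith
      have "1 / t \<le> b" using True t b by (simp add: field_simps)
      have "(g t + \<epsilon>) powr (1 / p) = (\<epsilon> * (b * t) powr p) powr (1 / p)" by (simp add: g_def algebra_simps)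
      also have "\<dots> = \<epsilon> powr (1 / p) * (b * t)"
        unfolding powr_mult[of \<epsilon>] powr_powr using assms t by simp
      finally have "F (g t) = tail X (\<epsilon> powr (1 / p) / D * t)" using b by (simp add: F_def)
      then show ?thesis using True t \<open>1 / t \<le> b\<close> assms tail_bounds(1)[OF X]
        by (simp add: g'_def ennreal_mult[symmetric] mult_ac)
    next
      case False
      then have "\<not> 1 / t \<le> b" if "t \<ge> 1" using that b by (simp add: field_simps)
      then show ?thesis using False by (cases "t \<ge> 1") (auto simp: indicator_def)
    qed
  qed
  also have "\<dots> = ennreal (p * \<epsilon>) * weighted_tail X p (\<epsilon> powr (1 / p) / D) b"
    unfolding weighted_tail_def by (rule nn_integral_cmult) measurable
  finally show ?thesis unfolding g0 F_def .
qed

text \<open>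
  By Tonelli the sum moves under the integral, where it becomes the coefficient sum bounded by
  \<open>weighted_coeff_sum_upper\<close>.
\<close>
lemma weighted_tail_sum_finite:
  assumes X: "X \<in> H" and "p > 0" "r > 1" "q > 0" "\<beta> > - q / r" and s: "s = r / q"
    and fin: "tail_integral X s p 1 < \<infinity>" and \<kappa>: "\<kappa> > 0"
  shows "(\<Sum>n. ennreal (real (Suc n) powr (r - 2))
    * (\<Sum>i=1..Suc n. weighted_tail X p \<kappa> (model_coeff q \<beta> (Suc n) i))) < \<infinity>"
proof -
  have [measurable]: "tail X \<in> borel_measurable borel" by (rule tail_measurable[OF X])
  define b where "b = model_coeff q \<beta>"
  define h where "h n i t = (if 1 / t \<le> b n i then b n i powr p else 0)" for n i and t :: real
  have hm [measurable]: "h n i \<in> borel_measurable borel" for n i unfolding h_def by measurable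
  define v where "v t = tail X (\<kappa> * t) * t powr (p - 1)" for t
  have vm [measurable]: "v \<in> borel_measurable borel" unfolding v_def by measurable
  have v0: "v t \<ge> 0" for t using tail_bounds(1)[OF X] by (simp add: v_def)
  have wt: "weighted_tail X p \<kappa> (b n i) = (\<integral>\<^sup>+t\<in>{1..}. ennreal (v t * h n i t) \<partial>lborel)" for n i
    unfolding weighted_tail_def v_def h_def by (simp add: mult.assoc)
  obtain C where C: "C \<ge> 0" "\<And>m t. t \<ge> 1 \<Longrightarrow> (\<Sum>n=1..m. real n powr (r - 2) * (\<Sum>i=1..n. h n i t)) \<le> C * moment_weight s p t"
    using weighted_coeff_sum_upper[OF assms(3,4,5,2) s] unfolding h_def b_def by blast
  have "(\<Sum>n<m. ennreal (real (Suc n) powr (r - 2)) * (\<Sum>i=1..Suc n. weighted_tail X p \<kappa> (b (Suc n) i)))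
      \<le> ennreal C * tail_integral X s p \<kappa>" for m
  proof -
    define G where "G n i t = ennreal (v t * h n i t) * indicator {1..} t" for n i t
    have Gm [measurable]: "G n i \<in> borel_measurable borel" for n i unfolding G_def by measurable
    have "(\<Sum>n<m. ennreal (real (Suc n) powr (r - 2)) * (\<Sum>i=1..Suc n. weighted_tail X p \<kappa> (b (Suc n) i)))
        = (\<integral>\<^sup>+t. (\<Sum>n<m. ennreal (real (Suc n) powr (r - 2))
            * (\<Sum>i=1..Suc n. ennreal (v t * h (Suc n) i t) * indicator {1..} t)) \<partial>lborel)"
      unfolding wt G_def[symmetric]
      by (simp add: nn_integral_sum nn_integral_cmult del: sum.cl_ivl_Suc)
    also have "\<dots> \<le> (\<integral>\<^sup>+t. ennreal C * (ennreal (tail X (\<kappa> * t) * (t powr (p - 1) * moment_weight s p t)) * indicator {1..} t) \<partial>lborel)"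
    proof (intro nn_integral_mono)
      fix t :: real
      show "(\<Sum>n<m. ennreal (real (Suc n) powr (r - 2)) * (\<Sum>i=1..Suc n. ennreal (v t * h (Suc n) i t) * indicator {1..} t))
        \<le> ennreal C * (ennreal (tail X (\<kappa> * t) * (t powr (p - 1) * moment_weight s p t)) * indicator {1..} t)"
      proof (cases "t \<ge> 1")
        case True
        have h0: "h n i t \<ge> 0" for n i by (simp add: h_def)
        have "(\<Sum>n<m. ennreal (real (Suc n) powr (r - 2)) * (\<Sum>i=1..Suc n. ennreal (v t * h (Suc n) i t)))
            = ennreal (\<Sum>n<m. real (Suc n) powr (r - 2) * (\<Sum>i=1..Suc n. v t * h (Suc n) i t))"
        proof -
          have "(\<Sum>i=1..Suc n. ennreal (v t * h (Suc n) i t)) = ennreal (\<Sum>i=1..Suc n. v t * h (Suc n) i t)" for n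
            using h0 v0 by (intro sum_ennreal) auto
          moreover have "ennreal (real (Suc n) powr (r - 2)) * ennreal (\<Sum>i=1..Suc n. v t * h (Suc n) i t)
              = ennreal (real (Suc n) powr (r - 2) * (\<Sum>i=1..Suc n. v t * h (Suc n) i t))" for n
            using h0 v0 by (intro ennreal_mult[symmetric] sum_nonneg) auto
          moreover have "(\<Sum>n<m. ennreal (real (Suc n) powr (r - 2) * (\<Sum>i=1..Suc n. v t * h (Suc n) i t)))
              = ennreal (\<Sum>n<m. real (Suc n) powr (r - 2) * (\<Sum>i=1..Suc n. v t * h (Suc n) i t))"
            using h0 v0 by (intro sum_ennreal mult_nonneg_nonneg sum_nonneg) auto
          ultimately show ?thesis by (simp only:)
        qed
        also have "(\<Sum>n<m. real (Suc n) powr (r - 2) * (\<Sum>i=1..Suc n. v t * h (Suc n) i t))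
            = v t * (\<Sum>n=1..m. real n powr (r - 2) * (\<Sum>i=1..n. h n i t))"
          by (simp add: sum.atLeast1_atMost_eq[of _ m] sum_distrib_left mult_ac del: sum.cl_ivl_Suc)
        also have "\<dots> \<le> v t * (C * moment_weight s p t)"
          using C(2)[OF True, of m] v0 by (intro mult_left_mono) auto
        also have "\<dots> = C * (tail X (\<kappa> * t) * (t powr (p - 1) * moment_weight s p t))"
          by (simp add: v_def)
        also have "ennreal \<dots> = ennreal C * ennreal (tail X (\<kappa> * t) * (t powr (p - 1) * moment_weight s p t))"
          using C moment_weight_nonneg[OF True, of s p] tail_bounds(1)[OF X] by (intro ennreal_mult) auto
        finally show ?thesis using True by (simp add: ennreal_leI del: sum.cl_ivl_Suc)
      qed simp
    qed
    also have "\<dots> = ennreal C * tail_integral X s p \<kappa>"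
      unfolding tail_integral_def by (rule nn_integral_cmult) measurable
    finally show ?thesis .
  qed
  then have "(\<Sum>n. ennreal (real (Suc n) powr (r - 2)) * (\<Sum>i=1..Suc n. weighted_tail X p \<kappa> (b (Suc n) i)))
      \<le> ennreal C * tail_integral X s p \<kappa>"
    by (rule suminf_le_const[OF summableI])
  also have "\<dots> < \<infinity>" using tail_integral_scale[OF X zero_less_one \<kappa> fin] by (simp add: ennreal_mult_less_top)
  finally show ?thesis by (simp add: b_def)
qed

lemma tail_cmult:
  assumes "d > 0"
  shows "tail (\<lambda>\<omega>. d * X \<omega>) u = tail X (u / d)"
  unfolding tail_def using assms
  by (intro arg_cong[where f=cap]) (auto simp: abs_mult field_simps)

lemma tail_cmult_le:
  assumes X: "X \<in> H" and "\<bar>c\<bar> \<le> d" "d > 0"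
  shows "tail (\<lambda>\<omega>. c * X \<omega>) u \<le> tail X (u / d)"
  unfolding tail_def
proof (intro cap_mono sets_abs_greater H_cmult X subsetI)
  fix \<omega> assume w: "\<omega> \<in> {\<omega> \<in> space M. u < \<bar>c * X \<omega>\<bar>}"
  have "\<bar>c * X \<omega>\<bar> \<le> d * \<bar>X \<omega>\<bar>" unfolding abs_mult using assms by (intro mult_right_mono) auto
  with w assms show "\<omega> \<in> {\<omega> \<in> space M. u / d < \<bar>X \<omega>\<bar>}" by (auto simp: field_simps)
qed

text \<open>
  A crude bound for a single row with arbitrary coefficients, needed because the asymptotics of
  the array say nothing about finitely many rows: if a partial sum exceeds $y$, some summand
  exceeds $y/n$.
\<close>
lemma excess_integral_finite:
  assumes X0: "X0 \<in> H" and XH: "\<And>i. i \<ge> 1 \<Longrightarrow> X i \<in> H" and tails: "\<And>i. i \<ge> 1 \<Longrightarrow> tail (X i) = tail X0"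
    and p: "p > 0" and \<epsilon>: "\<epsilon> > 0" and fin: "tail_integral X0 s p 1 < \<infinity>" and n: "n \<ge> 1"
  shows "excess_integral a X p \<epsilon> n < \<infinity>"
proof -
  define d where "d = real n * (1 + (\<Sum>i=1..n. \<bar>a n i\<bar>))"
  have sn: "0 \<le> (\<Sum>i=1..n. \<bar>a n i\<bar>)" by (rule sum_nonneg) auto
  have d: "d > 0" unfolding d_def using n sn by (intro mult_pos_pos add_pos_nonneg) auto
  define Y where "Y \<omega> = d * X0 \<omega>" for \<omega>
  have Y: "Y \<in> H" unfolding Y_def[abs_def] by (rule H_cmult[OF X0])
  have [measurable]: "tail Y \<in> borel_measurable borel" by (rule tail_measurable[OF Y])
  have "tail_integral Y s p 1 = tail_integral X0 s p (1 / d)"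
    unfolding tail_integral_def Y_def[abs_def] tail_cmult[OF d] by simp
  also have "\<dots> < \<infinity>" using d by (intro tail_integral_scale[OF X0 zero_less_one _ fin]) auto
  finally have Yfin: "abs_moment Y p < \<infinity>" by (rule abs_moment_finite[OF Y _ zero_less_one p]) simp
  have le: "cap (max_exceeds a X n y) \<le> real n * tail Y y" if y: "y \<ge> 0" for y
  proof -
    have S: "{\<omega> \<in> space M. \<bar>a n i * X i \<omega>\<bar> > y / real n} \<in> sets M" if "i \<in> {1..n}" for i
      using that by (intro sets_abs_greater H_cmult XH) auto
    have "cap (max_exceeds a X n y) \<le> cap (\<Union>i\<in>{1..n}. {\<omega> \<in> space M. \<bar>a n i * X i \<omega>\<bar> > y / real n})"
    proof (intro cap_mono sets_max_exceeds XH subsetI)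
      show "(\<Union>i\<in>{1..n}. {\<omega> \<in> space M. \<bar>a n i * X i \<omega>\<bar> > y / real n}) \<in> sets M" using S by auto
      fix \<omega> assume "\<omega> \<in> max_exceeds a X n y"
      then obtain k where k: "\<omega> \<in> space M" "k \<in> {1..n}" "\<bar>\<Sum>i=1..k. a n i * X i \<omega>\<bar> > y"
        by (auto simp: max_exceeds_def)
      show "\<omega> \<in> (\<Union>i\<in>{1..n}. {\<omega> \<in> space M. \<bar>a n i * X i \<omega>\<bar> > y / real n})"
      proof (rule ccontr)
        assume "\<omega> \<notin> (\<Union>i\<in>{1..n}. {\<omega> \<in> space M. \<bar>a n i * X i \<omega>\<bar> > y / real n})"
        then have "\<bar>a n i * X i \<omega>\<bar> \<le> y / real n" if "i \<in> {1..k}" for i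
          using that k by (auto simp: not_less)
        then have "(\<Sum>i=1..k. \<bar>a n i * X i \<omega>\<bar>) \<le> (\<Sum>i=1..k. y / real n)" by (intro sum_mono)
        also have "\<dots> = real k * (y / real n)" by simp
        also have "\<dots> \<le> real n * (y / real n)" using k y by (intro mult_right_mono) auto
        also have "\<dots> = y" using n by simp
        finally have "(\<Sum>i=1..k. \<bar>a n i * X i \<omega>\<bar>) \<le> y" .
        then show False using k(3) sum_abs[of "\<lambda>i. a n i * X i \<omega>" "{1..k}"] by linarith
      qed
    qed auto
    also have "\<dots> \<le> (\<Sum>i=1..n. cap {\<omega> \<in> space M. \<bar>a n i * X i \<omega>\<bar> > y / real n})"
      using S by (intro cap_UN) auto
    also have "\<dots> \<le> (\<Sum>i=1..n. tail Y y)"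
    proof (rule sum_mono)
      fix i assume i: "i \<in> {1..n}"
      have "\<bar>a n i\<bar> \<le> (\<Sum>i=1..n. \<bar>a n i\<bar>)" using i by (intro member_le_sum) auto
      then have ai: "\<bar>a n i\<bar> \<le> 1 + (\<Sum>i=1..n. \<bar>a n i\<bar>)" by simp
      have "cap {\<omega> \<in> space M. \<bar>a n i * X i \<omega>\<bar> > y / real n} = tail (\<lambda>\<omega>. a n i * X i \<omega>) (y / real n)"
        by (simp add: tail_def)
      also have "\<dots> \<le> tail (X i) (y / real n / (1 + (\<Sum>i=1..n. \<bar>a n i\<bar>)))"
        using i sn by (intro tail_cmult_le XH ai add_pos_nonneg) auto
      also have "\<dots> = tail Y y"
        using tails[of i] i unfolding Y_def[abs_def] tail_cmult[OF d] by (simp add: d_def)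
      finally show "cap {\<omega> \<in> space M. \<bar>a n i * X i \<omega>\<bar> > y / real n} \<le> tail Y y" .
    qed
    also have "\<dots> = real n * tail Y y" by simp
    finally show ?thesis .
  qed
  show ?thesis unfolding excess_integral_def
  proof (rule nn_integral_finite_mono[where C="real n" and g="\<lambda>x. tail Y (x powr (1 / p))"])
    show "(\<integral>\<^sup>+x\<in>{0..}. ennreal (tail Y (x powr (1 / p))) \<partial>lborel) < \<infinity>"
      using Yfin by (simp add: abs_moment_def)
    fix x :: real assume x: "x \<in> {0..}"
    have "cap (max_exceeds a X n ((x + \<epsilon>) powr (1 / p))) \<le> real n * tail Y ((x + \<epsilon>) powr (1 / p))"
      by (rule le) simp
    also have "\<dots> \<le> real n * tail Y (x powr (1 / p))"
      using x \<epsilon> p by (intro mult_left_mono antimonoD[OF tail_antimono[OF Y]] powr_mono2) auto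
    finally show "cap (max_exceeds a X n ((x + \<epsilon>) powr (1 / p))) \<le> real n * tail Y (x powr (1 / p))" .
    show "0 \<le> tail Y (x powr (1 / p))" by (rule tail_bounds(1)[OF Y])
  qed auto
qed

text \<open>
  The tail bound for weighted sums at truncation level $y/K$, where $y = (x+\epsilon)^{1/p}$. Its
  hypothesis $B \le 1$ holds for all $y \ge \epsilon^{1/p}$ once $n$ is large, since $B$ is a
  multiple of $n^{-\eta} y^{-\theta}$ with $\eta = q\theta - 1 > 0$. Raising $B$ to the power
  $K/2$ makes the decay in $n$ and in $x$ as fast as needed.
\<close>
lemma max_exceeds_tail_bound:
  assumes ca: "countably_subadditive_exp M H \<E>"
    and X0: "X0 \<in> H" and XH: "\<And>i. i \<ge> 1 \<Longrightarrow> X i \<in> H" and ind: "indep_seq H \<E> X"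
    and tails: "\<And>i. i \<ge> 1 \<Longrightarrow> tail (X i) = tail X0"
    and centred: "\<And>i. i \<ge> 1 \<Longrightarrow> q \<le> 1 \<Longrightarrow> \<E> (X i) = 0 \<and> \<E> (\<lambda>\<omega>. - X i \<omega>) = 0"
    and p: "p > 0" and r: "r > 1" and q: "q > 1/2" and \<beta>: "\<beta> > - q / r" and s: "s = r / q"
    and C: "C > 0" and a: "\<And>n i. n \<ge> n0 \<Longrightarrow> i \<in> {1..n} \<Longrightarrow> \<bar>a n i\<bar> \<le> C * model_coeff q \<beta> n i"
    and fin: "tail_integral X0 s p 1 < \<infinity>" and \<epsilon>: "\<epsilon> > 0"
  obtains K A \<sigma> N where "K > 0" "A \<ge> 0" "\<sigma> > 1"
    and "\<And>n x. n \<ge> N \<Longrightarrow> n \<ge> 1 \<Longrightarrow> x \<ge> 0 \<Longrightarrow> cap (max_exceeds a X n ((x + \<epsilon>) powr (1 / p)))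
      \<le> (\<Sum>i=1..n. tail X0 ((x + \<epsilon>) powr (1 / p) / (K * model_coeff q \<beta> n i)))
        + A * real n powr (- r) * (x + \<epsilon>) powr (- \<sigma>)"
proof -
  have q0: "q > 0" using q by simp
  have s0: "s > 0" using s r q0 by simp
  define b where "b = model_coeff q \<beta>"
  have b0: "b n i > 0" if "i \<in> {1..n}" for n i
    using that model_coeff_pos[of n i q \<beta>] by (simp add: b_def)
  \<comment> \<open>The bound $2$ requires centred variables, which are available only for $q \le 1$.\<close>
  define \<theta> where "\<theta> = min s (if q \<le> 1 then 2 else 1)"
  have \<theta>: "0 < \<theta>" "\<theta> \<le> 2" "\<theta> \<le> s" "\<theta> > 1 \<Longrightarrow> q \<le> 1"
    using s0 by (auto simp: \<theta>_def split: if_splits)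
  have q\<theta>: "q * \<theta> > 1"
  proof -
    have "q * s = r" using s q0 by simp
    then show ?thesis using r q unfolding \<theta>_def min_def by (auto split: if_splits)
  qed
  have "\<beta> * s > -1" using \<beta> r q0 by (simp add: s field_simps)
  note b\<theta> = exponent_above_minus_one[OF this \<theta>(1,3)]
  define \<eta> where "\<eta> = q * \<theta> - 1"
  have \<eta>: "\<eta> > 0" using q\<theta> by (simp add: \<eta>_def)
  obtain C\<theta> where C\<theta>: "C\<theta> > 0" "\<And>n. n \<ge> 1 \<Longrightarrow> (\<Sum>i=1..n. b n i powr \<theta>) \<le> C\<theta> * real n powr (- \<eta>)"
    using sum_model_coeff_powr_le[OF b\<theta>, of q] unfolding b_def \<eta>_def by auto
  define \<mu> where "\<mu> = enn2real (abs_moment X0 \<theta>)"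
  have "abs_moment X0 \<theta> < \<infinity>" using \<theta> by (intro abs_moment_finite[OF X0 fin]) auto
  then have \<mu>0: "abs_moment X0 \<theta> = ennreal \<mu>" by (simp add: \<mu>_def)
  have \<mu>: "abs_moment (X i) \<theta> \<le> ennreal \<mu>" if "i \<ge> 1" for i
    using \<mu>0 tails[OF that] by (simp add: abs_moment_def)
  have \<mu>n: "\<mu> \<ge> 0" by (simp add: \<mu>_def)
  \<comment> \<open>The first term controls the decay in $n$, the second the decay in $x$.\<close>
  define K where "K = max (2 * r / \<eta>) (4 * p / \<theta>)"
  have K: "K > 0" "\<eta> * K / 2 \<ge> r" "\<theta> * K / (2 * p) \<ge> 2"
  proof -
    have "2 * r / \<eta> > 0" using r \<eta> by simp
    then show "K > 0" unfolding K_def by linarith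
    have "K \<ge> 2 * r / \<eta>" "K \<ge> 4 * p / \<theta>" by (auto simp: K_def)
    then show "\<eta> * K / 2 \<ge> r" "\<theta> * K / (2 * p) \<ge> 2" using \<eta> \<theta> p by (auto simp: field_simps)
  qed
  define \<sigma> where "\<sigma> = \<theta> * K / (2 * p)"
  \<comment> \<open>The summand $1$ only serves to make $D$ positive, since the moment may be $0$.\<close>
  define D where "D = (C * K) powr \<theta> * \<mu> * C\<theta> + 1"
  have D: "D > 0" using \<mu>n C\<theta> by (simp add: D_def add_nonneg_pos)
  define B where "B n x = D * real n powr (- \<eta>) * (x + \<epsilon>) powr (- \<theta> / p)" for n x
  define A where "A = 2 * exp 3 * D powr (K / 2)"
  obtain N1 :: nat where small: "\<And>n. n \<ge> N1 \<Longrightarrow> D * real n powr (- \<eta>) * \<epsilon> powr (- \<theta> / p) \<le> 1"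
  proof -
    have "((\<lambda>n. real n powr (- \<eta>)) \<longlongrightarrow> 0) sequentially"
      using \<eta> by (intro tendsto_neg_powr filterlim_real_sequentially) auto
    then have "((\<lambda>n. D * real n powr (- \<eta>) * \<epsilon> powr (- \<theta> / p)) \<longlongrightarrow> D * 0 * \<epsilon> powr (- \<theta> / p)) sequentially"
      by (intro tendsto_intros)
    then have "eventually (\<lambda>n. D * real n powr (- \<eta>) * \<epsilon> powr (- \<theta> / p) < 1) sequentially"
      by (intro order_tendstoD(2)) auto
    then obtain N where "\<forall>n\<ge>N. D * real n powr (- \<eta>) * \<epsilon> powr (- \<theta> / p) < 1"
      unfolding eventually_sequentially by blast
    then show ?thesis by (intro that[of N] less_imp_le) blast
  qed
  show thesis
  proof (rule that[of "K * C" A \<sigma> "max n0 N1"])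
    show "K * C > 0" "A \<ge> 0" "\<sigma> > 1" using K C by (auto simp: A_def \<sigma>_def)
    fix n :: nat and x :: real assume nn: "n \<ge> max n0 N1" and n1: "n \<ge> 1" and x: "x \<ge> 0"
    then have n: "n \<ge> n0" "n \<ge> N1" by auto
    have "cap (max_exceeds a X n ((x + \<epsilon>) powr (1 / p)))
        \<le> (\<Sum>i=1..n. tail X0 ((x + \<epsilon>) powr (1 / p) / (K * C * b n i)))
          + A * real n powr (- (\<eta> * K / 2)) * (x + \<epsilon>) powr (- \<sigma>)"
    proof -
      define y where "y = (x + \<epsilon>) powr (1 / p)"
      have y: "y > 0" using x \<epsilon> by (simp add: y_def)
      define L where "L = y / K"
      have L: "L > 0" using y K by (simp add: L_def)
      have xe: "x + \<epsilon> > 0" using x \<epsilon> by simp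
      have Bpos: "0 < B n x" using D xe n1 by (simp add: B_def)
      have "(x + \<epsilon>) powr (- \<theta> / p) \<le> \<epsilon> powr (- \<theta> / p)"
        using x \<epsilon> \<theta> p by (intro powr_mono2') auto
      then have "B n x \<le> D * real n powr (- \<eta>) * \<epsilon> powr (- \<theta> / p)"
        unfolding B_def using D by (intro mult_left_mono) auto
      then have B1: "B n x \<le> 1" using small[OF n(2)] by simp
      have "(\<Sum>i=1..n. (\<bar>a n i\<bar> / L) powr \<theta> * \<mu>) \<le> (\<Sum>i=1..n. (C * K) powr \<theta> * y powr (- \<theta>) * \<mu> * b n i powr \<theta>)"
      proof (rule sum_mono)
        fix i assume i: "i \<in> {1..n}"
        have "\<bar>a n i\<bar> / L \<le> C * b n i / L" using a[OF n(1) i] L by (intro divide_right_mono) (auto simp: b_def)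
        then have "(\<bar>a n i\<bar> / L) powr \<theta> \<le> (C * b n i / L) powr \<theta>"
          using L \<theta> by (intro powr_mono2) auto
        also have "C * b n i / L = (C * K) * b n i / y" by (simp add: L_def)
        also have "((C * K) * b n i / y) powr \<theta> = (C * K) powr \<theta> * y powr (- \<theta>) * b n i powr \<theta>"
          by (simp only: powr_divide powr_mult powr_minus) (simp add: divide_inverse)
        finally have "(\<bar>a n i\<bar> / L) powr \<theta> * \<mu> \<le> (C * K) powr \<theta> * y powr (- \<theta>) * b n i powr \<theta> * \<mu>"
          using \<mu>n by (rule mult_right_mono)
        then show "(\<bar>a n i\<bar> / L) powr \<theta> * \<mu> \<le> (C * K) powr \<theta> * y powr (- \<theta>) * \<mu> * b n i powr \<theta>"
          by (simp add: mult_ac)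
      qed
      also have "\<dots> = (C * K) powr \<theta> * y powr (- \<theta>) * \<mu> * (\<Sum>i=1..n. b n i powr \<theta>)"
        by (simp add: sum_distrib_left)
      also have "\<dots> \<le> (C * K) powr \<theta> * y powr (- \<theta>) * \<mu> * (C\<theta> * real n powr (- \<eta>))"
        using C\<theta>(2)[OF n1] \<mu>n by (intro mult_left_mono) auto
      also have "\<dots> = (D - 1) * (real n powr (- \<eta>) * y powr (- \<theta>))" by (simp add: D_def)
      also have "\<dots> \<le> D * (real n powr (- \<eta>) * y powr (- \<theta>))" by (intro mult_right_mono) auto
      also have "y powr (- \<theta>) = (x + \<epsilon>) powr (- \<theta> / p)" by (simp add: y_def powr_powr)
      also have "D * (real n powr (- \<eta>) * (x + \<epsilon>) powr (- \<theta> / p)) = B n x" by (simp add: B_def)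
      finally have Bsum: "(\<Sum>i=1..n. (\<bar>a n i\<bar> / L) powr \<theta> * \<mu>) \<le> B n x" .
      have A1: "cap (max_exceeds a X n y) \<le> (\<Sum>i=1..n. cap {\<omega> \<in> space M. \<bar>a n i * X i \<omega>\<bar> > L})
          + 2 * exp 3 * B n x powr (y / L / 2)"
        unfolding max_exceeds_def
        by (rule max_weighted_sum_tail_le[OF ca XH ind L \<theta>(1,2) _ \<mu> \<mu>n Bsum Bpos B1])
          (use centred \<theta>(4) in auto)
      have A2: "(\<Sum>i=1..n. cap {\<omega> \<in> space M. \<bar>a n i * X i \<omega>\<bar> > L}) \<le> (\<Sum>i=1..n. tail X0 (y / (K * C * b n i)))"
      proof (rule sum_mono)
        fix i assume i: "i \<in> {1..n}"
        have "cap {\<omega> \<in> space M. \<bar>a n i * X i \<omega>\<bar> > L} = tail (\<lambda>\<omega>. a n i * X i \<omega>) L"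
          by (simp add: tail_def)
        also have "\<dots> \<le> tail (X i) (L / (C * b n i))"
          using i C b0[OF i] a[OF n(1) i] by (intro tail_cmult_le XH) (auto simp: b_def)
        also have "L / (C * b n i) = y / (K * C * b n i)" by (simp add: L_def)
        finally show "cap {\<omega> \<in> space M. \<bar>a n i * X i \<omega>\<bar> > L} \<le> tail X0 (y / (K * C * b n i))"
          using tails[of i] i by simp
      qed
      have A3: "2 * exp 3 * B n x powr (y / L / 2) = A * real n powr (- (\<eta> * K / 2)) * (x + \<epsilon>) powr (- \<sigma>)"
      proof -
        have yL: "y / L = K" using y K by (simp add: L_def)
        show ?thesis unfolding yL B_def powr_mult powr_powr A_def \<sigma>_def by (simp add: mult.commute[of p 2])
      qed
      from A1 A2 have "cap (max_exceeds a X n y) \<le> (\<Sum>i=1..n. tail X0 (y / (K * C * b n i)))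
          + A * real n powr (- (\<eta> * K / 2)) * (x + \<epsilon>) powr (- \<sigma>)"
        unfolding A3 by linarith
      then show ?thesis unfolding y_def .
    qed
    also have "A * real n powr (- (\<eta> * K / 2)) * (x + \<epsilon>) powr (- \<sigma>)
        \<le> A * real n powr (- r) * (x + \<epsilon>) powr (- \<sigma>)"
      using K(2) n1 by (intro mult_right_mono mult_left_mono powr_mono) (auto simp: A_def)
    finally show "cap (max_exceeds a X n ((x + \<epsilon>) powr (1 / p)))
        \<le> (\<Sum>i=1..n. tail X0 ((x + \<epsilon>) powr (1 / p) / (K * C * model_coeff q \<beta> n i)))
          + A * real n powr (- r) * (x + \<epsilon>) powr (- \<sigma>)"
      by (simp add: b_def)
  qed
qed

text \<open>
  The single large summands give the tail integral; the remainder is of order $n^{-2}$ after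
  multiplication by $n^{r-2}$.
\<close>
proposition excess_series_finite:
  assumes ca: "countably_subadditive_exp M H \<E>"
    and X0: "X0 \<in> H" and XH: "\<And>i. i \<ge> 1 \<Longrightarrow> X i \<in> H" and ind: "indep_seq H \<E> X"
    and tails: "\<And>i. i \<ge> 1 \<Longrightarrow> tail (X i) = tail X0"
    and centred: "\<And>i. i \<ge> 1 \<Longrightarrow> q \<le> 1 \<Longrightarrow> \<E> (X i) = 0 \<and> \<E> (\<lambda>\<omega>. - X i \<omega>) = 0"
    and p: "p > 0" and r: "r > 1" and q: "q > 1/2" and \<beta>: "\<beta> > - q / r" and s: "s = r / q"
    and C: "C > 0" and a: "\<And>n i. n \<ge> n0 \<Longrightarrow> i \<in> {1..n} \<Longrightarrow> \<bar>a n i\<bar> \<le> C * model_coeff q \<beta> n i"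
    and fin: "tail_integral X0 s p 1 < \<infinity>" and \<epsilon>: "\<epsilon> > 0"
  shows "(\<Sum>n. ennreal (real (Suc n) powr (r - 2)) * excess_integral a X p \<epsilon> (Suc n)) < \<infinity>"
proof -
  have q0: "q > 0" using q by simp
  define b where "b = model_coeff q \<beta>"
  have b01: "b n i > 0" "b n i \<le> 1" if "i \<in> {1..n}" for n i
    using that model_coeff_pos[of n i q \<beta>] model_coeff_le_1[of i n q \<beta>] q0 exponent_sum_pos[OF r q0 \<beta>]
    by (auto simp: b_def)
  define y where "y x = (x + \<epsilon>) powr (1 / p)" for x
  obtain K A \<sigma> N where K: "K > 0" and A: "A \<ge> 0" and \<sigma>: "\<sigma> > 1"
    and bound: "\<And>n x. n \<ge> N \<Longrightarrow> n \<ge> 1 \<Longrightarrow> x \<ge> 0 \<Longrightarrow> cap (max_exceeds a X n (y x))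
      \<le> (\<Sum>i=1..n. tail X0 (y x / (K * b n i))) + A * real n powr (- r) * (x + \<epsilon>) powr (- \<sigma>)"
    unfolding y_def b_def
    using max_exceeds_tail_bound[OF ca X0 XH ind tails centred p r q \<beta> s C a fin \<epsilon>] that by blast
  define I where "I = (\<integral>\<^sup>+x\<in>{0..}. ennreal ((x + \<epsilon>) powr (- \<sigma>)) \<partial>lborel)"
  have I: "I < \<infinity>" unfolding I_def by (rule nn_integral_shifted_powr_finite[OF \<sigma> \<epsilon>])
  define R where "R n = ennreal (A * real n powr (- r)) * I" for n
  define \<kappa> where "\<kappa> = \<epsilon> powr (1 / p) / K"
  have \<kappa>: "\<kappa> > 0" using \<epsilon> K by (simp add: \<kappa>_def)
  define V where "V n = (\<Sum>i=1..n. weighted_tail X0 p \<kappa> (b n i))" for n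
  have main: "excess_integral a X p \<epsilon> n \<le> ennreal (p * \<epsilon>) * V n + R n" if n: "n \<ge> N" "n \<ge> 1" for n
  proof -
    have tm [measurable]: "tail X0 \<in> borel_measurable borel" by (rule tail_measurable[OF X0])
    define F where "F i x = ennreal (tail X0 (y x / (K * b n i))) * indicator {0..} x" for i x
    have Fm [measurable]: "F i \<in> borel_measurable borel" for i unfolding F_def y_def by measurable
    define Q where "Q x = ennreal ((x + \<epsilon>) powr (- \<sigma>)) * indicator {0..} x" for x
    have Qm [measurable]: "Q \<in> borel_measurable borel" unfolding Q_def by measurable
    have "excess_integral a X p \<epsilon> n \<le> (\<integral>\<^sup>+x. (\<Sum>i=1..n. F i x) + ennreal (A * real n powr (- r)) * Q x \<partial>lborel)"
      unfolding excess_integral_def y_def[symmetric]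
    proof (intro nn_integral_mono)
      fix x :: real
      show "ennreal (cap (max_exceeds a X n (y x))) * indicator {0..} x
        \<le> (\<Sum>i=1..n. F i x) + ennreal (A * real n powr (- r)) * Q x"
      proof (cases "x \<ge> 0")
        case True
        have "ennreal (cap (max_exceeds a X n (y x))) \<le> ennreal ((\<Sum>i=1..n. tail X0 (y x / (K * b n i)))
            + A * real n powr (- r) * (x + \<epsilon>) powr (- \<sigma>))"
          by (rule ennreal_leI[OF bound[OF n True]])
        also have "\<dots> = ennreal (\<Sum>i=1..n. tail X0 (y x / (K * b n i)))
            + ennreal (A * real n powr (- r) * (x + \<epsilon>) powr (- \<sigma>))"
          using A tail_bounds(1)[OF X0] by (intro ennreal_plus sum_nonneg) auto
        also have "ennreal (\<Sum>i=1..n. tail X0 (y x / (K * b n i))) = (\<Sum>i=1..n. ennreal (tail X0 (y x / (K * b n i))))"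
          using tail_bounds(1)[OF X0] by (intro sum_ennreal[symmetric])
        also have "ennreal (A * real n powr (- r) * (x + \<epsilon>) powr (- \<sigma>))
            = ennreal (A * real n powr (- r)) * ennreal ((x + \<epsilon>) powr (- \<sigma>))"
          using A by (intro ennreal_mult) auto
        finally show ?thesis using True by (simp add: F_def Q_def)
      qed simp
    qed
    also have "\<dots> = (\<Sum>i=1..n. \<integral>\<^sup>+x. F i x \<partial>lborel) + R n"
      unfolding R_def I_def Q_def[symmetric]
      by (simp add: nn_integral_add nn_integral_sum nn_integral_cmult del: sum.cl_ivl_Suc)
    also have "(\<Sum>i=1..n. \<integral>\<^sup>+x. F i x \<partial>lborel) = (\<Sum>i=1..n. ennreal (p * \<epsilon>) * weighted_tail X0 p \<kappa> (b n i))"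
      unfolding \<kappa>_def F_def y_def using b01 p \<epsilon> K by (intro sum.cong refl weighted_tail_eq X0) auto
    finally show ?thesis by (simp add: V_def sum_distrib_left)
  qed
  have R: "(\<Sum>n. ennreal (real (Suc n) powr (r - 2)) * R (Suc n)) < \<infinity>"
  proof -
    have "ennreal (real (Suc n) powr (r - 2)) * R (Suc n) = ennreal (A * real (Suc n) powr (- 2)) * I" for n
    proof -
      have "real (Suc n) powr (r - 2) * real (Suc n) powr (- r) = real (Suc n) powr (- 2)"
        unfolding powr_add[symmetric] by simp
      then have "real (Suc n) powr (r - 2) * (A * real (Suc n) powr (- r)) = A * real (Suc n) powr (- 2)"
        by (simp only: mult.left_commute)
      moreover have "ennreal u * (ennreal v * I) = ennreal (u * v) * I" if "u \<ge> 0" "v \<ge> 0" for u v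
        using that by (simp add: ennreal_mult mult.assoc)
      ultimately show ?thesis unfolding R_def using A by (metis mult_nonneg_nonneg powr_ge_zero)
    qed
    then have "(\<Sum>n. ennreal (real (Suc n) powr (r - 2)) * R (Suc n)) = (\<Sum>n. ennreal (A * real (Suc n) powr (- 2))) * I"
      by (simp only: ennreal_suminf_multc)
    also have "(\<Sum>n. ennreal (A * real (Suc n) powr (- 2))) < \<infinity>"
    proof -
      have "summable (\<lambda>n. real n powr (- 2))" by (subst summable_real_powr_iff) simp
      then have "summable (\<lambda>n. A * real (Suc n) powr (- 2))"
        by (intro summable_mult) (subst summable_Suc_iff, assumption)
      then show ?thesis using A by (subst suminf_ennreal2) auto
    qed
    then have "(\<Sum>n. ennreal (A * real (Suc n) powr (- 2))) * I < \<infinity>"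
      using I by (simp add: ennreal_mult_less_top)
    finally show ?thesis .
  qed
  have W: "(\<Sum>n. ennreal (real (Suc n) powr (r - 2)) * V (Suc n)) < \<infinity>"
    unfolding V_def b_def by (rule weighted_tail_sum_finite[OF X0 p r q0 \<beta> s fin \<kappa>])
  define g where "g n = ennreal (p * \<epsilon>) * (ennreal (real (Suc n) powr (r - 2)) * V (Suc n))
    + ennreal (real (Suc n) powr (r - 2)) * R (Suc n)" for n
  show ?thesis
  proof (rule suminf_finite_if_eventually_le[where N=N and g=g])
    show "ennreal (real (Suc n) powr (r - 2)) * excess_integral a X p \<epsilon> (Suc n) < \<infinity>" for n
      using excess_integral_finite[where n="Suc n" and a=a, OF X0 XH tails p \<epsilon> fin] by (simp add: ennreal_mult_less_top)
    fix n assume n: "n \<ge> N"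
    have "ennreal (real (Suc n) powr (r - 2)) * excess_integral a X p \<epsilon> (Suc n)
      \<le> ennreal (real (Suc n) powr (r - 2)) * (ennreal (p * \<epsilon>) * V (Suc n) + R (Suc n))"
      using n by (intro mult_left_mono main) auto
    then show "ennreal (real (Suc n) powr (r - 2)) * excess_integral a X p \<epsilon> (Suc n) \<le> g n"
      by (simp only: g_def distrib_left mult.left_commute[of "ennreal (p * \<epsilon>)"])
  next
    show "(\<Sum>n. g n) < \<infinity>"
      unfolding g_def using W R
      by (subst suminf_add[symmetric]) (auto intro: summableI simp: ennreal_suminf_cmult ennreal_mult_less_top)
  qed
qed

section \<open>From the series to the moment condition\<close>

text \<open>
  A summand larger than $2u$ is the difference of two consecutive partial sums, one of which must
  exceed $u$. At least $n/2$ independent summands are available, so the capacity is at least $1 -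
  (1-v)^{n/2} \ge 1 - e^{-nv/2}$, and $1 - e^{-z} \ge z/(1+z) \ge \frac12\min(1,z)$.
\<close>
lemma max_exceeds_lower_bound:
  assumes X0: "X0 \<in> H" and XH: "\<And>i. i \<ge> 1 \<Longrightarrow> X i \<in> H" and ind: "indep_seq H \<E> X"
    and tails: "\<And>i. i \<ge> 1 \<Longrightarrow> tail (X i) = tail X0"
    and u: "u \<ge> 0" and d: "d > 0"
    and a: "\<And>i. i \<in> {n div 2 + 1..n} \<Longrightarrow> \<bar>a n i\<bar> \<ge> d"
  shows "cap (max_exceeds a X n u) \<ge> min 1 (real n * tail X0 (2 * u / d)) / 4"
proof -
  define y where "y = 2 * u / d"
  define v where "v = tail X0 y"
  define T where "T i = (if i \<in> {n div 2 + 1..n} then {z::real. \<bar>z\<bar> > y} else {})" for i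
  have v: "0 \<le> v" "v \<le> 1" using tail_bounds[OF X0] by (auto simp: v_def)
  have T: "T i \<in> sets borel" for i
  proof -
    have "open {z::real. \<bar>z\<bar> > y}" by (intro open_Collect_less continuous_intros)
    then show ?thesis by (simp add: T_def)
  qed
  have ev: "{\<omega> \<in> space M. X i \<omega> \<in> T i} \<in> sets M" if "i \<ge> 1" for i
    using sets_abs_greater[OF XH[OF that]] by (auto simp: T_def)
  have sets: "{\<omega> \<in> space M. \<exists>i\<in>{1..n}. X i \<omega> \<in> T i} \<in> sets M"
  proof -
    have "{\<omega> \<in> space M. \<exists>i\<in>{1..n}. X i \<omega> \<in> T i} = (\<Union>i\<in>{1..n}. {\<omega> \<in> space M. X i \<omega> \<in> T i})" by auto
    then show ?thesis using ev by auto
  qed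
  have capT: "cap {\<omega> \<in> space M. X i \<omega> \<in> T i} = (if i \<in> {n div 2 + 1..n} then v else 0)" if "i \<in> {1..n}" for i
    using tails[of i] that by (auto simp: T_def v_def tail_def[abs_def] cap_empty fun_eq_iff)
  have "(\<Prod>i=1..n. 1 - cap {\<omega> \<in> space M. X i \<omega> \<in> T i})
      \<le> (\<Prod>i=1..n. exp (- (if i \<in> {n div 2 + 1..n} then v else 0)))"
  proof (rule prod_mono)
    fix i assume i: "i \<in> {1..n}"
    show "0 \<le> 1 - cap {\<omega> \<in> space M. X i \<omega> \<in> T i} \<and> 1 - cap {\<omega> \<in> space M. X i \<omega> \<in> T i}
        \<le> exp (- (if i \<in> {n div 2 + 1..n} then v else 0))"
      unfolding capT[OF i] using v exp_ge_add_one_self[of "- v"] by auto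
  qed
  also have "\<dots> = exp (- (\<Sum>i=1..n. if i \<in> {n div 2 + 1..n} then v else 0))"
    by (simp only: exp_sum[symmetric] finite_atLeastAtMost sum_negf)
  also have "(\<Sum>i=1..n. if i \<in> {n div 2 + 1..n} then v else 0) = (\<Sum>i\<in>{n div 2 + 1..n}. v)"
    by (rule sum.mono_neutral_cong_right) auto
  also have "\<dots> = real (n - n div 2) * v" by simp
  also have "exp (- (real (n - n div 2) * v)) \<le> exp (- (real n / 2 * v))"
  proof -
    have "2 * (n - n div 2) \<ge> n" by simp
    then have "real n / 2 \<le> real (n - n div 2)" by linarith
    then have "real n / 2 * v \<le> real (n - n div 2) * v" using v by (intro mult_right_mono)
    then show ?thesis by simp
  qed
  finally have "1 - exp (- (real n / 2 * v)) \<le> cap {\<omega> \<in> space M. \<exists>i\<in>{1..n}. X i \<omega> \<in> T i}"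
    using cap_union_indep[where T=T and n=n, OF XH ind T] by linarith
  moreover have "min 1 (real n * v) / 4 \<le> 1 - exp (- (real n / 2 * v))"
  proof -
    define z where "z = real n / 2 * v"
    have z: "z \<ge> 0" using v by (simp add: z_def)
    have "exp (- z) \<le> 1 / (1 + z)"
      using exp_ge_add_one_self[of z] z by (simp add: exp_minus divide_inverse le_imp_inverse_le)
    moreover have "min 1 (2 * z) / 4 \<le> 1 - 1 / (1 + z)"
    proof (cases "z \<le> 1")
      case True
      have "z / 2 \<le> z / (1 + z)" using z True by (intro divide_left_mono) auto
      also have "z / (1 + z) = 1 - 1 / (1 + z)" using z by (simp add: field_simps)
      finally show ?thesis using z by (simp add: min_def)
    next
      case False
      have "1 / (1 + z) \<le> 1 / 2" using False by (intro divide_left_mono) auto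
      then show ?thesis by (simp add: min_def)
    qed
    ultimately show ?thesis by (simp add: z_def)
  qed
  moreover have "cap {\<omega> \<in> space M. \<exists>i\<in>{1..n}. X i \<omega> \<in> T i} \<le> cap (max_exceeds a X n u)"
  proof (intro cap_mono sets sets_max_exceeds XH subsetI)
    fix \<omega> assume "\<omega> \<in> {\<omega> \<in> space M. \<exists>i\<in>{1..n}. X i \<omega> \<in> T i}"
    then obtain i where w: "\<omega> \<in> space M" and i: "i \<in> {n div 2 + 1..n}" "\<bar>X i \<omega>\<bar> > y"
      by (auto simp: T_def split: if_splits)
    define S where "S k = (\<Sum>i=1..k. a n i * X i \<omega>)" for k
    have "2 * u = d * y" using d by (simp add: y_def)
    also have "\<dots> < d * \<bar>X i \<omega>\<bar>" using i d by simp
    also have "\<dots> \<le> \<bar>a n i\<bar> * \<bar>X i \<omega>\<bar>" using a[OF i(1)] by (intro mult_right_mono) auto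
    also have "\<dots> = \<bar>S i - S (i - 1)\<bar>" using i by (cases i) (auto simp: S_def abs_mult)
    finally have "\<bar>S i\<bar> > u \<or> \<bar>S (i - 1)\<bar> > u" by linarith
    moreover have "S 0 = 0" by (simp add: S_def)
    ultimately have "\<bar>S i\<bar> > u \<or> i - 1 \<ge> 1 \<and> \<bar>S (i - 1)\<bar> > u" using u by (cases "i - 1 = 0") auto
    then have "\<exists>k\<in>{1..n}. \<bar>S k\<bar> > u"
    proof
      assume "\<bar>S i\<bar> > u"
      then show ?thesis using i by (intro bexI[of _ i]) auto
    next
      assume "i - 1 \<ge> 1 \<and> \<bar>S (i - 1)\<bar> > u"
      then show ?thesis using i by (intro bexI[of _ "i - 1"]) auto
    qed
    then show "\<omega> \<in> max_exceeds a X n u" using w by (simp add: max_exceeds_def S_def)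
  qed
  ultimately show ?thesis by (simp add: v_def y_def)
qed

lemma min_scaled_tail_mono:
  assumes X: "X \<in> H" and "m \<le> n" "y \<le> x"
  shows "min 1 (real m * tail X x) \<le> min 1 (real n * tail X y)"
  using assms antimonoD[OF tail_antimono[OF X], of y x] tail_bounds[OF X]
  by (intro min.mono mult_mono) auto

text \<open>
  For $n$ between $N$ and $2N$ and $x \in [0,1]$ the arguments $D n^q (x+1)^{1/p}$ are at most
  $D\zeta N^q$: the two factors of $\zeta$ come from $(x+1)^{1/p}$ and from $n \le 2N$. If $N
  v(D\zeta N^q)$ exceeded $1$, these terms would contribute a multiple of $N^{r-1}$ to the series,
  which is impossible for large $N$.
\<close>
lemma tail_small_of_excess_series:
  assumes X0: "X0 \<in> H" and p: "p > 0" and r: "r > 1" and q: "q > 0" and D: "D > 0"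
    and low: "\<And>n u. n \<ge> n0 \<Longrightarrow> n \<ge> 1 \<Longrightarrow> u \<ge> 0 \<Longrightarrow>
      min 1 (real n * tail X0 (D * real n powr q * u)) / 4 \<le> cap (max_exceeds a X n u)"
    and series: "(\<Sum>n. ennreal (real (Suc n) powr (r - 2)) * excess_integral a X p 1 (Suc n)) < \<infinity>"
    and \<zeta>_def: "\<zeta> = 2 powr (1 / p) * 2 powr q"
  shows "\<exists>N. \<forall>n\<ge>N. real n * tail X0 (D * \<zeta> * real n powr q) \<le> 1"
proof -
  define v where "v = tail X0"
  have v: "0 \<le> v u" "v u \<le> 1" for u using tail_bounds[OF X0] by (auto simp: v_def)
  define f where "f n = ennreal (real (Suc n) powr (r - 2)) * excess_integral a X p 1 (Suc n)" for n
  obtain T where T: "(\<Sum>n. f n) = ennreal T" "T \<ge> 0"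
    using series unfolding f_def by (cases "\<Sum>n. f n") (auto simp: f_def)
  \<comment> \<open>The constant with $n^{r-2} \ge c_2 N^{r-2}$ for $N \le n \le 2N$, whatever the sign of $r - 2$.\<close>
  define c2 where "c2 = min 1 (2 powr (r - 2))"
  have c2: "c2 > 0" by (simp add: c2_def)
  have block: "c2 * real (Suc k) powr (r - 1) * (min 1 (real (Suc k) * v (D * \<zeta> * real (Suc k) powr q)) / 4) \<le> T"
    if k: "k \<ge> n0" for k
  proof -
    define N where "N = Suc k"
    define m where "m = min 1 (real N * v (D * \<zeta> * real N powr q)) / 4"
    have m0: "m \<ge> 0" using v by (simp add: m_def)
    have each: "ennreal (c2 * real N powr (r - 2) * m) \<le> f j" if j: "j \<in> {k..2*k}" for j
    proof -
      define n where "n = Suc j"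
      have n: "N \<le> n" "n \<le> 2 * N" "n \<ge> n0" "n \<ge> 1" using j k by (auto simp: N_def n_def)
      have "c2 * real N powr (r - 2) \<le> real n powr (r - 2)"
      proof (cases "r \<ge> 2")
        case True
        have "c2 * real N powr (r - 2) \<le> 1 * real N powr (r - 2)"
          by (intro mult_right_mono) (auto simp: c2_def)
        also have "\<dots> \<le> real n powr (r - 2)" using True n by (simp add: powr_mono2)
        finally show ?thesis .
      next
        case False
        have "c2 * real N powr (r - 2) \<le> 2 powr (r - 2) * real N powr (r - 2)"
          by (intro mult_right_mono) (auto simp: c2_def)
        also have "\<dots> = (2 * real N) powr (r - 2)" by (simp add: powr_mult)
        also have "\<dots> \<le> real n powr (r - 2)" using False n by (intro powr_mono2') auto
        finally show ?thesis .
      qed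
      moreover have "ennreal m \<le> excess_integral a X p 1 n"
      proof -
        have "m \<le> cap (max_exceeds a X n ((x + 1) powr (1 / p)))" if x: "x \<in> {0..1}" for x
        proof -
          have "real n powr q * (x + 1) powr (1 / p) \<le> (2 * real N) powr q * 2 powr (1 / p)"
            using n x p q by (intro mult_mono powr_mono2) auto
          also have "\<dots> = \<zeta> * real N powr q" by (simp add: \<zeta>_def powr_mult)
          finally have "D * (real n powr q * (x + 1) powr (1 / p)) \<le> D * (\<zeta> * real N powr q)"
            using D by (intro mult_left_mono) auto
          then have "m \<le> min 1 (real n * v (D * real n powr q * (x + 1) powr (1 / p))) / 4"
            unfolding m_def v_def using n
            by (intro divide_right_mono min_scaled_tail_mono X0) (auto simp: mult.assoc)
          also have "\<dots> \<le> cap (max_exceeds a X n ((x + 1) powr (1 / p)))"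
            using n by (unfold v_def, intro low) auto
          finally show ?thesis .
        qed
        then have pt: "ennreal m * indicator {0..1} x
            \<le> ennreal (cap (max_exceeds a X n ((x + 1) powr (1 / p)))) * indicator {0..} x" for x
          by (cases "x \<in> {0..1}") (auto intro!: ennreal_leI)
        have "(\<integral>\<^sup>+x\<in>{0..1::real}. ennreal m \<partial>lborel) \<le> excess_integral a X p 1 n"
          unfolding excess_integral_def by (intro nn_integral_mono pt)
        then show ?thesis by (simp add: nn_integral_cmult_indicator)
      qed
      ultimately have "ennreal (c2 * real N powr (r - 2)) * ennreal m \<le> f j"
        unfolding f_def n_def by (intro mult_mono ennreal_leI) auto
      then show ?thesis using c2 m0 by (simp add: ennreal_mult)
    qed
    have "ennreal (real (Suc k) * (c2 * real N powr (r - 2) * m)) = (\<Sum>j\<in>{k..2*k}. ennreal (c2 * real N powr (r - 2) * m))"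
      using c2 m0 by (simp add: ennreal_mult ennreal_of_nat_eq_real_of_nat)
    also have "\<dots> \<le> (\<Sum>j\<in>{k..2*k}. f j)" by (intro sum_mono each)
    also have "\<dots> \<le> (\<Sum>j. f j)" by (intro sum_le_suminf summableI) auto
    finally have "real N * (c2 * real N powr (r - 2) * m) \<le> T"
      unfolding T(1) N_def[symmetric] using T(2) by (simp add: ennreal_le_iff)
    moreover have "real N * real N powr (r - 2) = real N powr (r - 1)"
    proof -
      have "real N powr 1 * real N powr (r - 2) = real N powr (r - 1)"
        unfolding powr_add[symmetric] by simp
      then show ?thesis by (simp add: N_def)
    qed
    ultimately have "c2 * real N powr (r - 1) * m \<le> T" by (simp add: mult_ac)
    then show ?thesis unfolding m_def N_def .
  qed
  have "filterlim (\<lambda>n. real n powr (r - 1)) at_top sequentially"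
    using r by (intro filterlim_compose[OF filterlim_powr_at_top filterlim_real_sequentially]) auto
  then have "eventually (\<lambda>n. 4 * T / c2 + 1 \<le> real n powr (r - 1)) sequentially"
    by (simp add: filterlim_at_top)
  then obtain N2 where N2: "\<And>n. n \<ge> N2 \<Longrightarrow> 4 * T / c2 + 1 \<le> real n powr (r - 1)"
    by (auto simp: eventually_sequentially)
  show ?thesis
  proof (intro exI[of _ "max N2 (Suc n0)"] allI impI)
    fix n assume n: "n \<ge> max N2 (Suc n0)"
    then obtain k where k: "n = Suc k" "k \<ge> n0" by (cases n) auto
    define z where "z = real n * v (D * \<zeta> * real n powr q)"
    have "z \<le> 1"
    proof (rule ccontr)
      assume "\<not> z \<le> 1"
      then have "min 1 (real (Suc k) * v (D * \<zeta> * real (Suc k) powr q)) = 1" using k by (simp add: z_def)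
      with block[OF k(2)] have "c2 * real n powr (r - 1) \<le> 4 * T" using k by simp
      moreover have "c2 * (4 * T / c2 + 1) \<le> c2 * real n powr (r - 1)"
        using N2[of n] n c2 by (intro mult_left_mono) auto
      moreover have "c2 * (4 * T / c2 + 1) = 4 * T + c2" using c2 by (simp add: field_simps)
      ultimately show False using c2 by linarith
    qed
    then show "real n * tail X0 (D * \<zeta> * real n powr q) \<le> 1" by (simp add: z_def v_def)
  qed
qed

text \<open>
  The converse of the Tonelli argument in \<open>weighted_tail_sum_finite\<close>: the coefficient
  $n^{-q}$ enters exactly for $n \le t^{1/q}$, and the resulting sum of $n^{r-1-qp}$ is bounded
  below by a multiple of $\Lambda(t)$.
\<close>
lemma tail_integral_finite_of_weighted_tail_series:
  assumes X0: "X0 \<in> H" and q: "q > 0" and s: "s = r / q"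
    and \<kappa>: "\<kappa> > 0" and n1: "n1 \<ge> 1"
    and fin: "(\<Sum>n. if Suc n \<ge> n1 then ennreal (real (Suc n) powr (r - 1))
      * weighted_tail X0 p \<kappa> (real (Suc n) powr (- q)) else 0) < \<infinity>"
  shows "tail_integral X0 s p 1 < \<infinity>"
proof -
  define v where "v = tail X0"
  have v: "0 \<le> v u" "v u \<le> 1" for u using tail_bounds[OF X0] by (auto simp: v_def)
  have vm [measurable]: "v \<in> borel_measurable borel" unfolding v_def by (rule tail_measurable[OF X0])
  define G where "G n t = (if n \<ge> n1 then real n powr (r - 1) * (v (\<kappa> * t) * (t powr (p - 1)
      * (if 1 / t \<le> real n powr (- q) then (real n powr (- q)) powr p else 0))) else 0)" for n and t :: real
  have G0: "G n t \<ge> 0" for n t using v by (simp add: G_def)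
  have Gm [measurable]: "G n \<in> borel_measurable borel" for n
  proof (cases "n \<ge> n1")
    case True
    then show ?thesis unfolding G_def by simp
  qed (simp add: G_def[abs_def])
  have Gint: "(\<Sum>n. \<integral>\<^sup>+t\<in>{1..}. ennreal (G (Suc n) t) \<partial>lborel) < \<infinity>"
  proof -
    have "(\<integral>\<^sup>+t\<in>{1..}. ennreal (G n t) \<partial>lborel)
        = (if n \<ge> n1 then ennreal (real n powr (r - 1)) * weighted_tail X0 p \<kappa> (real n powr (- q)) else 0)" for n
    proof (cases "n \<ge> n1")
      case True
      have "(\<integral>\<^sup>+t\<in>{1..}. ennreal (G n t) \<partial>lborel)
          = (\<integral>\<^sup>+t. ennreal (real n powr (r - 1)) * (ennreal (v (\<kappa> * t) * (t powr (p - 1)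
            * (if 1 / t \<le> real n powr (- q) then (real n powr (- q)) powr p else 0))) * indicator {1..} t) \<partial>lborel)"
        unfolding G_def using True v
        by (intro nn_integral_cong) (auto simp: ennreal_mult[symmetric] indicator_def)
      also have "\<dots> = ennreal (real n powr (r - 1)) * weighted_tail X0 p \<kappa> (real n powr (- q))"
        unfolding weighted_tail_def v_def[symmetric] by (rule nn_integral_cmult) measurable
      finally show ?thesis using True by simp
    qed (simp add: G_def)
    with fin show ?thesis by simp
  qed
  obtain c t0 where c: "c > 0" and t0: "t0 \<ge> 1" and lower: "\<And>t. t \<ge> t0 \<Longrightarrow> c * moment_weight s p t
      \<le> (\<Sum>n=n1..nat \<lfloor>t powr (1/q)\<rfloor>. real n powr (r - q * p - 1))"
    using weighted_sum_lower[OF q s n1] by blast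
  have Wm [measurable]: "(\<lambda>t. v (\<kappa> * t) * (t powr (p - 1) * moment_weight s p t)) \<in> borel_measurable borel" by measurable
  have big: "(\<integral>\<^sup>+t\<in>{t0..}. ennreal (v (\<kappa> * t) * (t powr (p - 1) * moment_weight s p t)) \<partial>lborel) < \<infinity>"
  proof -
    have "ennreal c * (\<integral>\<^sup>+t\<in>{t0..}. ennreal (v (\<kappa> * t) * (t powr (p - 1) * moment_weight s p t)) \<partial>lborel)
        = (\<integral>\<^sup>+t. ennreal c * (ennreal (v (\<kappa> * t) * (t powr (p - 1) * moment_weight s p t)) * indicator {t0..} t) \<partial>lborel)"
      by (rule nn_integral_cmult[symmetric]) measurable
    also have "\<dots> \<le> (\<integral>\<^sup>+t. (\<Sum>n. ennreal (G (Suc n) t) * indicator {1..} t) \<partial>lborel)"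
    proof (intro nn_integral_mono)
      fix t :: real
      show "ennreal c * (ennreal (v (\<kappa> * t) * (t powr (p - 1) * moment_weight s p t)) * indicator {t0..} t)
          \<le> (\<Sum>n. ennreal (G (Suc n) t) * indicator {1..} t)"
      proof (cases "t \<ge> t0")
        case True
        then have t1: "t \<ge> 1" using t0 by simp
        define K where "K = nat \<lfloor>t powr (1/q)\<rfloor>"
        define x where "x = v (\<kappa> * t) * t powr (p - 1)"
        have x: "x \<ge> 0" using v by (simp add: x_def)
        have Gn: "G n t = x * real n powr (r - q * p - 1)" if n: "n \<in> {n1..K}" for n
        proof -
          have n1': "n \<ge> 1" using n n1 by auto
          have "real n \<le> t powr (1/q)" using n unfolding K_def by (simp add: le_nat_iff le_floor_iff)
          then have "real n powr q \<le> (t powr (1/q)) powr q" using q by (intro powr_mono2) auto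
          then have "real n powr q \<le> t" using q t1 by (simp add: powr_powr)
          then have "1 / t \<le> real n powr (- q)"
            using n1' t1 by (simp add: powr_minus_divide frac_le)
          moreover have "real n powr (r - 1) * (real n powr (- q)) powr p = real n powr (r - q * p - 1)"
            unfolding powr_powr powr_add[symmetric] by (simp add: algebra_simps)
          ultimately show ?thesis using n by (simp add: G_def x_def mult_ac)
        qed
        have "ennreal c * ennreal (v (\<kappa> * t) * (t powr (p - 1) * moment_weight s p t))
            = ennreal (x * (c * moment_weight s p t))"
          using c v moment_weight_nonneg[OF t1, of s p] by (simp add: ennreal_mult[symmetric] x_def mult_ac)
        also have "\<dots> \<le> ennreal (x * (\<Sum>n=n1..K. real n powr (r - q * p - 1)))"
          using lower[OF True] x by (intro ennreal_leI mult_left_mono) (auto simp: K_def)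
        also have "x * (\<Sum>n=n1..K. real n powr (r - q * p - 1)) = (\<Sum>n=n1..K. G n t)"
          by (simp add: sum_distrib_left Gn)
        also have "\<dots> = (\<Sum>j\<in>{n1 - 1..<K}. G (Suc j) t)"
          using n1 by (intro sum.reindex_bij_witness[of _ Suc "\<lambda>n. n - 1"]) auto
        also have "ennreal \<dots> = (\<Sum>j\<in>{n1 - 1..<K}. ennreal (G (Suc j) t))"
          using G0 by (intro sum_ennreal[symmetric])
        also have "\<dots> \<le> (\<Sum>j. ennreal (G (Suc j) t))" by (intro sum_le_suminf summableI) auto
        finally show ?thesis using True t1 by simp
      qed simp
    qed
    also have "\<dots> = (\<Sum>n. \<integral>\<^sup>+t\<in>{1..}. ennreal (G (Suc n) t) \<partial>lborel)"
      by (rule nn_integral_suminf) measurable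
    also note Gint
    finally show ?thesis using c by (auto simp: ennreal_mult_less_top)
  qed
  have "tail_integral X0 s p \<kappa>
      \<le> (\<integral>\<^sup>+t\<in>{1..t0}. ennreal (v (\<kappa> * t) * (t powr (p - 1) * moment_weight s p t)) \<partial>lborel)
        + (\<integral>\<^sup>+t\<in>{t0..}. ennreal (v (\<kappa> * t) * (t powr (p - 1) * moment_weight s p t)) \<partial>lborel)"
    unfolding tail_integral_def v_def[symmetric] by (intro nn_integral_split_at Wm t0)
  also have "(\<integral>\<^sup>+t\<in>{1..t0}. ennreal (v (\<kappa> * t) * (t powr (p - 1) * moment_weight s p t)) \<partial>lborel)
      \<le> ennreal (t0 powr \<bar>p - 1\<bar> * moment_weight s p t0 * (t0 - 1))"
  proof (rule nn_integral_interval_le)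
    fix t assume t: "t \<in> {1..t0}"
    have "v (\<kappa> * t) * (t powr (p - 1) * moment_weight s p t) \<le> 1 * (t powr (p - 1) * moment_weight s p t)"
      using v moment_weight_nonneg[of t s p] t by (intro mult_right_mono) auto
    also have "\<dots> \<le> t0 powr \<bar>p - 1\<bar> * moment_weight s p t0"
      using powr_moment_weight_le[of t t0 p s] t by simp
    finally show "v (\<kappa> * t) * (t powr (p - 1) * moment_weight s p t) \<le> t0 powr \<bar>p - 1\<bar> * moment_weight s p t0" .
  qed (use t0 moment_weight_nonneg[OF t0] in auto)
  finally have "tail_integral X0 s p \<kappa> < \<infinity>" using big by (auto simp: order.strict_trans1)
  then show ?thesis by (rule tail_integral_scale[OF X0 \<kappa> zero_less_one])
qed

text \<open>
  With $\epsilon = \zeta^p$ every level in the integral is at least $\zeta$, so the minimum in the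
  lower bound is $n v$ for all large $n$, and \<open>weighted_tail_eq\<close> with coefficient
  $n^{-q}$ applies.
\<close>
proposition tail_integral_finite_of_excess_series:
  assumes X0: "X0 \<in> H" and XH: "\<And>i. i \<ge> 1 \<Longrightarrow> X i \<in> H" and ind: "indep_seq H \<E> X"
    and tails: "\<And>i. i \<ge> 1 \<Longrightarrow> tail (X i) = tail X0"
    and p: "p > 0" and r: "r > 1" and q: "q > 0" and s: "s = r / q"
    and C: "C > 0" and a: "\<And>n i. n \<ge> n0 \<Longrightarrow> i \<in> {1..n} \<Longrightarrow> model_coeff q \<beta> n i / C \<le> a n i"
    and series: "\<And>\<epsilon>. \<epsilon> > 0 \<Longrightarrow>
      (\<Sum>n. ennreal (real (Suc n) powr (r - 2)) * excess_integral a X p \<epsilon> (Suc n)) < \<infinity>"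
  shows "tail_integral X0 s p 1 < \<infinity>"
proof -
  define v where "v = tail X0"
  have v: "0 \<le> v u" for u using tail_bounds[OF X0] by (simp add: v_def)
  have vm [measurable]: "v \<in> borel_measurable borel" unfolding v_def by (rule tail_measurable[OF X0])
  \<comment> \<open>On the upper half of the $n$-th row the coefficients are at least $c_1 n^{-q}$.\<close>
  define c1 where "c1 = min 1 (2 powr (- \<beta>)) / C"
  have c1: "c1 > 0" using C by (simp add: c1_def)
  define D where "D = 2 / c1"
  have D: "D > 0" using c1 by (simp add: D_def)
  have low: "min 1 (real n * v (D * real n powr q * u)) / 4 \<le> cap (max_exceeds a X n u)"
    if n: "n \<ge> n0" "n \<ge> 1" and u: "u \<ge> 0" for n u
  proof -
    have "min 1 (real n * tail X0 (2 * u / (c1 * real n powr (- q)))) / 4 \<le> cap (max_exceeds a X n u)"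
    proof (rule max_exceeds_lower_bound[OF X0 XH ind tails u])
      show "c1 * real n powr (- q) > 0" using c1 n by simp
      fix i assume i: "i \<in> {n div 2 + 1..n}"
      have "c1 * real n powr (- q) \<le> model_coeff q \<beta> n i / C"
        using model_coeff_upper_half[OF i, of \<beta> q] C by (simp add: c1_def divide_right_mono)
      also have "\<dots> \<le> a n i" using i by (intro a n) auto
      finally show "c1 * real n powr (- q) \<le> \<bar>a n i\<bar>" by simp
    qed
    also have "2 * u / (c1 * real n powr (- q)) = D * real n powr q * u"
      by (simp add: D_def powr_minus field_simps)
    finally show ?thesis by (simp add: v_def)
  qed
  define \<zeta> where "\<zeta> = 2 powr (1 / p) * 2 powr q"
  have \<zeta>: "\<zeta> > 0" by (simp add: \<zeta>_def)
  obtain N1 where N1: "\<And>n. n \<ge> N1 \<Longrightarrow> real n * v (D * \<zeta> * real n powr q) \<le> 1"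
    using tail_small_of_excess_series[OF X0 p r q D low[unfolded v_def] series[OF zero_less_one] \<zeta>_def]
    unfolding v_def by blast
  define n1 where "n1 = max 1 (max n0 N1)"
  have n1: "n1 \<ge> 1" "n1 \<ge> n0" "n1 \<ge> N1" by (auto simp: n1_def)
  define \<epsilon> where "\<epsilon> = \<zeta> powr p"
  have \<epsilon>: "\<epsilon> > 0" "\<epsilon> powr (1 / p) = \<zeta>" using \<zeta> p by (auto simp: \<epsilon>_def powr_powr)
  define \<kappa> where "\<kappa> = D * \<zeta>"
  have \<kappa>: "\<kappa> > 0" using D \<zeta> by (simp add: \<kappa>_def)
  define w where "w n = weighted_tail X0 p \<kappa> (real n powr (- q))" for n
  define e where "e = p * \<epsilon> / 4"
  have e: "e > 0" using p \<epsilon> by (simp add: e_def)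
  have excess: "ennreal (e * real n) * w n \<le> excess_integral a X p \<epsilon> n" if n: "n \<ge> n1" for n
  proof -
    have nn: "n \<ge> 1" "n \<ge> n0" "n \<ge> N1" using n n1 by auto
    have b: "0 < real n powr (- q)" "real n powr (- q) \<le> 1"
      using nn q powr_mono[of "- q" 0 "real n"] by auto
    have "ennreal (real n / 4) * (\<integral>\<^sup>+x\<in>{0..}. ennreal (v ((x + \<epsilon>) powr (1 / p) / (1 / D * real n powr (- q)))) \<partial>lborel)
        = (\<integral>\<^sup>+x. ennreal (real n / 4) * (ennreal (v ((x + \<epsilon>) powr (1 / p) / (1 / D * real n powr (- q)))) * indicator {0..} x) \<partial>lborel)"
      by (rule nn_integral_cmult[symmetric]) measurable
    also have "\<dots> \<le> excess_integral a X p \<epsilon> n"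
      unfolding excess_integral_def
    proof (intro nn_integral_mono)
      fix x :: real
      show "ennreal (real n / 4) * (ennreal (v ((x + \<epsilon>) powr (1 / p) / (1 / D * real n powr (- q)))) * indicator {0..} x)
        \<le> ennreal (cap (max_exceeds a X n ((x + \<epsilon>) powr (1 / p)))) * indicator {0..} x"
      proof (cases "x \<ge> 0")
        case True
        define u where "u = (x + \<epsilon>) powr (1 / p)"
        have "\<zeta> \<le> u" unfolding u_def \<epsilon>(2)[symmetric] using True \<epsilon> p by (intro powr_mono2) auto
        then have "D * \<zeta> * real n powr q \<le> D * u * real n powr q"
          using D by (intro mult_right_mono mult_left_mono) auto
        then have "v (D * real n powr q * u) \<le> v (D * \<zeta> * real n powr q)"
          unfolding v_def by (intro antimonoD[OF tail_antimono[OF X0]]) (simp add: mult_ac)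
        then have "real n * v (D * real n powr q * u) \<le> real n * v (D * \<zeta> * real n powr q)"
          by (intro mult_left_mono) auto
        then have "real n * v (D * real n powr q * u) \<le> 1" using N1[OF nn(3)] by linarith
        then have "real n / 4 * v (D * real n powr q * u) \<le> cap (max_exceeds a X n u)"
          using low[OF nn(2,1), of u] by (simp add: u_def)
        moreover have "D * real n powr q * u = u / (1 / D * real n powr (- q))"
          by (simp add: powr_minus field_simps)
        ultimately have "real n / 4 * v (u / (1 / D * real n powr (- q))) \<le> cap (max_exceeds a X n u)" by simp
        then show ?thesis using True v by (simp add: u_def ennreal_mult[symmetric] ennreal_leI)
      qed simp
    qed
    also have "(\<integral>\<^sup>+x\<in>{0..}. ennreal (v ((x + \<epsilon>) powr (1 / p) / (1 / D * real n powr (- q)))) \<partial>lborel)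
        = ennreal (p * \<epsilon>) * w n"
      unfolding v_def w_def using weighted_tail_eq[OF X0 b p \<epsilon>(1), of "1 / D"] D
      by (simp add: \<epsilon>(2) \<kappa>_def mult.commute)
    finally have "ennreal (real n / 4) * (ennreal (p * \<epsilon>) * w n) \<le> excess_integral a X p \<epsilon> n" .
    moreover have "ennreal (real n / 4) * ennreal (p * \<epsilon>) = ennreal (e * real n)"
      using p \<epsilon> by (simp add: ennreal_mult[symmetric] e_def mult_ac)
    ultimately show ?thesis by (simp add: mult.assoc[symmetric])
  qed
  have "(\<Sum>n. if Suc n \<ge> n1 then ennreal (real (Suc n) powr (r - 1)) * w (Suc n) else 0)
      \<le> (\<Sum>n. ennreal (1 / e) * (ennreal (real (Suc n) powr (r - 2)) * excess_integral a X p \<epsilon> (Suc n)))"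
  proof (intro suminf_le summableI)
    fix k
    define n where "n = Suc k"
    have "ennreal (real n powr (r - 1)) * w n
        \<le> ennreal (1 / e) * (ennreal (real n powr (r - 2)) * excess_integral a X p \<epsilon> n)" if "n \<ge> n1"
    proof -
      have "real n powr (r - 1) = 1 / e * (real n powr (r - 2) * (e * real n))"
      proof -
        have "real n powr (r - 2) * real n powr 1 = real n powr (r - 1)"
          unfolding powr_add[symmetric] by simp
        then show ?thesis using e by (simp add: n_def)
      qed
      then have "ennreal (real n powr (r - 1)) * w n
          = ennreal (1 / e) * (ennreal (real n powr (r - 2)) * (ennreal (e * real n) * w n))"
        using e by (simp only: ennreal_mult mult_nonneg_nonneg powr_ge_zero of_nat_0_le_iff divide_nonneg_nonneg
          less_imp_le zero_le_one mult.assoc)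
      also have "\<dots> \<le> ennreal (1 / e) * (ennreal (real n powr (r - 2)) * excess_integral a X p \<epsilon> n)"
        by (intro mult_left_mono excess that) auto
      finally show ?thesis .
    qed
    then show "(if Suc k \<ge> n1 then ennreal (real (Suc k) powr (r - 1)) * w (Suc k) else 0)
        \<le> ennreal (1 / e) * (ennreal (real (Suc k) powr (r - 2)) * excess_integral a X p \<epsilon> (Suc k))"
      by (simp add: n_def)
  qed
  also have "\<dots> < \<infinity>"
    using series[OF \<epsilon>(1)] by (simp add: ennreal_suminf_cmult ennreal_mult_less_top)
  finally show ?thesis
    unfolding w_def by (rule tail_integral_finite_of_weighted_tail_series[OF X0 q s \<kappa> n1(1)])
qed

section \<open>The equivalence\<close>

text \<open>
  Indicators of level sets are admissible test functions, with finite expectation.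
\<close>
lemma ident_distrib_tail_eq:
  assumes "Y \<in> H" "X \<in> H" "ident_distrib H \<E> Y X"
  shows "tail Y = tail X"
proof
  fix u
  define \<psi> where "\<psi> = (\<lambda>z::real. of_bool (\<bar>z\<bar> > u) :: real)"
  have \<psi>: "\<psi> \<in> borel_measurable borel" unfolding \<psi>_def by measurable
  have H: "(\<lambda>\<omega>. \<psi> (Z \<omega>)) \<in> H" "\<bar>\<E> (\<lambda>\<omega>. \<psi> (Z \<omega>))\<bar> < \<infinity>" "cap {\<omega> \<in> space M. \<bar>Z \<omega>\<bar> > u} = mean (\<lambda>\<omega>. \<psi> (Z \<omega>))"
    if "Z \<in> H" for Z
  proof -
    show ZH: "(\<lambda>\<omega>. \<psi> (Z \<omega>)) \<in> H" unfolding \<psi>_def by (rule H_event[OF sets_abs_greater[OF that]])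
    have "bounded_rv (\<lambda>\<omega>. \<psi> (Z \<omega>))" by (rule bounded_rvI[OF ZH, of 1]) (simp add: \<psi>_def)
    then show "\<bar>\<E> (\<lambda>\<omega>. \<psi> (Z \<omega>))\<bar> < \<infinity>" by (simp add: E_eq_mean)
    show "cap {\<omega> \<in> space M. \<bar>Z \<omega>\<bar> > u} = mean (\<lambda>\<omega>. \<psi> (Z \<omega>))"
      unfolding cap_eq_mean mean_def
      by (rule arg_cong[where f=real_of_ereal], rule E_cong)
        (use sets_abs_greater[OF that] in \<open>auto simp: \<psi>_def intro: H_indicator\<close>)
  qed
  have "\<E> (\<lambda>\<omega>. \<psi> (Y \<omega>)) = \<E> (\<lambda>\<omega>. \<psi> (X \<omega>))"
    using assms \<psi> H by (auto simp: ident_distrib_def)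
  then show "tail Y u = tail X u" using assms H by (simp add: tail_def mean_def)
qed

text \<open>
  The upper bound is domination by $|X|$. If $E[X]$ were $-\infty$, sub-additivity applied to $X +
  (-X) = 0$ would give $0 \le -\infty$.
\<close>
lemma finite_E_of_finite_moment:
  assumes ca: "countably_subadditive_exp M H \<E>" and X: "X \<in> H" and fin: "abs_moment X 1 < \<infinity>"
  shows "\<bar>\<E> X\<bar> < \<infinity>"
proof -
  define \<mu> where "\<mu> = enn2real (abs_moment X 1)"
  have \<mu>: "abs_moment X 1 \<le> ennreal \<mu>" "\<mu> \<ge> 0" using fin by (simp_all add: \<mu>_def)
  have nX: "(\<lambda>\<omega>. - X \<omega>) \<in> H" using H_cmult[OF X, of "-1"] by simp
  have abs: "\<E> (\<lambda>\<omega>. \<bar>X \<omega>\<bar>) \<le> ereal (1 * \<mu>)"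
    by (rule E_dominated_by_moment[OF ca X H_abs[OF X] _ _ _ _ \<mu>]) auto
  have "\<E> X \<le> \<E> (\<lambda>\<omega>. \<bar>X \<omega>\<bar>)" by (intro mono H_abs X) auto
  with abs have up: "\<E> X \<le> ereal \<mu>" by (auto intro: order_trans)
  have "\<E> (\<lambda>\<omega>. - X \<omega>) \<le> \<E> (\<lambda>\<omega>. \<bar>X \<omega>\<bar>)" by (intro mono H_abs X nX) auto
  with abs have up': "\<E> (\<lambda>\<omega>. - X \<omega>) \<le> ereal \<mu>" by (auto intro: order_trans)
  have "\<E> X \<noteq> - \<infinity>"
  proof
    assume m: "\<E> X = - \<infinity>"
    have "\<E> (\<lambda>\<omega>. X \<omega> + - X \<omega>) \<le> \<E> X + \<E> (\<lambda>\<omega>. - X \<omega>)"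
      using m up' by (intro subadditive X nX) auto
    then show False using m up' const[of 0] by (cases "\<E> (\<lambda>\<omega>. - X \<omega>)") auto
  qed
  with up show ?thesis by (cases "\<E> X") auto
qed

text \<open>
  Identical distribution transfers only finite expectations, so the first moment has to be known
  to be finite before the centring of $X$ can be transferred to the sequence.
\<close>
lemma ident_distrib_E_eq:
  assumes ca: "countably_subadditive_exp M H \<E>" and Y: "Y \<in> H" and X: "X \<in> H"
    and id: "ident_distrib H \<E> Y X" and fin: "abs_moment X 1 < \<infinity>"
  shows "\<E> Y = \<E> X \<and> \<E> (\<lambda>\<omega>. - Y \<omega>) = \<E> (\<lambda>\<omega>. - X \<omega>)"
proof -
  have t: "tail Y = tail X" by (rule ident_distrib_tail_eq[OF Y X id])
  have nH: "(\<lambda>\<omega>. - Z \<omega>) \<in> H" if "Z \<in> H" for Z using H_cmult[OF that, of "-1"] by simp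
  have finY: "abs_moment Y 1 < \<infinity>" using fin t by (simp add: abs_moment_def)
  have neg: "abs_moment (\<lambda>\<omega>. - Z \<omega>) 1 = abs_moment Z 1" for Z by (simp add: abs_moment_def tail_def)
  have "\<E> (\<lambda>\<omega>. \<psi> (Y \<omega>)) = \<E> (\<lambda>\<omega>. \<psi> (X \<omega>))"
    if "\<psi> \<in> borel_measurable borel" "(\<lambda>\<omega>. \<psi> (Y \<omega>)) \<in> H" "(\<lambda>\<omega>. \<psi> (X \<omega>)) \<in> H"
      "abs_moment (\<lambda>\<omega>. \<psi> (Y \<omega>)) 1 < \<infinity>" "abs_moment (\<lambda>\<omega>. \<psi> (X \<omega>)) 1 < \<infinity>" for \<psi>
    using id that finite_E_of_finite_moment[OF ca] unfolding ident_distrib_def by blast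
  from this[of "\<lambda>z. z"] this[of uminus] show ?thesis
    using X Y fin finY nH by (simp add: neg)
qed

end

theorem theorem3p1:
  fixes M :: "'a measure" and H :: "('a \<Rightarrow> real) set" and \<E> :: "('a \<Rightarrow> real) \<Rightarrow> ereal"
    and X :: "nat \<Rightarrow> 'a \<Rightarrow> real" and X0 :: "'a \<Rightarrow> real"
    and a :: "nat \<Rightarrow> nat \<Rightarrow> real" and p r q \<beta> :: real
  assumes "sublinear_expectation_space M H \<E>"
    and "countably_subadditive_exp M H \<E>"
    and "X0 \<in> H" and "\<And>n. n \<ge> 1 \<Longrightarrow> X n \<in> H"
    and "indep_seq H \<E> X"
    and "\<And>n. n \<ge> 1 \<Longrightarrow> ident_distrib H \<E> (X n) X0"
    and "p > 0" and "r > 1" and "q > 1/2" and "\<beta> > - q / r"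
    and "q \<le> 1 \<Longrightarrow> \<E> X0 = 0 \<and> - \<E> (\<lambda>\<omega>. - X0 \<omega>) = 0"
    and "array_approx a (\<lambda>n i. (real i / real n) powr \<beta> * (1 / real n powr q))"
  shows
    "((p > r / q \<longrightarrow> choquet M \<E> (\<lambda>\<omega>. \<bar>X0 \<omega>\<bar> powr p) < \<infinity>) \<and>
      (p = r / q \<longrightarrow> choquet M \<E> (\<lambda>\<omega>. \<bar>X0 \<omega>\<bar> powr (r / q) * ln \<bar>X0 \<omega>\<bar>) < \<infinity>) \<and>
      (p < r / q \<longrightarrow> choquet M \<E> (\<lambda>\<omega>. \<bar>X0 \<omega>\<bar> powr (r / q)) < \<infinity>))
     \<longleftrightarrow>
     (\<forall>\<epsilon>>0.
        (\<Sum>n. ereal (real (Suc n) powr (r - 2)) *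
           choquet M \<E> (\<lambda>\<omega>. max 0
             (Max ((\<lambda>k. \<bar>\<Sum>i=1..k. a (Suc n) i * X i \<omega>\<bar> powr p) ` {1..Suc n}) - \<epsilon>))) < \<infinity>)"
proof -
  interpret sublinear_expectation_space M H \<E> by (rule assms(1))
  note ca = assms(2) and X0 = assms(3) and XH = assms(4) and ind = assms(5) and id = assms(6)
    and p = assms(7) and r = assms(8) and q = assms(9) and \<beta> = assms(10)
  have q0: "q > 0" using q by simp
  define s where "s = r / q"
  have s: "s > 0" using r q0 by (simp add: s_def)
  have tails: "tail (X i) = tail X0" if "i \<ge> 1" for i
    by (rule ident_distrib_tail_eq[OF XH[OF that] X0 id[OF that]])
  obtain C n0 where C: "C \<ge> 1"
    and approx: "\<And>n i. n \<ge> n0 \<Longrightarrow> i \<in> {1..n} \<Longrightarrow> inverse C * model_coeff q \<beta> n i \<le> a n i"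
      "\<And>n i. n \<ge> n0 \<Longrightarrow> i \<in> {1..n} \<Longrightarrow> a n i \<le> C * model_coeff q \<beta> n i"
    using assms(12) unfolding array_approx_def eventually_sequentially model_coeff_def[symmetric] by blast
  have C0: "C > 0" using C by simp
  have lower: "model_coeff q \<beta> n i / C \<le> a n i" if "n \<ge> n0" "i \<in> {1..n}" for n i
    using approx(1)[OF that] by (simp add: divide_inverse mult.commute)
  have upper: "\<bar>a n i\<bar> \<le> C * model_coeff q \<beta> n i" if "n \<ge> n0" "i \<in> {1..n}" for n i
  proof -
    have "0 \<le> model_coeff q \<beta> n i / C" using C0 by (simp add: model_coeff_def)
    then show ?thesis using lower[OF that] approx(2)[OF that] by linarith
  qed
  have series: "(\<Sum>n. ereal (real (Suc n) powr (r - 2)) *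
      choquet M \<E> (\<lambda>\<omega>. max 0 (Max ((\<lambda>k. \<bar>\<Sum>i=1..k. a (Suc n) i * X i \<omega>\<bar> powr p) ` {1..Suc n}) - \<epsilon>))) < \<infinity>
    \<longleftrightarrow> (\<Sum>n. ennreal (real (Suc n) powr (r - 2)) * excess_integral a X p \<epsilon> (Suc n)) < \<infinity>"
    if \<epsilon>: "\<epsilon> > 0" for \<epsilon>
  proof -
    have "ereal (real (Suc n) powr (r - 2)) *
        choquet M \<E> (\<lambda>\<omega>. max 0 (Max ((\<lambda>k. \<bar>\<Sum>i=1..k. a (Suc n) i * X i \<omega>\<bar> powr p) ` {1..Suc n}) - \<epsilon>))
      = enn2ereal (ennreal (real (Suc n) powr (r - 2)) * excess_integral a X p \<epsilon> (Suc n))" for n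
      by (subst choquet_excess_eq[OF XH _ p \<epsilon>]) (simp_all add: times_ennreal.rep_eq enn2ereal_ennreal)
    then have "(\<Sum>n. ereal (real (Suc n) powr (r - 2)) *
        choquet M \<E> (\<lambda>\<omega>. max 0 (Max ((\<lambda>k. \<bar>\<Sum>i=1..k. a (Suc n) i * X i \<omega>\<bar> powr p) ` {1..Suc n}) - \<epsilon>)))
      = enn2ereal (\<Sum>n. ennreal (real (Suc n) powr (r - 2)) * excess_integral a X p \<epsilon> (Suc n))"
      by (simp only: suminf_enn2ereal)
    then show ?thesis by (simp add: less_ennreal.rep_eq)
  qed
  have centred: "\<E> (X i) = 0 \<and> \<E> (\<lambda>\<omega>. - X i \<omega>) = 0"
    if fin: "tail_integral X0 s p 1 < \<infinity>" and i: "i \<ge> 1" and q1: "q \<le> 1" for i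
  proof -
    have "1 \<le> s" using r q1 q0 by (simp add: s_def field_simps)
    then have "abs_moment X0 1 < \<infinity>" by (intro abs_moment_finite[OF X0 fin]) auto
    note eq = ident_distrib_E_eq[OF ca XH[OF i] X0 id[OF i] this]
    have "\<E> (\<lambda>\<omega>. - X0 \<omega>) = 0"
      using assms(11)[OF q1] by (cases "\<E> (\<lambda>\<omega>. - X0 \<omega>)") auto
    then show ?thesis using eq assms(11)[OF q1] by simp
  qed
  have "tail_integral X0 s p 1 < \<infinity>
    \<longleftrightarrow> (\<forall>\<epsilon>>0. (\<Sum>n. ennreal (real (Suc n) powr (r - 2)) * excess_integral a X p \<epsilon> (Suc n)) < \<infinity>)"
  proof (intro iffI allI impI)
    fix \<epsilon> :: real assume fin: "tail_integral X0 s p 1 < \<infinity>" and \<epsilon>: "\<epsilon> > 0"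
    show "(\<Sum>n. ennreal (real (Suc n) powr (r - 2)) * excess_integral a X p \<epsilon> (Suc n)) < \<infinity>"
      by (rule excess_series_finite[OF ca X0 XH ind tails centred[OF fin] p r q \<beta> s_def C0 upper fin \<epsilon>])
  next
    assume "\<forall>\<epsilon>>0. (\<Sum>n. ennreal (real (Suc n) powr (r - 2)) * excess_integral a X p \<epsilon> (Suc n)) < \<infinity>"
    then show "tail_integral X0 s p 1 < \<infinity>"
      by (intro tail_integral_finite_of_excess_series[OF X0 XH ind tails p r q0 s_def C0 lower]) auto
  qed
  then show ?thesis
    using moment_condition_iff_tail_integral[OF X0 p s] series unfolding s_def by simp
qed

end
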